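(* Let $ABC$ be any triangle, tiled by a tile with angles $(\alpha,\beta,2\pi/3)$ with non-commensurable angles, and suppose $ABC$ is not similar to the tile. Then the tile has commensurable sides, unless $ABC$ satisfies both of the following: (i) every tile supported by the boundary of $ABC$ has its $c$-edge on the boundary of $ABC$; and (ii) $ABC$ is either equilateral or has angles $(\pi/3, 2\alpha, 2\beta)$.
   Context: The tile is a triangle with side lengths $a,b,c$ opposite the angles $\alpha,\beta,2\pi/3$ respectively; a tiling of $ABC$ is an expression of $ABC$ as a union of non-overlapping congruent copies of the tile. Non-commensurable angles means not all angles are rational multiples of $\pi$; commensurable sides means all pairwise ratios of $a,b,c$ are rational. A tile is supported by a segment if one of its edges lies on that segment. *)

theory Defs
  imports "HOL-Analysis.Analysis"
begin

text \<open>The Euclidean plane is the type \<^typ>\<open>complex\<close>. A triangle is an ordered triple of vertices.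
  For a tile \<open>(P, Q, R)\<close> the order fixes the labels of angles and sides: the angles at
  \<open>P, Q, R\<close> are \<open>\<alpha>, \<beta>, \<gamma>\<close> and the sides opposite to them are \<open>a, b, c\<close>.\<close>

type_synonym triangle = "complex \<times> complex \<times> complex"

fun nondegenerate :: "triangle \<Rightarrow> bool" where
  "nondegenerate (P, Q, R) \<longleftrightarrow> \<not> collinear {P, Q, R}"

fun region :: "triangle \<Rightarrow> complex set" where
  "region (P, Q, R) = convex hull {P, Q, R}"

fun a_edge :: "triangle \<Rightarrow> complex set" where
  "a_edge (P, Q, R) = closed_segment Q R"

fun b_edge :: "triangle \<Rightarrow> complex set" where
  "b_edge (P, Q, R) = closed_segment R P"

fun c_edge :: "triangle \<Rightarrow> complex set" where
  "c_edge (P, Q, R) = closed_segment P Q"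

definition edges :: "triangle \<Rightarrow> complex set set" where
  "edges t = {a_edge t, b_edge t, c_edge t}"

text \<open>\<open>angle_at X Y Z\<close> is the unsigned angle \<open>XYZ\<close>, with vertex \<open>Y\<close>.\<close>

definition angle_at :: "complex \<Rightarrow> complex \<Rightarrow> complex \<Rightarrow> real" where
  "angle_at X Y Z = arccos (((X - Y) \<bullet> (Z - Y)) / (norm (X - Y) * norm (Z - Y)))"

fun angles :: "triangle \<Rightarrow> real multiset" where
  "angles (A, B, C) = {# angle_at C A B, angle_at A B C, angle_at B C A #}"

fun equilateral :: "triangle \<Rightarrow> bool" where
  "equilateral (A, B, C) \<longleftrightarrow> dist A B = dist B C \<and> dist B C = dist C A"

text \<open>Similarity transformations of ratio \<open>k\<close>; both orientations are allowed, and \<open>k = 1\<close>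
  gives the isometries of the plane.\<close>

definition similarity :: "real \<Rightarrow> (complex \<Rightarrow> complex) \<Rightarrow> bool" where
  "similarity k f \<longleftrightarrow> k > 0 \<and> (\<forall>x y. dist (f x) (f y) = k * dist x y)"

definition similar :: "triangle \<Rightarrow> triangle \<Rightarrow> bool" where
  "similar s t \<longleftrightarrow> (\<exists>k f. similarity k f \<and> f ` region s = region t)"

text \<open>A copy inherits the vertex labels of the tile, so that its \<open>c\<close>-edge is the image of
  the \<open>c\<close>-edge of the tile.\<close>

definition copy_of :: "triangle \<Rightarrow> triangle \<Rightarrow> bool" where
  "copy_of tile t \<longleftrightarrow> (\<exists>f. similarity 1 f \<and> t = map_prod f (map_prod f f) tile)"

definition tiling :: "triangle \<Rightarrow> triangle set \<Rightarrow> triangle \<Rightarrow> bool" where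
  "tiling tile T ABC \<longleftrightarrow>
     finite T \<and> (\<forall>t\<in>T. copy_of tile t) \<and>
     (\<Union>t\<in>T. region t) = region ABC \<and>
     (\<forall>s\<in>T. \<forall>t\<in>T. s \<noteq> t \<longrightarrow> interior (region s) \<inter> interior (region t) = {})"

definition supported_by :: "triangle \<Rightarrow> complex set \<Rightarrow> bool" where
  "supported_by t S \<longleftrightarrow> (\<exists>e\<in>edges t. e \<subseteq> S)"

end

theory Submission
  imports Defs
begin

text \<open>A function \<open>w\<close> of directed edges that is additive along lines satisfies
  \<open>\<Sum>\<^sub>t w(\<partial>t) = w(\<partial>ABC)\<close> over the positively oriented tiles \<open>t\<close>, since
  on every line the contributions of the two sides cancel in the interior. Apart from areas and side
  lengths this is applied to \<open>w(p, q) = \<phi>(|q - p|) exp(i f(arg(q - p)))\<close> with \<open>\<phi>, f\<close> linear over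
  \<open>\<rat>\<close>, \<open>f(\<pi>) = 3\<pi>\<close> and \<open>f(\<alpha>) = 0\<close>. Such an \<open>f\<close> exists because \<open>\<alpha>/\<pi>\<close> is irrational, and \<open>w\<close>
  vanishes on all copies of the tile as soon as \<open>\<phi>(c + a - b) = 0\<close>. Hence a signed sum of the sides of
  \<open>ABC\<close>, the signs being determined by the number of angles \<open>\<beta>\<close> at each corner, is a
  rational multiple of \<open>c + a - b\<close>; by symmetry another one is a rational multiple of \<open>c - a + b\<close>.
  Unless \<open>ABC\<close> is similar to the tile, its corners consist of three angles \<open>\<alpha>\<close> and three angles
  \<open>\<beta>\<close>. For each such distribution the two relations, the law of sines and the rationality of the
  ratio of the areas either make the sides of the tile commensurable, or
  force \<open>a\<close> and \<open>b\<close> to differ by a rational multiple of \<open>c\<close> while the sides of \<open>ABC\<close> are rational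
  multiples of \<open>c\<close>, which leaves only \<open>c\<close>-edges on the boundary. The exception is the triangle with
  angles \<open>2\<alpha> + \<beta>, \<alpha> + \<beta>, \<beta>\<close>: there two sides of \<open>ABC\<close> would consist of \<open>a\<close>-edges only, which the
  single angle \<open>\<beta>\<close> at their common vertex does not permit.\<close>

section \<open>Orientation and half-planes\<close>

text \<open>The tiles need not meet edge to edge, so sides cannot be matched one by one; what
  survives is that along a line the tiles on its two sides cover the same points. Hence a weight has
  to be additive on each line and to change sign when an edge is reversed. The value f(\<pi>) =
  3\<pi> achieves this sign change and makes the ambiguity 2\<pi> of a direction harmless. It also
  gives f(2\<pi>/3) = 2\<pi> and, with f(\<alpha>) = 0, f(\<beta>) = \<pi>: around a tile the
  direction factor changes by signs only, and the boundary sum is a unit factor times \<phi>(c + a -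
  b). If the signed sum of the sides of ABC were not a rational multiple of c + a - b, some \<phi>
  would vanish on the latter and not on the former. The irrationality of \<alpha>/\<pi> also governs
  the corners: they contain as many \<alpha> as \<beta>, and either one angle 2\<pi>/3 with one
  \<alpha> and one \<beta>, which is the shape of the tile, or three of each. The exceptional shape
  is the one whose area only repeats what the two relations say.\<close>

definition orient :: "complex \<Rightarrow> complex \<Rightarrow> complex \<Rightarrow> real" where
  "orient p q r = (Re q - Re p) * (Im r - Im p) - (Im q - Im p) * (Re r - Re p)"

fun orientation :: "triangle \<Rightarrow> real" where
  "orientation (p, q, r) = orient p q r"

text \<open>\<open>orient\<close> is twice the signed area. Multiplying by
  \<open>orient p q r\<close> makes the test independent of the orientation, and strict inequalities
  make it an open condition directly, with no appeal to \<open>interior\<close>.\<close>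

fun strictly_inside :: "triangle \<Rightarrow> complex \<Rightarrow> bool" where
  "strictly_inside (p, q, r) z \<longleftrightarrow>
     0 < orient p q r * orient p q z \<and> 0 < orient p q r * orient q r z \<and> 0 < orient p q r * orient r p z"

fun boundary_sum :: "(complex \<Rightarrow> complex \<Rightarrow> 'a::ab_group_add) \<Rightarrow> triangle \<Rightarrow> 'a" where
  "boundary_sum w (p, q, r) = w p q + w q r + w r p"

lemma orient_rotate: "orient q r p = orient p q r"
  by (simp add: orient_def algebra_simps)

lemma orient_swap: "orient q p r = - orient p q r"
  by (simp add: orient_def algebra_simps)

lemma orient_degenerate [simp]: "orient p p z = 0" "orient p q p = 0" "orient p q q = 0"
  by (simp_all add: orient_def)

lemma orient_sum: "orient p q z + orient q r z + orient r p z = orient p q r"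
  by (simp add: orient_def algebra_simps)

lemma orient_affine:
  "orient (z0 + u * p) (z0 + u * q) (z0 + u * r) = (norm u)\<^sup>2 * orient p q r"
  unfolding orient_def cmod_power2 by (simp add: algebra_simps power2_eq_square)

lemma continuous_on_orient [continuous_intros]: "continuous_on S (\<lambda>z. orient p q z)"
  unfolding orient_def by (intro continuous_intros)

lemma collinear_iff_orient: "collinear {p, q, r} \<longleftrightarrow> orient p q r = 0"
proof -
  have "collinear {p, q, r} \<longleftrightarrow> collinear {q, p, r}" by (simp add: insert_commute)
  also have "\<dots> \<longleftrightarrow> collinear {0, q - p, r - p}"
    using collinear_3[of q p r] by (simp add: collinear_3)
  also have "\<dots> \<longleftrightarrow> (q - p = 0 \<or> r - p = 0 \<or> (\<exists>c. r - p = c *\<^sub>R (q - p)))"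
    by (rule collinear_lemma)
  also have "\<dots> \<longleftrightarrow> orient p q r = 0"
  proof
    assume "q - p = 0 \<or> r - p = 0 \<or> (\<exists>c. r - p = c *\<^sub>R (q - p))"
    moreover have "orient p q r = 0" if "r - p = c *\<^sub>R (q - p)" for c
    proof -
      have "Re r - Re p = c * (Re q - Re p)" "Im r - Im p = c * (Im q - Im p)"
        using that by (simp_all add: complex_eq_iff)
      thus ?thesis by (simp add: orient_def)
    qed
    ultimately show "orient p q r = 0"
      by (auto simp: orient_def)
  next
    assume o: "orient p q r = 0"
    show "q - p = 0 \<or> r - p = 0 \<or> (\<exists>c. r - p = c *\<^sub>R (q - p))"
    proof (cases "q = p")
      case False
      define c where "c = Re ((r - p) / (q - p))"
      \<comment> \<open>Up to the positive factor \<open>(norm (q - p))\<^sup>2\<close>, the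
        imaginary part of this quotient is \<open>orient p q r\<close>.\<close>
      have "Im ((r - p) / (q - p)) = 0"
        using o by (simp add: orient_def Im_divide algebra_simps)
      hence "(r - p) / (q - p) = of_real c"
        by (simp add: c_def complex_eq_iff)
      hence "r - p = c *\<^sub>R (q - p)"
        using False by (simp add: scaleR_conv_of_real field_simps)
      thus ?thesis by blast
    qed simp
  qed
  finally show ?thesis .
qed

lemma nondegenerate_iff: "nondegenerate t \<longleftrightarrow> orientation t \<noteq> 0"
  by (cases t) (simp add: collinear_iff_orient)

lemma orient_convex:
  assumes "u + v + w = 1"
  shows "orient p q (u *\<^sub>R p + v *\<^sub>R q + w *\<^sub>R r) = w * orient p q r"
proof -
  have "u = 1 - v - w" using assms by simp
  show ?thesis unfolding \<open>u = 1 - v - w\<close> orient_def by (simp add: algebra_simps)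
qed

text \<open>The quotients of \<open>orient q r z\<close>, \<open>orient r p z\<close>,
  \<open>orient p q z\<close> by \<open>orient p q r\<close> are the barycentric coordinates of z,
  so membership in the hull is nonnegativity of all three.\<close>

lemma region_iff:
  assumes D: "orient p q r \<noteq> 0"
  shows "z \<in> region (p, q, r) \<longleftrightarrow>
    0 \<le> orient p q r * orient p q z \<and> 0 \<le> orient p q r * orient q r z \<and> 0 \<le> orient p q r * orient r p z"
    (is "_ \<longleftrightarrow> ?R")
proof
  assume "z \<in> region (p, q, r)"
  then obtain u v w where uvw: "0 \<le> u" "0 \<le> v" "0 \<le> w" "u + v + w = 1"
    and z: "z = u *\<^sub>R p + v *\<^sub>R q + w *\<^sub>R r"
    by (auto simp: convex_hull_3)
  have 1: "orient p q z = w * orient p q r"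
    unfolding z using uvw(4) by (rule orient_convex)
  have 2: "orient q r z = u * orient p q r"
    using orient_convex[of v w u q r p] uvw(4) unfolding z orient_rotate[of q r p, symmetric]
    by (simp add: add_ac orient_rotate)
  have 3: "orient r p z = v * orient p q r"
    using orient_convex[of w u v r p q] uvw(4) unfolding z
    by (simp add: add_ac orient_rotate)
  have "0 \<le> orient p q r * orient p q r" by simp
  thus ?R unfolding 1 2 3 using uvw(1-3)
    by (metis mult.left_commute mult_nonneg_nonneg)
next
  assume R: ?R
  define D where "D = orient p q r"
  have D0: "D \<noteq> 0" using D D_def by simp
  define u v w where "u = orient q r z / D" and "v = orient r p z / D" and "w = orient p q z / D"
  have nn: "0 \<le> x / D" if "0 \<le> D * x" for x
    using that D0 by (metis mult_eq_0_iff zero_le_divide_iff zero_le_mult_iff)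
  have "0 \<le> u" "0 \<le> v" "0 \<le> w"
    using R nn unfolding u_def v_def w_def D_def by auto
  moreover have "u + v + w = 1"
    using orient_sum[of p q z r] D0 unfolding u_def v_def w_def
    by (simp add: D_def field_simps)
  moreover have "z = u *\<^sub>R p + v *\<^sub>R q + w *\<^sub>R r"
  proof -
    have "D * Re z = orient q r z * Re p + orient r p z * Re q + orient p q z * Re r"
      unfolding D_def orient_def by algebra
    moreover have "D * Im z = orient q r z * Im p + orient r p z * Im q + orient p q z * Im r"
      unfolding D_def orient_def by algebra
    ultimately show ?thesis using D0
      by (simp add: complex_eq_iff u_def v_def w_def add_divide_distrib[symmetric] eq_divide_eq mult.commute)
  qed
  ultimately show "z \<in> region (p, q, r)"
    by (auto simp: convex_hull_3)
qed

lemma strictly_inside_imp_region: "strictly_inside t z \<Longrightarrow> z \<in> region t"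
  proof (cases t)
  case (fields p q r)
  assume *: "strictly_inside t z"
  hence "orient p q r \<noteq> 0" by (auto simp: fields)
  thus ?thesis using * by (simp add: fields region_iff less_imp_le del: region.simps)
qed

lemma open_strictly_inside: "open {z. strictly_inside t z}"
proof -
  obtain p q r where t: "t = (p, q, r)" by (cases t)
  show ?thesis unfolding t strictly_inside.simps
    by (intro open_Collect_conj open_Collect_less continuous_intros)
qed

lemma strictly_inside_imp_interior:
  assumes "strictly_inside t z"
  shows "z \<in> interior (region t)"
proof -
  have "{z. strictly_inside t z} \<subseteq> interior (region t)"
    by (rule interior_maximal) (auto intro: strictly_inside_imp_region open_strictly_inside)
  thus ?thesis using assms by auto
qed

lemma closed_region: "closed (region t)"
  by (cases t) (simp add: compact_imp_closed finite_imp_compact_convex_hull)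

text \<open>If strictness fails, a barycentric coordinate is 0 and the two others parametrise a
  side.\<close>

lemma region_not_strict_imp_edge:
  assumes D: "orient p q r \<noteq> 0" and z: "z \<in> region (p, q, r)" and n: "\<not> strictly_inside (p, q, r) z"
  shows "z \<in> closed_segment p q \<or> z \<in> closed_segment q r \<or> z \<in> closed_segment r p"
proof -
  from z obtain u v w where uvw: "0 \<le> u" "0 \<le> v" "0 \<le> w" "u + v + w = 1"
    and z: "z = u *\<^sub>R p + v *\<^sub>R q + w *\<^sub>R r"
    by (auto simp: convex_hull_3)
  have 1: "orient p q z = w * orient p q r"
    unfolding z using uvw(4) by (rule orient_convex)
  have 2: "orient q r z = u * orient p q r"
    using orient_convex[of v w u q r p] uvw(4) unfolding z
    by (simp add: add_ac orient_rotate)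
  have 3: "orient r p z = v * orient p q r"
    using orient_convex[of w u v r p q] uvw(4) unfolding z
    by (simp add: add_ac orient_rotate)
  have pos: "0 < orient p q r * orient p q r" using D by (simp add: zero_less_mult_iff) auto
  have "u = 0 \<or> v = 0 \<or> w = 0"
  proof (rule ccontr)
    assume "\<not> ?thesis"
    hence "0 < u" "0 < v" "0 < w" using uvw by auto
    hence "strictly_inside (p, q, r) z"
      unfolding strictly_inside.simps 1 2 3 using pos by (metis mult.left_commute mult_pos_pos)
    thus False using n by simp
  qed
  thus ?thesis
  proof (elim disjE)
    assume "u = 0"
    hence "v = 1 - w" "w \<le> 1" using uvw by auto
    hence "z \<in> closed_segment q r" using uvw(3) z \<open>u = 0\<close> by (auto simp: in_segment)
    thus ?thesis by simp
  next
    assume "v = 0"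
    hence "w = 1 - u" "u \<le> 1" using uvw by auto
    hence "z \<in> closed_segment r p" using uvw(1) z \<open>v = 0\<close>
      by (auto simp: in_segment add.commute)
    thus ?thesis by simp
  next
    assume "w = 0"
    hence "u = 1 - v" "v \<le> 1" using uvw by auto
    hence "z \<in> closed_segment p q" using uvw(2) z \<open>w = 0\<close> by (auto simp: in_segment)
    thus ?thesis by simp
  qed
qed

section \<open>Step functions\<close>

text \<open>A combination of step functions that vanishes off a finite set has no jump anywhere, so
  at every point the signed endpoints cancel. This cancellation no longer mentions step functions
  and can be weighted by an arbitrary h.\<close>

lemma signed_step_sum:
  fixes c l r :: "'i \<Rightarrow> real" and h :: "real \<Rightarrow> 'v::real_vector"
  assumes fin: "finite I" "finite F"
    and zero: "\<And>x. x \<notin> F \<Longrightarrow> (\<Sum>i\<in>I. c i * (of_bool (l i < x) - of_bool (r i < x))) = 0"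
  shows "(\<Sum>i\<in>I. c i *\<^sub>R (h (r i) - h (l i))) = 0"
proof -
  define E where "E = l ` I \<union> r ` I"
  have finE: "finite E" using fin by (simp add: E_def)
  have coeff: "(\<Sum>i\<in>I. c i * (of_bool (r i = x) - of_bool (l i = x))) = 0" for x
  proof -
    have "finite ((E \<union> F) - {x})" using finE fin by simp
    then obtain e where e: "e > 0" "\<And>y. y \<in> (E \<union> F) - {x} \<Longrightarrow> e \<le> dist x y"
      using finite_set_avoid[of "(E \<union> F) - {x}" x] by auto
    \<comment> \<open>The points y and z straddle x so closely that x is the only possible endpoint
      between them, and neither of them is exceptional.\<close>
    define y z where "y = x - e / 2" and "z = x + e / 2"
    have "y \<notin> E \<union> F" "z \<notin> E \<union> F"
      using e(1) e(2)[of y] e(2)[of z] by (auto simp: y_def z_def dist_real_def)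
    have mem: "of_bool (v < z) - of_bool (v < y) = (of_bool (v = x) :: real)" if "v \<in> E" for v
    proof (cases "v = x")
      case True thus ?thesis using e(1) by (simp add: y_def z_def)
    next
      case False
      hence "e \<le> \<bar>x - v\<bar>" using e(2)[of v] that by (simp add: dist_real_def)
      thus ?thesis using e(1) False by (auto simp: y_def z_def abs_if split: if_splits)
    qed
    have "(\<Sum>i\<in>I. c i * (of_bool (l i = x) - of_bool (r i = x)))
        = (\<Sum>i\<in>I. c i * (of_bool (l i < z) - of_bool (r i < z))) - (\<Sum>i\<in>I. c i * (of_bool (l i < y) - of_bool (r i < y)))"
      unfolding sum_subtractf[symmetric]
    proof (rule sum.cong)
      fix i assume "i \<in> I"
      hence "l i \<in> E" "r i \<in> E" by (auto simp: E_def)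
      from mem[OF this(1)] mem[OF this(2)]
      show "c i * (of_bool (l i = x) - of_bool (r i = x)) = c i * (of_bool (l i < z) - of_bool (r i < z)) - c i * (of_bool (l i < y) - of_bool (r i < y))"
        by (simp add: right_diff_distrib[symmetric])
    qed simp
    also have "\<dots> = 0"
      using zero[of y] zero[of z] \<open>y \<notin> E \<union> F\<close> \<open>z \<notin> E \<union> F\<close> by simp
    finally have "- (\<Sum>i\<in>I. c i * (of_bool (l i = x) - of_bool (r i = x))) = 0" by simp
    thus ?thesis by (simp add: sum_negf[symmetric] right_diff_distrib)
  qed
  have ev: "h v = (\<Sum>x\<in>E. of_bool (v = x) *\<^sub>R h x)" if "v \<in> E" for v
  proof -
    have "(\<Sum>x\<in>E. of_bool (v = x) *\<^sub>R h x) = (\<Sum>x\<in>E. if v = x then h x else 0)"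
      by (rule sum.cong) auto
    thus ?thesis using that finE by simp
  qed
  have "(\<Sum>i\<in>I. c i *\<^sub>R (h (r i) - h (l i)))
      = (\<Sum>i\<in>I. c i *\<^sub>R (\<Sum>x\<in>E. (of_bool (r i = x) - of_bool (l i = x)) *\<^sub>R h x))"
  proof (rule sum.cong)
    fix i assume "i \<in> I"
    hence m: "l i \<in> E" "r i \<in> E" by (auto simp: E_def)
    show "c i *\<^sub>R (h (r i) - h (l i)) = c i *\<^sub>R (\<Sum>x\<in>E. (of_bool (r i = x) - of_bool (l i = x)) *\<^sub>R h x)"
      using ev[OF m(1)] ev[OF m(2)] by (simp add: scaleR_left_diff_distrib sum_subtractf)
  qed simp
  also have "\<dots> = (\<Sum>i\<in>I. \<Sum>x\<in>E. (c i * (of_bool (r i = x) - of_bool (l i = x))) *\<^sub>R h x)"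
    by (simp add: scaleR_right.sum)
  also have "\<dots> = (\<Sum>x\<in>E. \<Sum>i\<in>I. (c i * (of_bool (r i = x) - of_bool (l i = x))) *\<^sub>R h x)"
    by (rule sum.swap)
  also have "\<dots> = (\<Sum>x\<in>E. (\<Sum>i\<in>I. c i * (of_bool (r i = x) - of_bool (l i = x))) *\<^sub>R h x)"
    by (simp add: scaleR_left.sum)
  also have "\<dots> = 0" by (simp add: coeff)
  finally show ?thesis .
qed

text \<open>The form in which step sums are used: every triangle contributes three intervals, one
  for each edge or each corner, and the triangles of T are compared with a single t0.\<close>

lemma signed_step_transfer:
  fixes s :: "'t \<Rightarrow> real" and l r :: "'t \<Rightarrow> nat \<Rightarrow> real" and h :: "real \<Rightarrow> 'v::real_vector"
  assumes fin: "finite T" "finite F"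
    and eq: "\<And>x. x \<notin> F \<Longrightarrow>
      (\<Sum>t\<in>T. s t * (\<Sum>k<3. of_bool (l t k < x) - of_bool (r t k < x))) =
      s t0 * (\<Sum>k<3. of_bool (l t0 k < x) - of_bool (r t0 k < x))"
  shows "(\<Sum>t\<in>T. s t *\<^sub>R (\<Sum>k<3. h (r t k) - h (l t k))) = s t0 *\<^sub>R (\<Sum>k<3. h (r t0 k) - h (l t0 k))"
proof -
  \<comment> \<open>\<open>None\<close> stands for t0 with the opposite sign, so that t0 is kept
    apart even if it belongs to T.\<close>
  define I where "I = (Some ` T \<union> {None}) \<times> {..<3::nat}"
  define v where "v o' = (case o' of None \<Rightarrow> t0 | Some t \<Rightarrow> t)" for o'
  define c where "c i = (case fst i of None \<Rightarrow> - s t0 | Some t \<Rightarrow> s t)" for i :: "'t option \<times> nat"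
  have split: "(\<Sum>i\<in>I. c i *\<^sub>R g (v (fst i)) (snd i))
     = (\<Sum>t\<in>T. s t *\<^sub>R (\<Sum>k<3. g t k)) - s t0 *\<^sub>R (\<Sum>k<3. g t0 k)" for g :: "'t \<Rightarrow> nat \<Rightarrow> 'u::real_vector"
  proof -
    have "(\<Sum>i\<in>I. c i *\<^sub>R g (v (fst i)) (snd i)) = (\<Sum>o'\<in>Some ` T \<union> {None}. \<Sum>k<3. c (o', k) *\<^sub>R g (v o') k)"
      unfolding I_def by (subst sum.cartesian_product) (simp add: case_prod_unfold)
    also have "\<dots> = (\<Sum>o'\<in>Some ` T. \<Sum>k<3. c (o', k) *\<^sub>R g (v o') k) + (\<Sum>k<3. c (None, k) *\<^sub>R g (v None) k)"
      using fin by (subst sum.union_disjoint) auto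
    also have "(\<Sum>o'\<in>Some ` T. \<Sum>k<3. c (o', k) *\<^sub>R g (v o') k) = (\<Sum>t\<in>T. \<Sum>k<3. c (Some t, k) *\<^sub>R g (v (Some t)) k)"
      by (subst sum.reindex) auto
    finally show ?thesis
      by (simp add: c_def v_def scaleR_right.sum sum_negf)
  qed
  have "(\<Sum>i\<in>I. c i *\<^sub>R (h (r (v (fst i)) (snd i)) - h (l (v (fst i)) (snd i)))) = 0"
  proof (rule signed_step_sum)
    show "finite I" using fin by (simp add: I_def)
    show "finite F" by fact
    fix x assume "x \<notin> F"
    show "(\<Sum>i\<in>I. c i * (of_bool (l (v (fst i)) (snd i) < x) - of_bool (r (v (fst i)) (snd i) < x))) = 0"
      using split[of "\<lambda>t k. (of_bool (l t k < x) - of_bool (r t k < x)) :: real"] eq[OF \<open>x \<notin> F\<close>]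
      by simp
  qed
  thus ?thesis using split[of "\<lambda>t k. h (r t k) - h (l t k)"] by simp
qed

section \<open>Additive functions on the edges of a tiling\<close>

text \<open>What the counting arguments need of a tiling: a point on the boundary of no tile is
  covered once inside \<open>t0\<close> and not at all outside. The tiles need not be congruent, and
  the notion survives similarities and relabelling of vertices.\<close>

definition tiled :: "triangle set \<Rightarrow> triangle \<Rightarrow> bool" where
  "tiled T t0 \<longleftrightarrow> finite T \<and> orientation t0 \<noteq> 0 \<and>
     (\<forall>t\<in>T. orientation t \<noteq> 0 \<and> region t \<subseteq> region t0) \<and>
     (\<forall>z. (\<forall>t\<in>T. z \<in> region t \<longrightarrow> strictly_inside t z) \<longrightarrow>
        (\<Sum>t\<in>T. of_bool (z \<in> region t)) = (of_bool (z \<in> region t0) :: real))"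

fun edge :: "triangle \<Rightarrow> nat \<Rightarrow> complex \<times> complex" where
  "edge (p, q, r) k = (if k = 0 then (p, q) else if k = 1 then (q, r) else (r, p))"

lemma sum_edges: "(\<Sum>k<3. w (fst (edge t k)) (snd (edge t k))) = boundary_sum w t"
  by (cases t) (simp add: eval_nat_numeral)

definition on_axis :: "complex \<times> complex \<Rightarrow> bool" where
  "on_axis e \<longleftrightarrow> Im (fst e) = 0 \<and> Im (snd e) = 0"

definition axis_weight :: "(real \<Rightarrow> 'v) \<Rightarrow> complex \<Rightarrow> complex \<Rightarrow> 'v::real_vector" where
  "axis_weight h p q = (if on_axis (p, q) then h (Re q) - h (Re p) else 0)"

text \<open>This is \<open>axis_weight\<close> for the step function
  \<open>\<lambda>v. - of_bool (v < x)\<close>: it is 1 or -1 if the edge passes over x to the right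
  or to the left.\<close>

definition axis_jump :: "real \<Rightarrow> complex \<Rightarrow> complex \<Rightarrow> real" where
  "axis_jump x p q = (if on_axis (p, q) then of_bool (Re p < x) - of_bool (Re q < x) else 0)"

text \<open>Comparing the points just above and just below a generic point of the real axis sees exactly the
  edges on the axis, each with the sign given by the side on which its triangle lies.\<close>

definition axis_local :: "triangle \<Rightarrow> real \<Rightarrow> real \<Rightarrow> bool" where
  "axis_local t x e \<longleftrightarrow>
     of_bool (Complex x e \<in> region t) - of_bool (Complex x (-e) \<in> region t)
        = sgn (orientation t) * boundary_sum (axis_jump x) t \<and>
     (Complex x e \<in> region t \<longrightarrow> strictly_inside t (Complex x e)) \<and>
     (Complex x (-e) \<in> region t \<longrightarrow> strictly_inside t (Complex x (-e)))"

lemma tendsto_Complex_pm: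
  "((\<lambda>e. Complex x e) \<longlongrightarrow> Complex x 0) (at_right 0)"
  "((\<lambda>e. Complex x (-e)) \<longlongrightarrow> Complex x 0) (at_right 0)"
proof -
  have id: "((\<lambda>e. e) \<longlongrightarrow> 0) (at_right (0::real))"
    by (rule tendsto_ident_at)
  show "((\<lambda>e. Complex x e) \<longlongrightarrow> Complex x 0) (at_right 0)"
    by (intro tendsto_Complex tendsto_const id)
  show "((\<lambda>e. Complex x (-e)) \<longlongrightarrow> Complex x 0) (at_right 0)"
    using tendsto_minus[OF id] by (intro tendsto_Complex tendsto_const) simp
qed

lemma region_rotate: "region (q, r, p) = region (p, q, r)"
  by (simp add: insert_commute)

lemma strictly_inside_rotate: "strictly_inside (q, r, p) z = strictly_inside (p, q, r) z"
  by (auto simp: orient_rotate)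

lemma axis_local_rotate: "axis_local (q, r, p) x = axis_local (p, q, r) x"
  unfolding axis_local_def [abs_def] region_rotate strictly_inside_rotate
  by (simp add: orient_rotate add_ac)

text \<open>If x is outside the edge, one of the other two half-plane conditions fails strictly at
  x, hence at both nearby points. If it is inside, both hold strictly, and of the two points only
  the one on the side of r lies in the triangle. The side of r together with the direction of the
  edge is what the orientation records.\<close>

lemma axis_local_edge:
  assumes D: "orient p q r \<noteq> 0" and pq: "Im p = 0" "Im q = 0" and x: "x \<noteq> Re p" "x \<noteq> Re q"
  shows "eventually (axis_local (p, q, r) x) (at_right 0)"
proof -
  let ?D = "orient p q r"
  have Deq: "?D = (Re q - Re p) * Im r" using pq by (simp add: orient_def)
  hence nz: "Im r \<noteq> 0" "Re q \<noteq> Re p" using D by auto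
  have na: "\<not> on_axis (q, r)" "\<not> on_axis (r, p)" using nz by (auto simp: on_axis_def)
  have bs: "boundary_sum (axis_jump x) (p, q, r) = of_bool (Re p < x) - of_bool (Re q < x)"
    using na pq by (simp add: axis_jump_def on_axis_def)
  \<comment> \<open>Squares are split off, so that only the signs of the remaining factors
    matter.\<close>
  have o1: "?D * orient p q (Complex x y) = (Re q - Re p)\<^sup>2 * (Im r * y)" for y
    using pq unfolding Deq by (simp add: orient_def power2_eq_square algebra_simps)
  have o2: "?D * orient q r (Complex x 0) = (Im r)\<^sup>2 * ((Re q - Re p) * (Re q - x))"
    using pq unfolding Deq by (simp add: orient_def power2_eq_square algebra_simps)
  have o3: "?D * orient r p (Complex x 0) = (Im r)\<^sup>2 * ((Re q - Re p) * (x - Re p))"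
    using pq unfolding Deq by (simp add: orient_def power2_eq_square algebra_simps)
  have lim: "((\<lambda>e. ?D * orient a b (Complex x e)) \<longlongrightarrow> ?D * orient a b (Complex x 0)) (at_right 0)"
            "((\<lambda>e. ?D * orient a b (Complex x (-e))) \<longlongrightarrow> ?D * orient a b (Complex x 0)) (at_right 0)" for a b
  proof -
    have "continuous_on UNIV (\<lambda>z. ?D * orient a b z)" by (intro continuous_intros)
    hence "isCont (\<lambda>z. ?D * orient a b z) (Complex x 0)"
      by (simp add: continuous_on_eq_continuous_at)
    from isCont_tendsto_compose[OF this tendsto_Complex_pm(1)] isCont_tendsto_compose[OF this tendsto_Complex_pm(2)]
    show "((\<lambda>e. ?D * orient a b (Complex x e)) \<longlongrightarrow> ?D * orient a b (Complex x 0)) (at_right 0)"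
            "((\<lambda>e. ?D * orient a b (Complex x (-e))) \<longlongrightarrow> ?D * orient a b (Complex x 0)) (at_right 0)" .
  qed
  have ev0: "eventually (\<lambda>e::real. 0 < e) (at_right 0)" by (rule eventually_at_right_less)
  have sq: "(Im r)\<^sup>2 > 0" "(Re q - Re p)\<^sup>2 > 0" using nz by auto
  show ?thesis
  proof (cases "(Re p < x) = (Re q < x)")
    case True
    hence "(Re q - Re p) * (Re q - x) < 0 \<or> (Re q - Re p) * (x - Re p) < 0"
      using x nz(2) by (auto simp: mult_less_0_iff)
    hence "?D * orient q r (Complex x 0) < 0 \<or> ?D * orient r p (Complex x 0) < 0"
      unfolding o2 o3 using sq by (simp add: mult_less_0_iff)
    then obtain a b where ab: "?D * orient a b (Complex x 0) < 0" "(a, b) = (q, r) \<or> (a, b) = (r, p)" by blast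
    have "eventually (\<lambda>e. ?D * orient a b (Complex x e) < 0) (at_right 0)"
         "eventually (\<lambda>e. ?D * orient a b (Complex x (-e)) < 0) (at_right 0)"
      using order_tendstoD(2)[OF lim(1) ab(1)] order_tendstoD(2)[OF lim(2) ab(1)] .
    thus ?thesis
    proof eventually_elim
      case (elim e)
      hence "Complex x e \<notin> region (p, q, r)" "Complex x (-e) \<notin> region (p, q, r)"
        using ab(2) unfolding region_iff[OF D] by (auto simp: not_le)
      thus ?case using True bs by (simp add: axis_local_def del: region.simps boundary_sum.simps)
    qed
  next
    case False
    hence "(Re q - Re p) * (Re q - x) > 0 \<and> (Re q - Re p) * (x - Re p) > 0"
      using x nz(2) by (auto simp: zero_less_mult_iff)
    hence pos: "0 < ?D * orient q r (Complex x 0)" "0 < ?D * orient r p (Complex x 0)"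
      unfolding o2 o3 using sq by simp_all
    from order_tendstoD(1)[OF lim(1) pos(1)] order_tendstoD(1)[OF lim(2) pos(1)]
         order_tendstoD(1)[OF lim(1) pos(2)] order_tendstoD(1)[OF lim(2) pos(2)] ev0
    show ?thesis
    proof eventually_elim
      case (elim e)
      have 1: "Complex x e \<in> region (p, q, r) \<longleftrightarrow> 0 < Im r" "strictly_inside (p, q, r) (Complex x e) \<longleftrightarrow> 0 < Im r"
        unfolding region_iff[OF D] strictly_inside.simps o1
        using elim sq nz by (auto simp: zero_le_mult_iff zero_less_mult_iff)
      have 2: "Complex x (-e) \<in> region (p, q, r) \<longleftrightarrow> Im r < 0" "strictly_inside (p, q, r) (Complex x (-e)) \<longleftrightarrow> Im r < 0"
        unfolding region_iff[OF D] strictly_inside.simps o1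
        using elim sq nz by (auto simp: zero_le_mult_iff zero_less_mult_iff mult_le_0_iff mult_less_0_iff)
      show ?case
      proof (cases "Re p < x")
        case True
        hence "sgn (Re q - Re p) = 1" "\<not> Re q < x" using False by auto
        thus ?thesis unfolding axis_local_def bs 1 2 using True nz by (simp add: Deq sgn_mult)
      next
        case F: False
        hence "sgn (Re q - Re p) = -1" "Re q < x" using False x by auto
        thus ?thesis unfolding axis_local_def bs 1 2 using F nz by (simp add: Deq sgn_mult)
      qed
    qed
  qed
qed

text \<open>The point on the axis is either strictly inside or outside. Both are open conditions, so
  its two neighbours agree and there is no jump.\<close>

lemma axis_local_no_edge:
  assumes n: "\<not> on_axis (p, q)" "\<not> on_axis (q, r)" "\<not> on_axis (r, p)"
    and z: "Complex x 0 \<in> region (p, q, r) \<Longrightarrow> strictly_inside (p, q, r) (Complex x 0)"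
  shows "eventually (axis_local (p, q, r) x) (at_right 0)"
proof -
  have bs: "boundary_sum (axis_jump x) (p, q, r) = 0" using n by (simp add: axis_jump_def)
  show ?thesis
  proof (cases "Complex x 0 \<in> region (p, q, r)")
    case True
    hence "Complex x 0 \<in> {z. strictly_inside (p, q, r) z}" using z by blast
    from topological_tendstoD[OF tendsto_Complex_pm(1) open_strictly_inside this]
         topological_tendstoD[OF tendsto_Complex_pm(2) open_strictly_inside this]
    show ?thesis
    proof eventually_elim
      case (elim e)
      thus ?case using bs strictly_inside_imp_region[of "(p, q, r)"]
        by (auto simp: axis_local_def simp del: region.simps boundary_sum.simps)
    qed
  next
    case False
    hence "Complex x 0 \<in> - region (p, q, r)" by blast
    from topological_tendstoD[OF tendsto_Complex_pm(1) open_Compl[OF closed_region] this]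
         topological_tendstoD[OF tendsto_Complex_pm(2) open_Compl[OF closed_region] this]
    show ?thesis
    proof eventually_elim
      case (elim e)
      thus ?case using bs by (auto simp: axis_local_def simp del: region.simps boundary_sum.simps)
    qed
  qed
qed

text \<open>A segment not parallel to the axis meets it for at most one parameter value, and a
  parallel one off the axis does not meet it.\<close>

lemma finite_axis_crossings:
  assumes "\<not> on_axis (p, q)"
  shows "finite {x. Complex x 0 \<in> closed_segment p q}"
proof (rule finite_subset)
  have *: "x = y" if x: "Complex x 0 \<in> closed_segment p q" and y: "Complex y 0 \<in> closed_segment p q" for x y
  proof -
    from x obtain u where u: "Complex x 0 = (1 - u) *\<^sub>R p + u *\<^sub>R q" by (auto simp: in_segment)
    from y obtain v where v: "Complex y 0 = (1 - v) *\<^sub>R p + v *\<^sub>R q" by (auto simp: in_segment)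
    have 1: "(1 - u) * Im p + u * Im q = 0" "(1 - v) * Im p + v * Im q = 0"
      using arg_cong[OF u, of Im] arg_cong[OF v, of Im] by simp_all
    have "(u - v) * (Im q - Im p) = 0" using 1 by algebra
    moreover have "Im q \<noteq> Im p"
    proof
      assume "Im q = Im p"
      hence "Im p = 0" using 1(1) by (simp add: algebra_simps)
      thus False using assms \<open>Im q = Im p\<close> by (simp add: on_axis_def)
    qed
    ultimately have "u = v" by simp
    thus "x = y" using u v by (metis complex.inject)
  qed
  \<comment> \<open>If there is no crossing, the set is empty and the arbitrary value of
    \<open>THE\<close> does no harm.\<close>
  show "{x. Complex x 0 \<in> closed_segment p q} \<subseteq> {THE x. Complex x 0 \<in> closed_segment p q}"
    using * by (auto intro!: the_equality[symmetric])
  show "finite {THE x. Complex x 0 \<in> closed_segment p q}" by simp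
qed

text \<open>The exceptional abscissae are those of the vertices and of the points where an edge not
  lying on the axis meets it.\<close>

lemma axis_local_generic:
  assumes "orientation t \<noteq> 0"
  obtains F where "finite F" "\<And>x. x \<notin> F \<Longrightarrow> eventually (axis_local t x) (at_right 0)"
proof -
  obtain p q r where t: "t = (p, q, r)" by (cases t)
  have D: "orient p q r \<noteq> 0" using assms by (simp add: t)
  define F where "F = {Re p, Re q, Re r} \<union>
    (\<Union>e\<in>{e\<in>{(p, q), (q, r), (r, p)}. \<not> on_axis e}. {x. Complex x 0 \<in> closed_segment (fst e) (snd e)})"
  have "finite F"
    unfolding F_def using finite_axis_crossings by (auto intro!: finite_UN_I)
  moreover have "eventually (axis_local t x) (at_right 0)" if x: "x \<notin> F" for x
  proof -
    have v: "x \<noteq> Re p" "x \<noteq> Re q" "x \<noteq> Re r" using x by (auto simp: F_def)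
    consider "on_axis (p, q)" | "on_axis (q, r)" | "on_axis (r, p)"
      | "\<not> on_axis (p, q)" "\<not> on_axis (q, r)" "\<not> on_axis (r, p)" by blast
    thus ?thesis
    proof cases
      case 1
      thus ?thesis using axis_local_edge[OF D] v by (simp add: t on_axis_def)
    next
      case 2
      have "eventually (axis_local (q, r, p) x) (at_right 0)"
        by (rule axis_local_edge) (use 2 v D in \<open>auto simp: orient_rotate on_axis_def\<close>)
      thus ?thesis using axis_local_rotate[of q r p x] by (simp add: t)
    next
      case 3
      have "eventually (axis_local (r, p, q) x) (at_right 0)"
        by (rule axis_local_edge) (use 3 v D in \<open>auto simp: orient_rotate on_axis_def\<close>)
      thus ?thesis using axis_local_rotate[of r p q x] axis_local_rotate[of q r p x] by (simp add: t)
    next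
      case 4
      have "Complex x 0 \<notin> closed_segment p q" "Complex x 0 \<notin> closed_segment q r" "Complex x 0 \<notin> closed_segment r p"
        using x 4 by (auto simp: F_def)
      hence "strictly_inside (p, q, r) (Complex x 0)" if "Complex x 0 \<in> region (p, q, r)"
        using region_not_strict_imp_edge[OF D that] by blast
      thus ?thesis unfolding t by (intro axis_local_no_edge 4)
    qed
  qed
  ultimately show ?thesis using that by blast
qed

text \<open>The covering number is the indicator of \<open>t0\<close> both just above and just below
  a generic point of the axis, so the jumps caused there by tile edges add up to the jump of
  \<open>t0\<close>. This is an identity of step functions; h enters only through
  \<open>signed_step_transfer\<close>.\<close>

lemma tiled_axis:
  fixes h :: "real \<Rightarrow> 'v::real_vector"
  assumes "tiled T t0"
  shows "(\<Sum>t\<in>T. sgn (orientation t) *\<^sub>R boundary_sum (axis_weight h) t)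
       = sgn (orientation t0) *\<^sub>R boundary_sum (axis_weight h) t0"
proof -
  \<comment> \<open>An edge off the axis gets the empty interval from 0 to 0.\<close>
  define l r where "l t k = (if on_axis (edge t k) then Re (fst (edge t k)) else 0)"
    and "r t k = (if on_axis (edge t k) then Re (snd (edge t k)) else 0)" for t k
  have hs: "(\<Sum>k<3. g (r t k) - g (l t k)) = boundary_sum (axis_weight g) t" for g :: "real \<Rightarrow> 'w::real_vector" and t
    unfolding sum_edges[symmetric] by (rule sum.cong) (auto simp: l_def r_def axis_weight_def)
  have js: "(\<Sum>k<3. of_bool (l t k < x) - of_bool (r t k < x)) = boundary_sum (axis_jump x) t" for t x
    unfolding sum_edges[symmetric] by (rule sum.cong) (auto simp: l_def r_def axis_jump_def)
  have fin: "finite T" and nd: "\<And>t. t \<in> insert t0 T \<Longrightarrow> orientation t \<noteq> 0"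
    using assms unfolding tiled_def by auto
  have cover: "\<And>z. (\<And>t. t \<in> T \<Longrightarrow> z \<in> region t \<Longrightarrow> strictly_inside t z) \<Longrightarrow>
        (\<Sum>t\<in>T. of_bool (z \<in> region t)) = (of_bool (z \<in> region t0) :: real)"
    using assms unfolding tiled_def by blast
  have "\<exists>F. finite F \<and> (\<forall>x. x \<notin> F \<longrightarrow> eventually (axis_local t x) (at_right 0))" if "t \<in> insert t0 T" for t
    using axis_local_generic[OF nd[OF that]] by metis
  then obtain F where F: "\<And>t. t \<in> insert t0 T \<Longrightarrow> finite (F t)"
    "\<And>t x. t \<in> insert t0 T \<Longrightarrow> x \<notin> F t \<Longrightarrow> eventually (axis_local t x) (at_right 0)"
    by metis
  show ?thesis
  proof (rule signed_step_transfer[where l = l and r = r and F = "\<Union>t\<in>insert t0 T. F t", unfolded hs js])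
    show "finite T" "finite (\<Union>t\<in>insert t0 T. F t)" using fin F(1) by auto
    fix x assume x: "x \<notin> (\<Union>t\<in>insert t0 T. F t)"
    hence "\<forall>t\<in>insert t0 T. eventually (axis_local t x) (at_right 0)" using F(2) by blast
    hence "eventually (\<lambda>e. \<forall>t\<in>insert t0 T. axis_local t x e) (at_right 0)"
      using fin by (intro eventually_ball_finite) auto
    \<comment> \<open>Finitely many triangles allow one common distance e, and
      \<open>axis_local\<close> makes both test points admissible in \<open>cover\<close>.\<close>
    then obtain e where e: "\<forall>t\<in>insert t0 T. axis_local t x e"
      using eventually_happens'[OF trivial_limit_at_right_real] by blast
    have c: "(\<Sum>t\<in>T. of_bool (Complex x e \<in> region t)) = (of_bool (Complex x e \<in> region t0) :: real)"
         "(\<Sum>t\<in>T. of_bool (Complex x (-e) \<in> region t)) = (of_bool (Complex x (-e) \<in> region t0) :: real)"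
      by (rule cover; use e in \<open>unfold axis_local_def, blast\<close>)+
    have "(\<Sum>t\<in>T. sgn (orientation t) * boundary_sum (axis_jump x) t)
       = (\<Sum>t\<in>T. of_bool (Complex x e \<in> region t) - of_bool (Complex x (-e) \<in> region t))"
      using e by (intro sum.cong) (auto simp: axis_local_def)
    also have "\<dots> = of_bool (Complex x e \<in> region t0) - of_bool (Complex x (-e) \<in> region t0)"
      unfolding sum_subtractf c ..
    also have "\<dots> = sgn (orientation t0) * boundary_sum (axis_jump x) t0"
      using e by (simp add: axis_local_def)
    finally show "(\<Sum>t\<in>T. sgn (orientation t) * boundary_sum (axis_jump x) t)
       = sgn (orientation t0) * boundary_sum (axis_jump x) t0" .
  qed
qed

section \<open>Transport of the axis argument to arbitrary lines\<close>

lemma tiled_map: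
  fixes z0 u :: complex
  assumes T: "tiled T t0" and u: "u \<noteq> 0"
  defines "g \<equiv> (\<lambda>z. (z - z0) / u)"
  shows "tiled (map_prod g (map_prod g g) ` T) (map_prod g (map_prod g g) t0)"
proof -
  let ?G = "map_prod g (map_prod g g)"
  define g' where "g' = (\<lambda>z. z0 + u * z)"
  have gg: "g' (g z) = z" "g (g' z) = z" for z using u by (simp_all add: g_def g'_def)
  have o: "orient (g p) (g q) (g r) = orient p q r / (norm u)\<^sup>2" for p q r
    using orient_affine[of z0 u "g p" "g q" "g r"] gg u by (simp add: g'_def field_simps)
  have n: "(norm u)\<^sup>2 > 0" using u by simp
  have ot: "orientation (?G t) = orientation t / (norm u)\<^sup>2" for t
    by (cases t) (simp add: o)
  have oz: "orient (g p) (g q) z = orient p q (g' z) / (norm u)\<^sup>2" for p q z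
    using o[of p q "g' z"] gg by simp
  have si: "strictly_inside (?G t) z \<longleftrightarrow> strictly_inside t (g' z)" for t z
    using n by (cases t) (simp add: o oz gg zero_less_divide_iff)
  have re: "z \<in> region (?G t) \<longleftrightarrow> g' z \<in> region t" if "orientation t \<noteq> 0" for t z
  proof (cases t)
    case (fields p q r)
    hence D: "orient p q r \<noteq> 0" using that by simp
    hence D': "orient (g p) (g q) (g r) \<noteq> 0" using n by (simp add: o)
    have "z \<in> region (?G t) \<longleftrightarrow> z \<in> region (g p, g q, g r)" by (simp add: fields)
    also have "\<dots> \<longleftrightarrow> g' z \<in> region (p, q, r)"
      unfolding region_iff[OF D'] region_iff[OF D] o oz using n by (simp add: gg zero_le_divide_iff)
    finally show ?thesis by (simp only: fields)
  qed
  have nd: "orientation t \<noteq> 0" "region t \<subseteq> region t0" if "t \<in> T" for t using T that by (auto simp: tiled_def)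
  have nd0: "orientation t0 \<noteq> 0" and fin: "finite T" using T by (auto simp: tiled_def)
  have cover: "(\<Sum>t\<in>T. of_bool (z \<in> region t)) = (of_bool (z \<in> region t0) :: real)"
    if "\<And>t. t \<in> T \<Longrightarrow> z \<in> region t \<Longrightarrow> strictly_inside t z" for z
    using T that unfolding tiled_def by blast
  have inj: "inj ?G"
    using gg by (intro prod.inj_map) (auto intro: inj_on_inverseI[where g = g'])
  show ?thesis
    unfolding tiled_def
  proof (intro conjI ballI allI impI)
    show "finite (?G ` T)" using fin by simp
    show "orientation (?G t0) \<noteq> 0" using nd0 n by (simp add: ot)
    fix t assume "t \<in> ?G ` T"
    then obtain s where s: "s \<in> T" "t = ?G s" by auto
    show "orientation t \<noteq> 0" using nd(1)[OF s(1)] n by (simp add: ot s)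
    show "region t \<subseteq> region (?G t0)"
      using re[OF nd(1)[OF s(1)]] re[OF nd0] nd(2)[OF s(1)] unfolding s(2) by blast
  next
    fix z assume a: "\<forall>t\<in>?G ` T. z \<in> region t \<longrightarrow> strictly_inside t z"
    have "(\<Sum>t\<in>?G ` T. of_bool (z \<in> region t)) = (\<Sum>t\<in>T. of_bool (g' z \<in> region t) :: real)"
      using inj by (subst sum.reindex) (auto intro: inj_on_subset simp: re nd cong: sum.cong)
    also have "\<dots> = of_bool (g' z \<in> region t0)"
      by (rule cover) (use a nd in \<open>auto simp: re si\<close>)
    also have "\<dots> = of_bool (z \<in> region (?G t0))"
      using re[OF nd0] by simp
    finally show "(\<Sum>t\<in>?G ` T. of_bool (z \<in> region t)) = (of_bool (z \<in> region (?G t0)) :: real)" .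
  qed
qed

definition line_weight :: "complex \<Rightarrow> complex \<Rightarrow> (real \<Rightarrow> 'v) \<Rightarrow> complex \<Rightarrow> complex \<Rightarrow> 'v::real_vector" where
  "line_weight z0 u h p q = axis_weight h ((p - z0) / u) ((q - z0) / u)"

lemma tiled_line:
  fixes h :: "real \<Rightarrow> 'v::real_vector"
  assumes T: "tiled T t0" and u: "u \<noteq> 0"
  shows "(\<Sum>t\<in>T. sgn (orientation t) *\<^sub>R boundary_sum (line_weight z0 u h) t)
       = sgn (orientation t0) *\<^sub>R boundary_sum (line_weight z0 u h) t0"
proof -
  define g where "g = (\<lambda>z. (z - z0) / u)"
  let ?G = "map_prod g (map_prod g g)"
  have "inj g" using u by (auto simp: g_def inj_on_def)
  hence inj: "inj ?G" by (intro prod.inj_map)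
  have o: "orientation (?G t) = orientation t / (norm u)\<^sup>2" for t
    using orient_affine[of z0 u "g (fst t)" "g (fst (snd t))" "g (snd (snd t))"] u
    by (cases t) (simp add: g_def field_simps)
  have sg: "sgn (orientation (?G t)) = sgn (orientation t)" for t
    using u by (simp add: o sgn_divide)
  have bs: "boundary_sum (axis_weight h) (?G t) = boundary_sum (line_weight z0 u h) t" for t
    by (cases t) (simp add: line_weight_def g_def)
  have "(\<Sum>t\<in>?G ` T. sgn (orientation t) *\<^sub>R boundary_sum (axis_weight h) t)
       = sgn (orientation (?G t0)) *\<^sub>R boundary_sum (axis_weight h) (?G t0)"
    using tiled_axis[OF tiled_map[OF T u, of z0], of h] by (simp add: g_def)
  thus ?thesis using inj by (subst (asm) sum.reindex) (auto intro: inj_on_subset simp: sg bs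
    simp del: boundary_sum.simps orientation.simps)
qed

text \<open>On each line w is the difference of a potential h. Nothing relates the potentials of
  different lines.\<close>

definition line_additive :: "(complex \<Rightarrow> complex \<Rightarrow> 'v::real_vector) \<Rightarrow> bool" where
  "line_additive w \<longleftrightarrow> (\<forall>z0 u. u \<noteq> 0 \<longrightarrow>
     (\<exists>h. \<forall>s s'. w (z0 + of_real s * u) (z0 + of_real s' * u) = h s' - h s))"

lemma on_axis_quotient:
  assumes "p \<noteq> q"
  shows "on_axis ((x - p) / (q - p), (y - p) / (q - p)) \<longleftrightarrow> orient p q x = 0 \<and> orient p q y = 0"
proof -
  have "Im ((x - p) / (q - p)) = 0 \<longleftrightarrow> orient p q x = 0" for x
    using assms by (auto simp: Im_divide orient_def algebra_simps complex_eq_iff)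
  thus ?thesis by (simp add: on_axis_def)
qed

text \<open>Only finitely many lines carry edges of the triangles involved. Restricted to one of
  these lines w is a \<open>line_weight\<close>, and on all edges that occur w is the sum of these
  restrictions.\<close>

lemma tiled_boundary_sum:
  fixes w :: "complex \<Rightarrow> complex \<Rightarrow> 'v::real_vector"
  assumes T: "tiled T t0" and w: "line_additive w"
  shows "(\<Sum>t\<in>T. sgn (orientation t) *\<^sub>R boundary_sum w t) = sgn (orientation t0) *\<^sub>R boundary_sum w t0"
proof -
  define line where "line p q = {z. orient p q z = 0}" for p q
  define E where "E = (\<Union>t\<in>insert t0 T. edge t ` {..<3})"
  \<comment> \<open>Lines are taken as point sets, so that collinear edges give the same element and
    each edge lies on exactly one member of \<open>K\<close>.\<close>
  define K where "K = (\<lambda>e. line (fst e) (snd e)) ` E"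
  define wk where "wk k p q = (if p \<in> k \<and> q \<in> k then w p q else 0)" for k p q
  have finT: "finite T" and nd: "\<And>t. t \<in> insert t0 T \<Longrightarrow> orientation t \<noteq> 0"
    using T by (auto simp: tiled_def)
  have finK: "finite K" using finT by (auto simp: K_def E_def)
  have E_nd: "fst e \<noteq> snd e" if "e \<in> E" for e
  proof -
    from that obtain t j where tj: "t \<in> insert t0 T" "j < 3" "e = edge t j"
      unfolding E_def by blast
    obtain p q r where t: "t = (p, q, r)" by (cases t)
    have "orient p q r \<noteq> 0" using nd[OF tj(1)] by (simp add: t)
    thus ?thesis by (auto simp: tj(3) t)
  qed
  have line_unique: "line p q = line p' q'"
    if pq: "p \<noteq> q" "p' \<noteq> q'" and "p' \<in> line p q" "q' \<in> line p q" for p q p' q'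
  proof -
    have 1: "orient p q p' = 0" "orient p q q' = 0" using that by (auto simp: line_def)
    have a: "(q - p) \<noteq> 0" using pq by simp
    have ex: "\<exists>s. z = p + of_real s * (q - p)" if "orient p q z = 0" for z
    proof -
      have "Im ((z - p) / (q - p)) = 0"
        using that by (simp add: Im_divide orient_def algebra_simps)
      hence "(z - p) / (q - p) = of_real (Re ((z - p) / (q - p)))" by (simp add: complex_eq_iff)
      hence "z = p + of_real (Re ((z - p) / (q - p))) * (q - p)" using a by (simp add: field_simps)
      thus ?thesis by blast
    qed
    obtain s s' where s: "p' = p + of_real s * (q - p)" "q' = p + of_real s' * (q - p)"
      using ex 1 by blast
    have "orient p' q' z = (s' - s) * orient p q z" for z
      unfolding s orient_def by (simp add: algebra_simps)
    moreover have "s' \<noteq> s" using s pq by auto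
    ultimately show ?thesis by (simp add: line_def)
  qed
  have decomp: "w (fst e) (snd e) = (\<Sum>k\<in>K. wk k (fst e) (snd e))" if e: "e \<in> E" for e
  proof -
    have "(\<Sum>k\<in>K. wk k (fst e) (snd e)) = (\<Sum>k\<in>K. if k = line (fst e) (snd e) then w (fst e) (snd e) else 0)"
    proof (rule sum.cong)
      fix k assume "k \<in> K"
      then obtain e' where e': "e' \<in> E" "k = line (fst e') (snd e')" by (auto simp: K_def)
      have "fst e \<in> line (fst e) (snd e)" "snd e \<in> line (fst e) (snd e)"
        by (simp_all add: line_def)
      hence "(fst e \<in> k \<and> snd e \<in> k) \<longleftrightarrow> k = line (fst e) (snd e)"
        using line_unique[OF E_nd[OF e'(1)] E_nd[OF e]] unfolding e'(2) by blast
      thus "wk k (fst e) (snd e) = (if k = line (fst e) (snd e) then w (fst e) (snd e) else 0)"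
        by (simp add: wk_def)
    qed simp
    also have "\<dots> = w (fst e) (snd e)" using finK e by (simp add: K_def)
    finally show ?thesis by simp
  qed
  have dec: "boundary_sum w t = (\<Sum>k\<in>K. boundary_sum (wk k) t)" if "t \<in> insert t0 T" for t
  proof -
    have "edge t j \<in> E" if "j < 3" for j
      using \<open>t \<in> insert t0 T\<close> that unfolding E_def by blast
    hence "boundary_sum w t = (\<Sum>j<3. \<Sum>k\<in>K. wk k (fst (edge t j)) (snd (edge t j)))"
      unfolding sum_edges[symmetric] by (intro sum.cong refl decomp) simp
    also have "\<dots> = (\<Sum>k\<in>K. boundary_sum (wk k) t)"
      unfolding sum_edges[symmetric] by (rule sum.swap)
    finally show ?thesis .
  qed
  have one: "(\<Sum>t\<in>T. sgn (orientation t) *\<^sub>R boundary_sum (wk k) t) = sgn (orientation t0) *\<^sub>R boundary_sum (wk k) t0"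
    if "k \<in> K" for k
  proof -
    from that obtain e where e: "e \<in> E" "k = line (fst e) (snd e)" by (auto simp: K_def)
    define z0 u where "z0 = fst e" and "u = snd e - fst e"
    have u: "u \<noteq> 0" using E_nd[OF e(1)] by (simp add: u_def)
    obtain h where h: "\<And>s s'. w (z0 + of_real s * u) (z0 + of_real s' * u) = h s' - h s"
      using w u unfolding line_additive_def by meson
    have "wk k p q = line_weight z0 u h p q" for p q
    proof -
      have iff: "on_axis ((p - z0) / u, (q - z0) / u) \<longleftrightarrow> p \<in> k \<and> q \<in> k"
        unfolding z0_def u_def using on_axis_quotient[OF E_nd[OF e(1)]] by (simp add: e(2) line_def)
      show ?thesis
      proof (cases "p \<in> k \<and> q \<in> k")
        case True
        have c: "z = z0 + of_real (Re ((z - z0) / u)) * u" if "Im ((z - z0) / u) = 0" for z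
        proof -
          have "(z - z0) / u = of_real (Re ((z - z0) / u))" using that by (simp add: complex_eq_iff)
          thus ?thesis using u by (simp add: field_simps)
        qed
        have "Im ((p - z0) / u) = 0" "Im ((q - z0) / u) = 0" using True iff by (auto simp: on_axis_def)
        hence "w p q = h (Re ((q - z0) / u)) - h (Re ((p - z0) / u))"
          using c h by metis
        thus ?thesis using True iff by (simp add: wk_def line_weight_def axis_weight_def)
      qed (use iff in \<open>auto simp: wk_def line_weight_def axis_weight_def\<close>)
    qed
    hence "wk k = line_weight z0 u h" by blast
    thus ?thesis using tiled_line[OF T u] by metis
  qed
  have "(\<Sum>t\<in>T. sgn (orientation t) *\<^sub>R boundary_sum w t)
      = (\<Sum>t\<in>T. \<Sum>k\<in>K. sgn (orientation t) *\<^sub>R boundary_sum (wk k) t)"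
    by (intro sum.cong refl) (simp add: dec scaleR_right.sum del: boundary_sum.simps)
  also have "\<dots> = (\<Sum>k\<in>K. \<Sum>t\<in>T. sgn (orientation t) *\<^sub>R boundary_sum (wk k) t)"
    by (rule sum.swap)
  also have "\<dots> = (\<Sum>k\<in>K. sgn (orientation t0) *\<^sub>R boundary_sum (wk k) t0)"
    by (intro sum.cong refl one)
  also have "\<dots> = sgn (orientation t0) *\<^sub>R boundary_sum w t0"
    by (simp only: dec insertI1 scaleR_right.sum)
  finally show ?thesis .
qed

section \<open>Distances, congruent copies and area\<close>

lemma cmod_diff_square: "(dist p q)\<^sup>2 = (Re p - Re q)\<^sup>2 + (Im p - Im q)\<^sup>2"
  by (simp add: dist_norm cmod_power2)

text \<open>Heron's formula for sixteen times the squared area; the distances thus determine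
  \<open>orient\<close> up to sign.\<close>

lemma orient_square_dist:
  "4 * (orient p q r)\<^sup>2 =
     4 * (dist p q)\<^sup>2 * (dist p r)\<^sup>2 - ((dist p q)\<^sup>2 + (dist p r)\<^sup>2 - (dist q r)\<^sup>2)\<^sup>2"
  unfolding cmod_diff_square orient_def by algebra

lemma inner_dist:
  fixes x y z :: complex
  shows "2 * ((x - y) \<bullet> (z - y)) = (dist x y)\<^sup>2 + (dist z y)\<^sup>2 - (dist x z)\<^sup>2"
  unfolding cmod_diff_square inner_complex_def minus_complex.sel by algebra

lemma angle_at_dist:
  "angle_at x y z = arccos (((dist x y)\<^sup>2 + (dist z y)\<^sup>2 - (dist x z)\<^sup>2) / 2 / (dist x y * dist z y))"
  unfolding angle_at_def inner_dist[symmetric] by (simp add: dist_norm)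

lemma copy_of_dist:
  assumes "copy_of (P, Q, R) (p, q, r)"
  shows "dist p q = dist P Q" "dist q r = dist Q R" "dist r p = dist R P"
  using assms by (auto simp: copy_of_def similarity_def)

lemma abs_orient_cong:
  assumes "dist p q = dist P Q" "dist q r = dist Q R" "dist r p = dist R P"
  shows "\<bar>orient p q r\<bar> = \<bar>orient P Q R\<bar>"
proof -
  have "(orient p q r)\<^sup>2 = (orient P Q R)\<^sup>2"
    using orient_square_dist[of p q r] orient_square_dist[of P Q R] assms by (simp add: dist_commute)
  thus ?thesis by (simp add: power2_eq_iff abs_eq_iff)
qed

lemma copy_of_orientation: "copy_of s t \<Longrightarrow> \<bar>orientation t\<bar> = \<bar>orientation s\<bar>"
  using copy_of_dist abs_orient_cong by (cases s; cases t) (metis orientation.simps)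

text \<open>A point that is strictly inside every tile containing it is interior to each of them, so
  disjoint interiors allow at most one such tile.\<close>

lemma tiling_imp_tiled:
  assumes til: "tiling s T t0" and s: "nondegenerate s" and t0: "nondegenerate t0"
  shows "tiled T t0"
  unfolding tiled_def
proof (intro conjI ballI allI impI)
  have cop: "\<And>t. t \<in> T \<Longrightarrow> copy_of s t" and un: "(\<Union>t\<in>T. region t) = region t0"
    and disj: "\<And>t t'. t \<in> T \<Longrightarrow> t' \<in> T \<Longrightarrow> t \<noteq> t' \<Longrightarrow> interior (region t) \<inter> interior (region t') = {}"
    using til unfolding tiling_def by blast+
  show fin: "finite T" using til by (simp add: tiling_def)
  show "orientation t0 \<noteq> 0" using t0 by (simp add: nondegenerate_iff)
  fix t assume "t \<in> T"
  thus "orientation t \<noteq> 0" using copy_of_orientation[OF cop[OF \<open>t \<in> T\<close>]] s by (auto simp: nondegenerate_iff)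
  show "region t \<subseteq> region t0" using un \<open>t \<in> T\<close> by blast
next
  fix z assume strict: "\<forall>t\<in>T. z \<in> region t \<longrightarrow> strictly_inside t z"
  have un: "(\<Union>t\<in>T. region t) = region t0" and fin: "finite T"
    and disj: "\<And>t t'. t \<in> T \<Longrightarrow> t' \<in> T \<Longrightarrow> t \<noteq> t' \<Longrightarrow> interior (region t) \<inter> interior (region t') = {}"
    using til unfolding tiling_def by blast+
  show "(\<Sum>t\<in>T. of_bool (z \<in> region t)) = (of_bool (z \<in> region t0) :: real)"
  proof (cases "z \<in> region t0")
    case True
    then obtain t where t: "t \<in> T" "z \<in> region t" using un by blast
    have "(z \<in> region t') = (t' = t)" if "t' \<in> T" for t'
      using disj[OF t(1) that] strict t that strictly_inside_imp_interior by blast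
    hence "(\<Sum>t\<in>T. of_bool (z \<in> region t)) = (\<Sum>t'\<in>T. if t' = t then 1 else (0::real))"
      by (intro sum.cong) auto
    thus ?thesis using fin t True by simp
  next
    case False
    hence "\<And>t. t \<in> T \<Longrightarrow> z \<notin> region t" using un by blast
    thus ?thesis using False by simp
  qed
qed

text \<open>The shoelace formula: the cross product of the end points is additive along lines, and
  its boundary sum is twice the signed area.\<close>

lemma tiled_area:
  assumes "tiled T t0"
  shows "(\<Sum>t\<in>T. \<bar>orientation t\<bar>) = \<bar>orientation t0\<bar>"
proof -
  define w where "w p q = Re p * Im q - Im p * Re q" for p q
  have "line_additive w"
    unfolding line_additive_def
  proof (intro allI impI)
    fix z0 u :: complex
    show "\<exists>h. \<forall>s s'. w (z0 + of_real s * u) (z0 + of_real s' * u) = h s' - h s"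
      by (rule exI[of _ "\<lambda>s. s * w z0 u"]) (simp add: w_def algebra_simps)
  qed
  moreover have "boundary_sum w t = orientation t" for t
    by (cases t) (simp add: w_def orient_def algebra_simps)
  ultimately show ?thesis
    using tiled_boundary_sum[OF assms, of w] by (simp add: abs_sgn mult.commute)
qed

section \<open>Tile edges along a side of the tiled triangle\<close>

definition aligned :: "complex \<Rightarrow> complex \<Rightarrow> complex \<Rightarrow> complex \<Rightarrow> bool" where
  "aligned p q x y \<longleftrightarrow> orient p q x = 0 \<and> orient p q y = 0"

lemma orient_zero_point:
  assumes "p \<noteq> q" "orient p q z = 0"
  shows "z = p + of_real (Re ((z - p) / (q - p))) * (q - p)"
proof -
  have "Im ((z - p) / (q - p)) = 0"
    using assms(2) by (simp add: Im_divide orient_def algebra_simps)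
  hence "(z - p) / (q - p) = of_real (Re ((z - p) / (q - p)))" by (simp add: complex_eq_iff)
  thus ?thesis using assms(1) by (simp add: field_simps)
qed

lemma tiled_cong:
  assumes "tiled T t0" "region t1 = region t0" "orientation t1 \<noteq> 0"
  shows "tiled T t1"
  using assms(1,3) unfolding tiled_def assms(2) by blast

lemma tiled_orientation: "tiled T (p, q, r) \<Longrightarrow> orient p q r \<noteq> 0"
  by (simp add: tiled_def)

lemma tiled_rotate:
  assumes "tiled T (p, q, r)"
  shows "tiled T (q, r, p)"
  by (rule tiled_cong[OF assms region_rotate])
    (use tiled_orientation[OF assms] in \<open>simp add: orient_rotate\<close>)

lemma region_swap: "region (q, p, r) = region (p, q, r)"
  by (simp add: insert_commute)

lemma tiled_swap:
  assumes "tiled T (p, q, r)"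
  shows "tiled T (q, p, r)"
  by (rule tiled_cong[OF assms region_swap])
    (use tiled_orientation[OF assms] in \<open>simp add: orient_swap[of q p]\<close>)

text \<open>This is \<open>tiled_line\<close> on the line through p and q, with the identity as
  potential. All tiles lie on one side of that line, so the orientation of a tile and the direction
  of its edge on the line determine each other, and signed lengths become lengths.\<close>

lemma tiled_side:
  assumes T: "tiled T (p, q, r)"
  shows "dist p q = (\<Sum>t\<in>T. boundary_sum (\<lambda>x y. if aligned p q x y then dist x y else 0) t)"
proof -
  define D where "D = orient p q r"
  have D: "D \<noteq> 0" using T by (simp add: tiled_def D_def)
  hence pq: "p \<noteq> q" by (auto simp: D_def)
  define u where "u = q - p"
  have u: "u \<noteq> 0" using pq by (simp add: u_def)
  define \<sigma> where "\<sigma> z = Re ((z - p) / u)" for z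
  define w where "w = line_weight p u (\<lambda>x. x)"
  have w: "w x y = (if aligned p q x y then \<sigma> y - \<sigma> x else 0)" for x y
    using on_axis_quotient[OF pq, of x y]
    by (simp add: w_def line_weight_def axis_weight_def \<sigma>_def u_def aligned_def)
  have "boundary_sum w (p, q, r) = 1"
    using D u by (simp add: w aligned_def \<sigma>_def u_def[symmetric] D_def)
  hence total: "(\<Sum>t\<in>T. sgn (orientation t) * boundary_sum w t) = sgn D"
    using tiled_line[OF T u, of p "\<lambda>x. x"] by (simp add: w_def D_def del: boundary_sum.simps)
  \<comment> \<open>The third vertex z lies on the side of r, so the sign of the triangle times the
    direction of its edge is the sign of D.\<close>
  have edge: "sgn D * (sgn (orient x y z) * w x y) = (if aligned p q x y then dist x y else 0) / norm u"
    if "0 \<le> D * orient p q z" "orient x y z \<noteq> 0" for x y z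
  proof (cases "aligned p q x y")
    case True
    have xy: "x = p + of_real (\<sigma> x) * u" "y = p + of_real (\<sigma> y) * u"
      using True orient_zero_point[OF pq] by (simp_all add: aligned_def \<sigma>_def u_def)
    have o: "orient x y z = (\<sigma> y - \<sigma> x) * orient p q z"
    proof -
      have "orient (p + of_real a * u) (p + of_real b * u) z = (b - a) * orient p q z" for a b
        by (simp add: orient_def u_def algebra_simps)
      thus ?thesis using xy by metis
    qed
    hence "orient p q z \<noteq> 0" using that by auto
    hence "sgn (orient p q z) = sgn D"
      using that(1) D by (auto simp: sgn_if zero_le_mult_iff)
    hence 1: "sgn (orient x y z) = sgn (\<sigma> y - \<sigma> x) * sgn D" by (simp add: o sgn_mult)
    have "y - x = of_real (\<sigma> y - \<sigma> x) * u"
    proof -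
      have "(p + of_real b * u) - (p + of_real a * u) = of_real (b - a) * u" for a b
        by (simp add: algebra_simps)
      thus ?thesis using xy by metis
    qed
    hence "dist x y = \<bar>\<sigma> y - \<sigma> x\<bar> * norm u"
      by (metis dist_commute dist_norm norm_mult norm_of_real)
    moreover have "sgn D * sgn D = 1" using D by (simp add: sgn_if)
    ultimately show ?thesis
      using True u by (simp add: w 1 abs_sgn mult.commute mult.left_commute)
  qed (simp add: w)
  have tile: "sgn D * (sgn (orientation t) * boundary_sum w t)
      = boundary_sum (\<lambda>x y. if aligned p q x y then dist x y else 0) t / norm u" if t: "t \<in> T" for t
  proof -
    obtain x y z where xyz: "t = (x, y, z)" by (cases t)
    have sub: "region t \<subseteq> region (p, q, r)" and nd: "orient x y z \<noteq> 0"
      using T t unfolding tiled_def by (auto simp: xyz simp del: region.simps)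
    have "{x, y, z} \<subseteq> region t" using hull_subset[of "{x, y, z}" convex] by (simp add: xyz)
    hence "0 \<le> D * orient p q v" if "v \<in> {x, y, z}" for v
      using that sub D region_iff[of p q r v] unfolding D_def by blast
    hence ge: "0 \<le> D * orient p q x" "0 \<le> D * orient p q y" "0 \<le> D * orient p q z" by auto
    have "sgn D * (sgn (orientation t) * boundary_sum w t)
        = sgn D * (sgn (orient x y z) * w x y) + sgn D * (sgn (orient y z x) * w y z) + sgn D * (sgn (orient z x y) * w z x)"
      by (simp add: xyz orient_rotate[of y z x, symmetric] orient_rotate[of z x y] algebra_simps)
    thus ?thesis
      using edge[OF ge(3), of x y] edge[OF ge(1), of y z] edge[OF ge(2), of z x] nd
      by (simp add: xyz orient_rotate add_divide_distrib)
  qed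
  have "1 = sgn D * (\<Sum>t\<in>T. sgn (orientation t) * boundary_sum w t)"
    using total D by (simp add: sgn_if)
  also have "\<dots> = (\<Sum>t\<in>T. boundary_sum (\<lambda>x y. if aligned p q x y then dist x y else 0) t) / norm u"
    by (simp add: sum_distrib_left tile sum_divide_distrib)
  finally show ?thesis using u by (simp add: u_def dist_norm norm_minus_commute field_simps)
qed

section \<open>Corners of a tiled triangle\<close>

text \<open>The two other vertices are passed in cyclic order, so that the sign of the orientation
  tells which of the two rays at v comes first.\<close>

fun corner_sum :: "complex \<Rightarrow> (complex \<Rightarrow> complex \<Rightarrow> 'a::ab_group_add) \<Rightarrow> triangle \<Rightarrow> 'a" where
  "corner_sum v w (p, q, r) =
     (if p = v then w q r else 0) + (if q = v then w r p else 0) + (if r = v then w p q else 0)"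

lemma orient_zero_polar: "orient 0 q r = norm q * norm r * sin (Arg r - Arg q)"
proof -
  have p: "Re z = norm z * cos (Arg z)" "Im z = norm z * sin (Arg z)" for z
    using rcis_cmod_Arg[of z] by (metis Re_rcis, metis Im_rcis)
  have "orient 0 q r = Re q * Im r - Im q * Re r" by (simp add: orient_def)
  also have "\<dots> = norm q * norm r * sin (Arg r - Arg q)"
    unfolding p[of q] p[of r] sin_diff by (simp add: algebra_simps)
  finally show ?thesis .
qed

lemma inner_polar:
  fixes q r :: complex
  shows "q \<bullet> r = norm q * norm r * cos (Arg r - Arg q)"
proof -
  have p: "Re z = norm z * cos (Arg z)" "Im z = norm z * sin (Arg z)" for z
    using rcis_cmod_Arg[of z] by (metis Re_rcis, metis Im_rcis)
  show ?thesis
    unfolding inner_complex_def cos_diff p[of q] p[of r] by (simp add: algebra_simps)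
qed

lemma sgn_sin: "\<bar>x\<bar> < pi \<Longrightarrow> sgn (sin x) = sgn x"
proof -
  assume x: "\<bar>x\<bar> < pi"
  consider "x = 0" | "x > 0" | "x < 0" by linarith
  thus ?thesis
  proof cases
    case 2 thus ?thesis using x sin_gt_zero[of x] by simp
  next
    case 3 thus ?thesis using x sin_gt_zero[of "-x"] by simp
  qed simp
qed

lemma orient_zero_pos_iff:
  assumes "q \<noteq> 0" "r \<noteq> 0" "\<bar>Arg r - Arg q\<bar> < pi"
  shows "sgn (orient 0 q r) = sgn (Arg r - Arg q)"
  using assms by (simp add: orient_zero_polar sgn_mult sgn_sin)

lemma angle_at_zero_Arg:
  assumes "q \<noteq> 0" "r \<noteq> 0" "\<bar>Arg r - Arg q\<bar> < pi"
  shows "angle_at q 0 r = \<bar>Arg r - Arg q\<bar>"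
proof -
  have "angle_at q 0 r = arccos (cos \<bar>Arg r - Arg q\<bar>)"
    unfolding angle_at_def using assms by (simp add: inner_polar)
  also have "\<dots> = \<bar>Arg r - Arg q\<bar>" using assms by (intro arccos_cos) auto
  finally show ?thesis .
qed

text \<open>The polar counterpart of \<open>axis_local\<close>: close to 0, the ray of angle
  \<theta> is in t exactly if \<theta> lies between the arguments of two sides of t that start at
  0.\<close>

definition corner_local :: "triangle \<Rightarrow> real \<Rightarrow> real \<Rightarrow> bool" where
  "corner_local t \<theta> d \<longleftrightarrow>
     of_bool (rcis d \<theta> \<in> region t) =
       sgn (orientation t) * corner_sum 0 (\<lambda>q r. of_bool (Arg q < \<theta>) - of_bool (Arg r < \<theta>)) t \<and>
     (rcis d \<theta> \<in> region t \<longrightarrow> strictly_inside t (rcis d \<theta>))"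

lemma corner_local_rotate: "corner_local (q, r, p) = corner_local (p, q, r)"
  unfolding corner_local_def [abs_def] region_rotate strictly_inside_rotate
  by (simp add: orient_rotate add_ac)

lemma tendsto_rcis_zero: "((\<lambda>d. rcis d \<theta>) \<longlongrightarrow> 0) (at_right 0)"
proof -
  have "((\<lambda>d. of_real d * cis \<theta>) \<longlongrightarrow> of_real 0 * cis \<theta>) (at_right 0)"
    by (intro tendsto_intros)
  thus ?thesis by (simp add: rcis_def)
qed

lemma corner_local_vertex:
  assumes D: "orient 0 q r \<noteq> 0" and \<theta>: "0 < \<theta>" "\<theta> < pi" "\<theta> \<noteq> Arg q" "\<theta> \<noteq> Arg r"
    and A: "0 \<le> Arg q" "Arg q < pi" "0 \<le> Arg r" "Arg r < pi"
  shows "eventually (corner_local (0, q, r) \<theta>) (at_right 0)"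
proof -
  let ?D = "orient 0 q r"
  have nz: "q \<noteq> 0" "r \<noteq> 0" using D by (auto simp: orient_def)
  have sD: "sgn ?D = sgn (Arg r - Arg q)" using nz A by (intro orient_zero_pos_iff) auto
  have "continuous_on UNIV (\<lambda>z. ?D * orient q r z)" by (intro continuous_intros)
  hence "isCont (\<lambda>z. ?D * orient q r z) 0" by (simp add: continuous_on_eq_continuous_at)
  from isCont_tendsto_compose[OF this tendsto_rcis_zero]
  have "((\<lambda>d. ?D * orient q r (rcis d \<theta>)) \<longlongrightarrow> ?D * orient q r 0) (at_right 0)" .
  \<comment> \<open>The side opposite to 0 stays away from 0, so near 0 only the conditions of the
    two other sides matter.\<close>
  moreover have "?D * orient q r 0 > 0"
  proof -
    have "orient q r 0 = ?D" by (rule orient_rotate)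
    thus ?thesis using D by (simp add: zero_less_mult_iff) linarith
  qed
  ultimately have ev: "eventually (\<lambda>d. ?D * orient q r (rcis d \<theta>) > 0) (at_right 0)"
    by (rule order_tendstoD(1))
  have "eventually (\<lambda>d::real. 0 < d) (at_right 0)" by (rule eventually_at_right_less)
  with ev show ?thesis
  proof eventually_elim
    case (elim d)
    have Az: "Arg (rcis d \<theta>) = \<theta>" using elim \<theta> by (simp add: Arg_rcis)
    have nz': "rcis d \<theta> \<noteq> 0" using elim by simp
    have 1: "sgn (orient 0 q (rcis d \<theta>)) = sgn (\<theta> - Arg q)"
      using orient_zero_pos_iff[OF nz(1) nz'] Az \<theta> A by (simp add: abs_if)
    have "sgn (orient 0 (rcis d \<theta>) r) = sgn (Arg r - \<theta>)"
      using orient_zero_pos_iff[OF nz' nz(2)] Az \<theta> A by (simp add: abs_if)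
    hence 2: "sgn (orient r 0 (rcis d \<theta>)) = sgn (Arg r - \<theta>)"
      by (simp only: orient_rotate[of 0 "rcis d \<theta>" r])
    have D0: "Arg r \<noteq> Arg q" using sD D by (auto simp: sgn_zero_iff)
    have pos: "0 < x * y \<longleftrightarrow> sgn x = sgn y" "0 \<le> x * y \<longleftrightarrow> sgn x = sgn y" if "x \<noteq> 0" "y \<noteq> 0" for x y :: real
      using that by (auto simp: sgn_if zero_less_mult_iff zero_le_mult_iff)
    have n12: "orient 0 q (rcis d \<theta>) \<noteq> 0" "orient r 0 (rcis d \<theta>) \<noteq> 0"
      using 1 2 \<theta> by (auto simp: sgn_if split: if_splits)
    have in_iff: "rcis d \<theta> \<in> region (0, q, r) \<longleftrightarrow> sgn (Arg r - Arg q) = sgn (\<theta> - Arg q) \<and> sgn (Arg r - Arg q) = sgn (Arg r - \<theta>)"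
      unfolding region_iff[OF D] pos(2)[OF D n12(1)] pos(2)[OF D n12(2)] sD 1 2 using elim by auto
    have st_iff: "strictly_inside (0, q, r) (rcis d \<theta>) \<longleftrightarrow> sgn (Arg r - Arg q) = sgn (\<theta> - Arg q) \<and> sgn (Arg r - Arg q) = sgn (Arg r - \<theta>)"
      unfolding strictly_inside.simps pos(1)[OF D n12(1)] pos(1)[OF D n12(2)] sD 1 2 using elim by auto
    show ?case
      unfolding corner_local_def in_iff st_iff
      using sD D0 \<theta> nz by (auto simp: sgn_if)
  qed
qed

lemma corner_local_away:
  assumes "0 \<notin> region t"
  shows "eventually (corner_local t \<theta>) (at_right 0)"
proof -
  obtain p q r where t: "t = (p, q, r)" by (cases t)
  have "{p, q, r} \<subseteq> region t" using hull_subset[of "{p, q, r}" convex] by (simp add: t)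
  hence "p \<noteq> 0" "q \<noteq> 0" "r \<noteq> 0" using assms by auto
  hence 0: "corner_sum 0 (\<lambda>q r. of_bool (Arg q < \<theta>) - of_bool (Arg r < \<theta>)) t = (0::real)"
    by (simp add: t)
  have "0 \<in> - region t" using assms by simp
  from topological_tendstoD[OF tendsto_rcis_zero open_Compl[OF closed_region] this]
  show ?thesis
  proof (rule eventually_mono)
    fix d assume "rcis d \<theta> \<in> - region t"
    thus "corner_local t \<theta> d" by (simp add: corner_local_def 0)
  qed
qed

text \<open>In the normalised position all arguments lie between 0 and \<open>Arg C\<close>, which
  is less than \<open>pi\<close>; the branch cut of \<open>Arg\<close> is never met, and differences
  of arguments are angles.\<close>

lemma region_sector:
  assumes C: "Im C > 0" and z: "z \<in> region (0, 1, C)" "z \<noteq> 0"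
  shows "0 \<le> Arg z" "Arg z \<le> Arg C" "Arg C < pi"
proof -
  have D: "orient 0 1 C = Im C" by (simp add: orient_def)
  have "orient 0 1 C \<noteq> 0" using C by (simp add: D)
  from z(1)[unfolded region_iff[OF this]] C
  have ge: "0 \<le> orient 0 1 z" "0 \<le> orient C 0 z" by (auto simp: D zero_le_mult_iff)
  show C': "Arg C < pi" using C Arg_lt_pi by blast
  have "0 \<le> Im z" using ge(1) by (simp add: orient_def)
  thus A0: "0 \<le> Arg z" by (simp add: Arg_less_0)
  have C0: "C \<noteq> 0" "0 < Arg C" using C Arg_lt_pi[of C] by auto
  have "0 \<le> orient 0 z C" using ge(2) by (simp add: orient_rotate)
  hence s: "0 \<le> sin (Arg C - Arg z)"
    using z(2) C0 by (simp add: orient_zero_polar zero_le_mult_iff mult_le_0_iff)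
  show "Arg z \<le> Arg C"
  proof (rule ccontr)
    assume "\<not> ?thesis"
    hence "0 < Arg z - Arg C" "Arg z - Arg C < pi" using C0 Arg_le_pi[of z] by auto
    hence "0 < sin (Arg z - Arg C)" by (rule sin_gt_zero)
    thus False using s sin_minus[of "Arg z - Arg C"] by simp
  qed
qed

text \<open>0 is an extreme point of the large triangle, so a tile that contains it has it as a
  vertex.\<close>

lemma corner_is_vertex:
  assumes C: "Im C > 0" and t: "0 \<in> region (p, q, r)" "region (p, q, r) \<subseteq> region (0, 1, C)"
  shows "p = 0 \<or> q = 0 \<or> r = 0"
proof -
  have D: "orient 0 1 C = Im C" by (simp add: orient_def)
  have D0: "orient 0 1 C \<noteq> 0" using C by (simp add: D)
  \<comment> \<open>The sum of the two side functionals at 0: linear, nonnegative on the large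
    triangle, and zero there only at 0.\<close>
  define L where "L z = Im z + (Re z * Im C - Im z * Re C)" for z
  have L: "0 \<le> L z" "L z = 0 \<Longrightarrow> z = 0" if "z \<in> region (0, 1, C)" for z
  proof -
    have ge: "0 \<le> Im z" "0 \<le> Re z * Im C - Im z * Re C"
      using that[unfolded region_iff[OF D0]] C by (auto simp: D orient_def zero_le_mult_iff algebra_simps)
    thus "0 \<le> L z" by (simp add: L_def)
    assume "L z = 0"
    hence "Im z = 0" "Re z * Im C - Im z * Re C = 0"
      unfolding L_def using add_nonneg_eq_0_iff[OF ge] by auto
    thus "z = 0" using C by (simp add: complex_eq_iff)
  qed
  from t(1) obtain u v w where uvw: "0 \<le> u" "0 \<le> v" "0 \<le> w" "u + v + w = 1"
    and z: "0 = u *\<^sub>R p + v *\<^sub>R q + w *\<^sub>R r"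
    by (auto simp: convex_hull_3)
  have "L (u *\<^sub>R p + v *\<^sub>R q + w *\<^sub>R r) = u * L p + v * L q + w * L r"
    by (simp add: L_def algebra_simps)
  hence s: "u * L p + v * L q + w * L r = 0" using z by (simp add: L_def)
  have "{p, q, r} \<subseteq> region (0, 1, C)"
    using hull_subset[of "{p, q, r}" convex] t(2) by auto
  hence m: "p \<in> region (0, 1, C)" "q \<in> region (0, 1, C)" "r \<in> region (0, 1, C)" by blast+
  have "u * L p = 0" "v * L q = 0" "w * L r = 0"
    using s mult_nonneg_nonneg[OF uvw(1) L(1)[OF m(1)]] mult_nonneg_nonneg[OF uvw(2) L(1)[OF m(2)]]
      mult_nonneg_nonneg[OF uvw(3) L(1)[OF m(3)]] by linarith+
  thus ?thesis using uvw(4) L(2) m by auto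
qed

text \<open>The argument of the axis again, with the angle on a small circle around 0 as the
  variable. The identity as h gives the angle sum at the corner, and indicators of single angles
  detect tiles lying along the two sides.\<close>

lemma tiled_corner_normalised:
  fixes h :: "real \<Rightarrow> 'v::real_vector"
  assumes T: "tiled T (0, 1, C)" and C: "Im C > 0"
  shows "(\<Sum>t\<in>T. sgn (orientation t) *\<^sub>R corner_sum 0 (\<lambda>q r. h (Arg r) - h (Arg q)) t) = h (Arg C) - h 0"
proof -
  let ?t0 = "(0, 1, C)"
  \<comment> \<open>The k-th vertex is rotated to the front; if it is not 0, both ends of the
    interval are set to 0 and the term vanishes.\<close>
  define opp where "opp t k = (case t of (p, q, r) \<Rightarrow> if k = 0 then (p, q, r) else if k = 1 then (q, r, p) else (r, p, q))"
    for t :: triangle and k :: nat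
  define l r where "l t k = (if fst (opp t k) = 0 then Arg (fst (snd (opp t k))) else 0)"
    and "r t k = (if fst (opp t k) = 0 then Arg (snd (snd (opp t k))) else 0)" for t k
  have hs: "(\<Sum>k<3. g (r t k) - g (l t k)) = corner_sum 0 (\<lambda>q r. g (Arg r) - g (Arg q)) t"
    for g :: "real \<Rightarrow> 'w::real_vector" and t
    by (cases t) (simp add: eval_nat_numeral l_def r_def opp_def)
  have js: "(\<Sum>k<3. of_bool (l t k < x) - of_bool (r t k < x)) =
      (corner_sum 0 (\<lambda>q r. of_bool (Arg q < x) - of_bool (Arg r < x)) t :: real)" for t x
    by (cases t) (simp add: eval_nat_numeral l_def r_def opp_def)
  have fin: "finite T" and nd: "\<And>t. t \<in> insert ?t0 T \<Longrightarrow> orientation t \<noteq> 0"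
    and sub: "\<And>t. t \<in> insert ?t0 T \<Longrightarrow> region t \<subseteq> region ?t0"
    using T unfolding tiled_def by auto
  have cover: "\<And>z. (\<And>t. t \<in> T \<Longrightarrow> z \<in> region t \<Longrightarrow> strictly_inside t z) \<Longrightarrow>
        (\<Sum>t\<in>T. of_bool (z \<in> region t)) = (of_bool (z \<in> region ?t0) :: real)"
    using T unfolding tiled_def by blast
  define F where "F = insert 0 (insert (Arg C) (\<Union>t\<in>insert ?t0 T. l t ` {..<3} \<union> r t ` {..<3}))"
  have lrF: "l t k \<in> F" "r t k \<in> F" if "t \<in> insert ?t0 T" "k < 3" for t k
    unfolding F_def using that by blast+
  have C0: "0 < Arg C" using C Arg_lt_pi by blast
  have lr: "0 \<le> l t k" "l t k \<le> Arg C" "0 \<le> r t k" "r t k \<le> Arg C" if t: "t \<in> insert ?t0 T" "k < 3" for t k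
  proof -
    obtain a b c where abc: "opp t k = (a, b, c)" by (cases "opp t k")
    have "{a, b, c} \<subseteq> region t"
    proof -
      obtain p q r where pqr: "t = (p, q, r)" by (cases t)
      have "{a, b, c} = {p, q, r}" using abc by (auto simp: opp_def pqr split: if_splits)
      thus ?thesis using hull_subset[of "{p, q, r}" convex] by (simp add: pqr)
    qed
    hence m: "b \<in> region ?t0" "c \<in> region ?t0" using sub[OF t(1)] by blast+
    have "orient a b c = orientation t"
      using abc by (cases t) (auto simp: opp_def orient_rotate split: if_splits)
    hence "orient a b c \<noteq> 0" using nd[OF t(1)] by simp
    hence "a = 0 \<Longrightarrow> b \<noteq> 0 \<and> c \<noteq> 0" by auto
    thus "0 \<le> l t k" "l t k \<le> Arg C" "0 \<le> r t k" "r t k \<le> Arg C"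
      unfolding l_def r_def abc using region_sector[OF C m(1)] region_sector[OF C m(2)] C0 by auto
  qed
  have loc: "eventually (corner_local t \<theta>) (at_right 0)"
    if t: "t \<in> insert ?t0 T" and \<theta>: "0 < \<theta>" "\<theta> < Arg C" "\<theta> \<notin> F" for t \<theta>
  proof (cases "0 \<in> region t")
    case True
    obtain p q r' where pqr: "t = (p, q, r')" by (cases t)
    have cp: "Arg C < pi" using C Arg_lt_pi by blast
    have v: "eventually (corner_local (0, b, c) \<theta>) (at_right 0)" if "k < 3" "opp t k = (0, b, c)" for b c k
    proof (rule corner_local_vertex)
      have "orient 0 b c = orientation t"
        using that(2) by (cases t) (auto simp: opp_def orient_rotate split: if_splits)
      thus "orient 0 b c \<noteq> 0" using nd[OF t] by simp
      have lr': "l t k = Arg b" "r t k = Arg c" by (simp_all add: l_def r_def that)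
      show "0 < \<theta>" "\<theta> < pi" using \<theta> cp by auto
      show "\<theta> \<noteq> Arg b" "\<theta> \<noteq> Arg c" using lrF[OF t that(1)] \<theta> lr' by auto
      show "0 \<le> Arg b" "Arg b < pi" "0 \<le> Arg c" "Arg c < pi" using lr[OF t that(1)] lr' cp by auto
    qed
    consider "p = 0" | "q = 0" | "r' = 0"
      using corner_is_vertex[OF C] True sub[OF t] unfolding pqr by blast
    thus ?thesis
    proof cases
      case 1 thus ?thesis using v[of 0 q r'] by (simp add: pqr opp_def)
    next
      case 2 thus ?thesis using v[of 1 r' p] corner_local_rotate[of q r' p] by (simp add: pqr opp_def)
    next
      case 3 thus ?thesis using v[of 2 p q] corner_local_rotate[of q r' p] corner_local_rotate[of r' p q]
        by (simp add: pqr opp_def)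
    qed
  qed (rule corner_local_away)
  have main: "(\<Sum>t\<in>T. sgn (orientation t) *\<^sub>R corner_sum 0 (\<lambda>q r. h (Arg r) - h (Arg q)) t)
     = sgn (orientation ?t0) *\<^sub>R corner_sum 0 (\<lambda>q r. h (Arg r) - h (Arg q)) ?t0"
  proof (rule signed_step_transfer[where l = l and r = r and F = F, unfolded hs js])
    show "finite T" by fact
    show "finite F" using fin by (simp add: F_def)
    fix \<theta> assume \<theta>: "\<theta> \<notin> F"
    show "(\<Sum>t\<in>T. sgn (orientation t) * corner_sum 0 (\<lambda>q r. of_bool (Arg q < \<theta>) - of_bool (Arg r < \<theta>)) t)
       = sgn (orientation ?t0) * corner_sum 0 (\<lambda>q r. of_bool (Arg q < \<theta>) - of_bool (Arg r < \<theta>)) ?t0"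
    proof (cases "0 < \<theta> \<and> \<theta> < Arg C")
      case True
      hence "\<forall>t\<in>insert ?t0 T. eventually (corner_local t \<theta>) (at_right 0)" using loc \<theta> by blast
      hence "eventually (\<lambda>e. \<forall>t\<in>insert ?t0 T. corner_local t \<theta> e) (at_right 0)"
        using fin by (intro eventually_ball_finite) auto
      then obtain e where e: "\<forall>t\<in>insert ?t0 T. corner_local t \<theta> e"
        using eventually_happens'[OF trivial_limit_at_right_real] by blast
      have c: "(\<Sum>t\<in>T. of_bool (rcis e \<theta> \<in> region t)) = (of_bool (rcis e \<theta> \<in> region ?t0) :: real)"
        by (rule cover) (use e in \<open>unfold corner_local_def, blast\<close>)
      have e': "sgn (orientation t) * corner_sum 0 (\<lambda>q r. of_bool (Arg q < \<theta>) - of_bool (Arg r < \<theta>)) t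
          = of_bool (rcis e \<theta> \<in> region t)" if "t \<in> insert ?t0 T" for t
        using e that unfolding corner_local_def by auto
      show ?thesis
        using c e' by (simp del: corner_sum.simps orientation.simps region.simps cong: sum.cong)
    next
      case False
      have "0 \<in> F" "Arg C \<in> F" by (auto simp: F_def)
      hence out: "\<theta> < 0 \<or> Arg C < \<theta>" using False \<theta> by (metis linorder_neqE_linordered_idom)
      have z: "(\<Sum>k<3. of_bool (l t k < \<theta>) - of_bool (r t k < \<theta>)) = (0::real)" if "t \<in> insert ?t0 T" for t
      proof (rule sum.neutral, rule ballI)
        fix k :: nat assume "k \<in> {..<3}"
        hence "k < 3" by simp
        from lr[OF that this] out show "of_bool (l t k < \<theta>) - of_bool (r t k < \<theta>) = (0::real)" by auto
      qed
      show ?thesis using z unfolding js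
        by (simp only: insertI1 insertI2 mult_zero_right sum.neutral_const cong: sum.cong)
    qed
  qed
  have "orientation ?t0 > 0" using C by (simp add: orient_def)
  thus ?thesis using main C by (auto simp del: orientation.simps)
qed

fun corner_ex :: "complex \<Rightarrow> (complex \<Rightarrow> complex \<Rightarrow> bool) \<Rightarrow> triangle \<Rightarrow> bool" where
  "corner_ex v P (p, q, r) \<longleftrightarrow> p = v \<and> P q r \<or> q = v \<and> P r p \<or> r = v \<and> P p q"

lemma corner_ex_mono:
  assumes "corner_ex v P t" and "\<And>q r. P q r \<Longrightarrow> Q q r"
  shows "corner_ex v Q t"
  using assms by (cases t) auto

lemma angle_at_commute: "angle_at x y z = angle_at z y x"
  by (simp add: angle_at_def inner_commute mult.commute)

lemma tiled_corner_at_zero: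
  assumes T: "tiled T (0, 1, C)" and C: "Im C > 0"
  shows "(\<Sum>t\<in>T. corner_sum 0 (\<lambda>q r. angle_at q 0 r) t) = angle_at 1 0 C"
    and "\<exists>t\<in>T. corner_ex 0 (\<lambda>q r. orient 0 1 q = 0 \<or> orient 0 1 r = 0) t"
    and "\<exists>t\<in>T. corner_ex 0 (\<lambda>q r. orient 0 C q = 0 \<or> orient 0 C r = 0) t"
proof -
  have C0: "0 < Arg C" "Arg C < pi" "C \<noteq> 0" using C Arg_lt_pi by auto
  \<comment> \<open>The sign of the orientation tells which of the two arguments is the larger
    one.\<close>
  have each: "sgn (orientation t) * corner_sum 0 (\<lambda>q r. Arg r - Arg q) t = corner_sum 0 (\<lambda>q r. angle_at q 0 r) t"
    if t: "t \<in> T" for t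
  proof -
    obtain p q r where pqr: "t = (p, q, r)" by (cases t)
    have nd: "orient p q r \<noteq> 0" and sub: "region (p, q, r) \<subseteq> region (0, 1, C)"
      using T t unfolding tiled_def pqr by (auto simp del: region.simps)
    have "{p, q, r} \<subseteq> region (0, 1, C)" using hull_subset[of "{p, q, r}" convex] sub by auto
    hence m: "p \<in> region (0, 1, C)" "q \<in> region (0, 1, C)" "r \<in> region (0, 1, C)" by blast+
    have s: "sgn (orient 0 x y) * (Arg y - Arg x) = angle_at x 0 y"
      if "orient 0 x y \<noteq> 0" "x \<in> region (0, 1, C)" "y \<in> region (0, 1, C)" for x y
    proof -
      have nz: "x \<noteq> 0" "y \<noteq> 0" using that by auto
      have "\<bar>Arg y - Arg x\<bar> < pi"
        using region_sector[OF C that(2) nz(1)] region_sector[OF C that(3) nz(2)] by auto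
      thus ?thesis
        using nz by (simp add: orient_zero_pos_iff angle_at_zero_Arg abs_sgn mult.commute)
    qed
    have d: "p \<noteq> q" "q \<noteq> r" "r \<noteq> p" using nd by auto
    consider "p = 0" | "q = 0" | "r = 0" | "p \<noteq> 0" "q \<noteq> 0" "r \<noteq> 0" by blast
    thus ?thesis
    proof cases
      case 1 thus ?thesis using s[of q r] nd m d by (simp add: pqr)
    next
      case 2 thus ?thesis using s[of r p] nd m d by (simp add: pqr orient_rotate[of 0 r p, symmetric])
    next
      case 3 thus ?thesis using s[of p q] nd m d by (simp add: pqr orient_rotate[of p q 0])
    qed (simp add: pqr)
  qed
  have "(\<Sum>t\<in>T. corner_sum 0 (\<lambda>q r. angle_at q 0 r) t) = Arg C"
    using tiled_corner_normalised[OF T C, of "\<lambda>x. x"] by (simp add: each cong: sum.cong)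
  moreover have "angle_at 1 0 C = Arg C"
    using C0 by (subst angle_at_zero_Arg) auto
  ultimately show "(\<Sum>t\<in>T. corner_sum 0 (\<lambda>q r. angle_at q 0 r) t) = angle_at 1 0 C" by simp
  \<comment> \<open>With the indicator of a as h, the right-hand side of
    \<open>tiled_corner_normalised\<close> is 1 or -1, so some tile must contribute.\<close>
  have ex: "\<exists>t\<in>T. corner_ex 0 (\<lambda>q r. Arg q = a \<or> Arg r = a) t" if "a = 0 \<or> a = Arg C" for a
  proof (rule ccontr)
    assume "\<not> ?thesis"
    hence "corner_sum 0 (\<lambda>q r. of_bool (Arg r = a) - of_bool (Arg q = a)) t = (0::real)" if "t \<in> T" for t
      using that by (cases t) auto
    hence "of_bool (Arg C = a) - of_bool (0 = a) = (0::real)"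
      using tiled_corner_normalised[OF T C, of "\<lambda>x. of_bool (x = a) :: real"] by simp
    thus False using that C0 by (auto split: if_splits)
  qed
  have "\<exists>t\<in>T. corner_ex 0 (\<lambda>q r. Arg q = 0 \<or> Arg r = 0) t" using ex[of 0] by simp
  thus "\<exists>t\<in>T. corner_ex 0 (\<lambda>q r. orient 0 1 q = 0 \<or> orient 0 1 r = 0) t"
  proof (rule bexE)
    fix t assume t: "t \<in> T" "corner_ex 0 (\<lambda>q r. Arg q = 0 \<or> Arg r = 0) t"
    have "corner_ex 0 (\<lambda>q r. orient 0 1 q = 0 \<or> orient 0 1 r = 0) t"
      by (rule corner_ex_mono[OF t(2)]) (auto simp: orient_zero_polar)
    thus ?thesis using t(1) by (rule bexI)
  qed
  have "\<exists>t\<in>T. corner_ex 0 (\<lambda>q r. Arg q = Arg C \<or> Arg r = Arg C) t" using ex[of "Arg C"] by simp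
  thus "\<exists>t\<in>T. corner_ex 0 (\<lambda>q r. orient 0 C q = 0 \<or> orient 0 C r = 0) t"
  proof (rule bexE)
    fix t assume t: "t \<in> T" "corner_ex 0 (\<lambda>q r. Arg q = Arg C \<or> Arg r = Arg C) t"
    have "corner_ex 0 (\<lambda>q r. orient 0 C q = 0 \<or> orient 0 C r = 0) t"
      by (rule corner_ex_mono[OF t(2)]) (auto simp: orient_zero_polar)
    thus ?thesis using t(1) by (rule bexI)
  qed
qed

lemma tiled_corner_pos:
  assumes T: "tiled T (A, B, C)" and pos: "orient A B C > 0"
  shows "(\<Sum>t\<in>T. corner_sum A (\<lambda>q r. angle_at q A r) t) = angle_at B A C"
    and "\<exists>t\<in>T. corner_ex A (\<lambda>q r. orient A B q = 0 \<or> orient A B r = 0) t"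
    and "\<exists>t\<in>T. corner_ex A (\<lambda>q r. orient A C q = 0 \<or> orient A C r = 0) t"
proof -
  have AB: "B \<noteq> A" using pos by auto
  define u where "u = B - A"
  have u: "u \<noteq> 0" using AB by (simp add: u_def)
  define g where "g = (\<lambda>z. (z - A) / u)"
  let ?G = "map_prod g (map_prod g g)"
  have g0: "g x = 0 \<longleftrightarrow> x = A" "g A = 0" "g B = 1" for x using u by (auto simp: g_def u_def)
  have o: "orient (g x) (g y) (g z) = orient x y z / (norm u)\<^sup>2" for x y z
    using orient_affine[of A u "g x" "g y" "g z"] u by (simp add: g_def field_simps)
  have d: "dist (g x) (g y) = dist x y / norm u" for x y
    by (simp add: g_def dist_norm diff_divide_distrib[symmetric] norm_divide)
  have an: "angle_at (g x) (g y) (g z) = angle_at x y z" for x y z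
  proof -
    have n: "norm u \<noteq> 0" using u by simp
    show ?thesis unfolding angle_at_dist d
      using n by (simp add: power_divide add_divide_distrib[symmetric] diff_divide_distrib[symmetric] power2_eq_square)
  qed
  have ang: "angle_at (g x) 0 (g z) = angle_at x A z" for x z using an[of x A z] by (simp add: g0)
  have T': "tiled (?G ` T) (0, 1, g C)" using tiled_map[OF T u, of A] by (simp add: g_def u_def AB)
  have "Im (g C) = orient 0 1 (g C)" by (simp add: orient_def)
  hence C': "Im (g C) > 0" using o[of A B C] pos u by (simp add: g0)
  have "inj g" using u by (auto simp: g_def inj_on_def)
  hence inj: "inj_on ?G T" by (intro inj_on_subset[OF prod.inj_map]) auto
  have cs: "corner_sum 0 (\<lambda>q r. angle_at q 0 r) (?G t) = corner_sum A (\<lambda>q r. angle_at q A r) t" for t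
    by (cases t) (simp add: g0 ang)
  have ce: "corner_ex 0 P (?G t) \<longleftrightarrow> corner_ex A (\<lambda>q r. P (g q) (g r)) t" for P t
    by (cases t) (simp add: g0)
  show "(\<Sum>t\<in>T. corner_sum A (\<lambda>q r. angle_at q A r) t) = angle_at B A C"
    using tiled_corner_at_zero(1)[OF T' C'] ang[of B C]
    by (subst (asm) sum.reindex[OF inj]) (simp add: cs g0)
  have oz: "orient 0 1 (g z) = 0 \<longleftrightarrow> orient A B z = 0" "orient 0 (g C) (g z) = 0 \<longleftrightarrow> orient A C z = 0" for z
    using o[of A B z] o[of A C z] u by (simp_all add: g0)
  show "\<exists>t\<in>T. corner_ex A (\<lambda>q r. orient A B q = 0 \<or> orient A B r = 0) t"
    using tiled_corner_at_zero(2)[OF T' C'] by (simp add: ce oz)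
  show "\<exists>t\<in>T. corner_ex A (\<lambda>q r. orient A C q = 0 \<or> orient A C r = 0) t"
    using tiled_corner_at_zero(3)[OF T' C'] by (simp add: ce oz)
qed

lemma tiled_corner:
  assumes T: "tiled T (A, B, C)"
  shows "(\<Sum>t\<in>T. corner_sum A (\<lambda>q r. angle_at q A r) t) = angle_at B A C"
    and "\<exists>t\<in>T. corner_ex A (\<lambda>q r. orient A B q = 0 \<or> orient A B r = 0) t"
    and "\<exists>t\<in>T. corner_ex A (\<lambda>q r. orient A C q = 0 \<or> orient A C r = 0) t"
proof -
  have T': "tiled T (A, C, B)" using tiled_rotate[OF tiled_swap[OF T]] tiled_rotate by blast
  have o: "orient A C B = - orient A B C" by (simp add: orient_def algebra_simps)
  have "orient A B C > 0 \<or> orient A C B > 0" using tiled_orientation[OF T] o by linarith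
  thus "(\<Sum>t\<in>T. corner_sum A (\<lambda>q r. angle_at q A r) t) = angle_at B A C"
    "\<exists>t\<in>T. corner_ex A (\<lambda>q r. orient A B q = 0 \<or> orient A B r = 0) t"
    "\<exists>t\<in>T. corner_ex A (\<lambda>q r. orient A C q = 0 \<or> orient A C r = 0) t"
    using tiled_corner_pos[OF T] tiled_corner_pos[OF T'] angle_at_commute[of C A B] by auto
qed

section \<open>Characters of directions\<close>

definition rat_linear :: "(real \<Rightarrow> real) \<Rightarrow> bool" where
  "rat_linear f \<longleftrightarrow> (\<forall>x y. f (x + y) = f x + f y) \<and> (\<forall>q x. q \<in> \<rat> \<longrightarrow> f (q * x) = q * f x)"

text \<open>The two numbers are linearly independent over the rationals, so they extend to a Hamel
  basis and the values on them are free.\<close>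

lemma rat_linear_exists:
  assumes x: "x \<noteq> 0" and y: "y / x \<notin> \<rat>"
  obtains f where "rat_linear f" "f x = u" "f y = v"
proof -
  interpret Q: vector_space "\<lambda>(q::rat) (r::real). of_rat q * r"
    by unfold_locales (simp_all add: algebra_simps of_rat_add of_rat_mult)
  interpret QQ: vector_space_pair "\<lambda>(q::rat) (r::real). of_rat q * r" "\<lambda>(q::rat) (r::real). of_rat q * r"
    by unfold_locales
  have xy: "x \<noteq> y" using y x by auto
  have "Q.independent {x, y}"
  proof -
    have "y \<notin> Q.span {x}"
    proof
      assume "y \<in> Q.span {x}"
      then obtain q where "y = of_rat q * x" by (auto simp: Q.span_singleton)
      hence "y / x = of_rat q" using x by simp
      thus False using y by simp
    qed
    moreover have "Q.independent {x}" using x by simp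
    ultimately have "Q.independent (insert y {x})" by (simp add: Q.independent_insert)
    thus ?thesis by (simp add: insert_commute)
  qed
  then obtain f where f: "Vector_Spaces.linear (\<lambda>(q::rat) (r::real). of_rat q * r) (\<lambda>(q::rat) (r::real). of_rat q * r) f"
    and fv: "\<forall>z\<in>{x, y}. f z = (if z = x then u else v)"
    using QQ.linear_independent_extend[of "{x, y}" "\<lambda>z. if z = x then u else v"] by blast
  interpret f: Vector_Spaces.linear "\<lambda>(q::rat) (r::real). of_rat q * r" "\<lambda>(q::rat) (r::real). of_rat q * r" f
    by (rule f)
  have "rat_linear f"
    unfolding rat_linear_def using f.add f.scale by (auto elim!: Rats_cases)
  thus ?thesis using that fv xy by auto
qed

lemma rat_linear_add: "rat_linear f \<Longrightarrow> f (x + y) = f x + f y"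
  and rat_linear_scale: "rat_linear f \<Longrightarrow> q \<in> \<rat> \<Longrightarrow> f (q * x) = q * f x"
  by (auto simp: rat_linear_def)

lemma rat_linear_minus: "rat_linear f \<Longrightarrow> f (- x) = - f x"
  using rat_linear_scale[of f "-1" x] by simp

lemma rat_linear_diff: "rat_linear f \<Longrightarrow> f (x - y) = f x - f y"
  using rat_linear_add[of f x "-y"] by (simp add: rat_linear_minus)

lemma rat_linear_zero: "rat_linear f \<Longrightarrow> f 0 = 0"
  using rat_linear_scale[of f 0 0] by simp

text \<open>With \<open>f \<pi> = 3 \<pi>\<close>, the function below sends the rotation by \<open>\<pi> / 3\<close> to \<open>-1\<close> and is odd. It is
  multiplicative, since \<open>f\<close> maps the ambiguity \<open>2 \<pi>\<close> of the argument to \<open>6 \<pi>\<close>.\<close>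

definition character :: "(real \<Rightarrow> real) \<Rightarrow> complex \<Rightarrow> complex" where
  "character f z = cis (f (Arg z))"

lemma character_cis:
  assumes f: "rat_linear f" "f pi = 3 * pi" and z: "z = of_real r * cis \<theta>" "r > 0"
  shows "character f z = cis (f \<theta>)"
proof -
  have "cis (Arg z) = cis \<theta>"
  proof -
    have "z \<noteq> 0" using z by simp
    have "cis (Arg z) = sgn z" using \<open>z \<noteq> 0\<close> by (rule cis_Arg)
    also have "\<dots> = cis \<theta>" using z by (simp add: sgn_mult sgn_eq norm_mult)
    finally show ?thesis .
  qed
  hence "sin (Arg z) = sin \<theta> \<and> cos (Arg z) = cos \<theta>" by (simp add: complex_eq_iff)
  then obtain m :: int where m: "Arg z = \<theta> + 2 * pi * real_of_int m"
    unfolding sin_cos_eq_iff by auto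
  define n where "n = real_of_int m"
  have n: "n \<in> \<int>" "Arg z = \<theta> + 2 * pi * n" using m by (simp_all add: n_def)
  have q: "2 * n \<in> \<rat>" using n(1) by (auto elim!: Ints_cases)
  have "f (Arg z) = f \<theta> + f ((2 * n) * pi)"
  proof -
    have "Arg z = \<theta> + (2 * n) * pi" using n(2) by (simp only: mult_ac)
    thus ?thesis by (simp only: rat_linear_add[OF f(1)])
  qed
  also have "\<dots> = f \<theta> + 2 * pi * (3 * n)"
    unfolding rat_linear_scale[OF f(1) q] f(2) by simp
  finally have "f (Arg z) = f \<theta> + 2 * pi * (3 * n)" .
  moreover have "cis (2 * pi * (3 * n)) = 1"
    by (rule cis_multiple_2pi) (use n(1) in simp)
  ultimately show ?thesis
    unfolding character_def by (metis cis_mult mult.right_neutral)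
qed

lemma character_mult_cis:
  assumes f: "rat_linear f" "f pi = 3 * pi" and z: "z \<noteq> 0" and w: "w = of_real r * z * cis \<theta>" "r > 0"
  shows "character f w = character f z * cis (f \<theta>)"
proof -
  have "of_real r * rcis (norm z) (Arg z) * cis \<theta> = of_real (r * norm z) * cis (Arg z + \<theta>)"
    unfolding rcis_def cis_mult[symmetric] by (simp only: of_real_mult mult_ac)
  hence "w = of_real (r * norm z) * cis (Arg z + \<theta>)"
    unfolding w(1) rcis_cmod_Arg .
  moreover have "0 < r * norm z" using z w(2) by simp
  ultimately have "character f w = cis (f (Arg z + \<theta>))"
    by (rule character_cis[OF f])
  thus ?thesis by (simp add: rat_linear_add[OF f(1)] character_def cis_mult)
qed

lemma character_minus:
  assumes f: "rat_linear f" "f pi = 3 * pi" and z: "z \<noteq> 0"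
  shows "character f (- z) = - character f z"
proof -
  have "cis (3 * pi) = -1"
    using cis_mult[of "2 * pi" pi] by simp
  thus ?thesis using character_mult_cis[OF f z, of "- z" 1 pi] f(2) by simp
qed

text \<open>In a counterclockwise triangle the ray from q to p arises from the ray from q to r by a
  turn through the interior angle.\<close>

lemma turn_at_vertex:
  assumes o: "orient p q r > 0"
  shows "p - q = of_real (dist p q / dist r q) * (r - q) * cis (angle_at p q r)"
proof -
  define u v where "u = r - q" and "v = p - q"
  have ne: "u \<noteq> 0" "v \<noteq> 0" using o by (auto simp: u_def v_def)
  define c where "c = (v \<bullet> u) / (norm v * norm u)"
  have th: "angle_at p q r = arccos c" by (simp add: angle_at_def c_def u_def v_def)
  have c: "\<bar>c\<bar> \<le> 1"
    using Cauchy_Schwarz_ineq2[of v u] ne by (simp add: c_def abs_mult)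
  have o': "Im (cnj u * v) = orient p q r"
    by (simp add: orient_def u_def v_def algebra_simps)
  have sq: "(v \<bullet> u)\<^sup>2 + (Im (cnj u * v))\<^sup>2 = (norm v * norm u)\<^sup>2"
    unfolding power_mult_distrib cmod_power2 by (simp add: inner_complex_def power2_eq_square algebra_simps)
  have "sin (arccos c) = sqrt (1 - c\<^sup>2)" using c by (simp add: sin_arccos_abs)
  also have "1 - c\<^sup>2 = (Im (cnj u * v) / (norm v * norm u))\<^sup>2"
    using sq ne by (simp add: c_def power_divide field_simps)
  also have "sqrt \<dots> = Im (cnj u * v) / (norm v * norm u)"
    unfolding o' using o by (subst real_sqrt_abs) simp
  finally have s: "sin (arccos c) = Im (cnj u * v) / (norm v * norm u)" .
  have "cos (arccos c) = Re (cnj u * v) / (norm v * norm u)"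
    using c by (simp add: cos_arccos_abs) (simp add: c_def inner_complex_def mult.commute)
  hence "of_real (norm v * norm u) * cis (arccos c) = cnj u * v"
    using s ne by (simp add: complex_eq_iff)
  hence "u * (of_real (norm v * norm u) * cis (arccos c)) = u * (cnj u * v)" by simp
  also have "\<dots> = of_real (norm u * norm u) * v"
  proof -
    have "u * cnj u = of_real (norm u * norm u)"
      using complex_norm_square[of u] by (simp add: power2_eq_square)
    thus ?thesis by (simp only: mult.assoc[symmetric])
  qed
  finally have eq: "u * (of_real (norm v * norm u) * cis (arccos c)) = of_real (norm u * norm u) * v" .
  have "(u * (of_real (norm v * norm u) * cis (arccos c))) / of_real (norm u * norm u)
      = of_real (norm v / norm u) * u * cis (arccos c)"
    using ne by (simp add: divide_simps)
  hence "of_real (norm v / norm u) * u * cis (arccos c)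
      = (u * (of_real (norm v * norm u) * cis (arccos c))) / of_real (norm u * norm u)" by (rule sym)
  also have "\<dots> = v" unfolding eq using ne by simp
  finally have "v = of_real (norm v / norm u) * u * cis (arccos c)" by simp
  thus ?thesis by (simp add: th u_def v_def dist_norm)
qed

section \<open>Edge weights built from a character\<close>

definition character_weight :: "(real \<Rightarrow> real) \<Rightarrow> (real \<Rightarrow> real) \<Rightarrow> complex \<Rightarrow> complex \<Rightarrow> complex" where
  "character_weight \<phi> f p q = of_real (\<phi> (dist p q)) * character f (q - p)"

lemma character_weight_swap:
  assumes f: "rat_linear f" "f pi = 3 * pi" and \<phi>: "rat_linear \<phi>"
  shows "character_weight \<phi> f q p = - character_weight \<phi> f p q"
proof (cases "p = q")
  case False
  thus ?thesis using character_minus[OF f, of "q - p"] by (simp add: character_weight_def dist_commute)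
qed (simp add: character_weight_def rat_linear_zero[OF \<phi>])

text \<open>On a line of direction u the potential is \<phi> of the signed length times the
  character of u. Edges that run backwards fit because the character is odd.\<close>

lemma line_additive_character_weight:
  assumes f: "rat_linear f" "f pi = 3 * pi" and \<phi>: "rat_linear \<phi>"
  shows "line_additive (character_weight \<phi> f)"
  unfolding line_additive_def
proof (intro allI impI)
  fix z0 u :: complex assume u: "u \<noteq> 0"
  define h where "h s = of_real (\<phi> (s * norm u)) * character f u" for s
  have le: "character_weight \<phi> f (z0 + of_real s * u) (z0 + of_real s' * u) = h s' - h s" if "s < s'" for s s'
  proof -
    have d: "dist (z0 + of_real s * u) (z0 + of_real s' * u) = s' * norm u - s * norm u"
    proof -
      have "dist (z0 + of_real s * u) (z0 + of_real s' * u) = norm (of_real (s' - s) * u)"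
        by (simp add: dist_norm norm_minus_commute algebra_simps)
      also have "\<dots> = s' * norm u - s * norm u"
        using that by (simp only: norm_mult norm_of_real) (simp add: algebra_simps)
      finally show ?thesis .
    qed
    have "character f (of_real (s' - s) * u) = character f u * cis (f 0)"
      using that u by (intro character_mult_cis[OF f, of u _ "s' - s"]) auto
    hence "character f (z0 + of_real s' * u - (z0 + of_real s * u)) = character f u"
      by (simp add: rat_linear_zero[OF f(1)] algebra_simps)
    thus ?thesis
      unfolding character_weight_def d h_def by (simp add: rat_linear_diff[OF \<phi>] algebra_simps)
  qed
  have "character_weight \<phi> f (z0 + of_real s * u) (z0 + of_real s' * u) = h s' - h s" for s s'
  proof -
    consider "s < s'" | "s = s'" | "s' < s" by linarith
    thus ?thesis
    proof cases
      case 2 thus ?thesis by (simp add: character_weight_def rat_linear_zero[OF \<phi>])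
    next
      case 3
      thus ?thesis
        using le[OF 3] character_weight_swap[OF f \<phi>, of "z0 + of_real s * u" "z0 + of_real s' * u"] by simp
    qed (rule le)
  qed
  thus "\<exists>h. \<forall>s s'. character_weight \<phi> f (z0 + of_real s * u) (z0 + of_real s' * u) = h s' - h s" by blast
qed

text \<open>Turning through an angle whose character is a sign changes the character of a direction
  by that sign only, so all three edges have the character of \<open>q - p\<close> up to sign, and
  it factors out. The minus signs come from reversing one of the two edges at each corner.\<close>

lemma boundary_sum_character:
  assumes f: "rat_linear f" "f pi = 3 * pi" and \<phi>: "rat_linear \<phi>"
    and o: "orient p q r \<noteq> 0"
    and \<chi>: "cis (f (angle_at p q r)) = of_real \<chi>q" "cis (f (angle_at r p q)) = of_real \<chi>p" "\<chi>q\<^sup>2 = 1"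
      "\<chi>p\<^sup>2 = 1"
  shows "boundary_sum (character_weight \<phi> f) (p, q, r)
     = character f (q - p) * of_real (\<phi> (dist p q) - \<chi>q * \<phi> (dist q r) - \<chi>p * \<phi> (dist r p))"
proof -
  have pos: "boundary_sum (character_weight \<phi> f) (p, q, r)
     = character f (q - p) * of_real (\<phi> (dist p q) - \<chi>q * \<phi> (dist q r) - \<chi>p * \<phi> (dist r p))"
    if o: "orient p q r > 0"
      and \<chi>: "cis (f (angle_at p q r)) = of_real \<chi>q" "cis (f (angle_at r p q)) = of_real \<chi>p" "\<chi>q\<^sup>2 = 1" for p q r \<chi>p \<chi>q
  proof -
    have d: "p \<noteq> q" "q \<noteq> r" "r \<noteq> p" using o by auto
    have "character f (p - q) = character f (r - q) * of_real \<chi>q"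
      using character_mult_cis[OF f _ turn_at_vertex[OF o]] d \<chi>(1) by simp
    hence "character f (p - q) * of_real \<chi>q = character f (r - q) * of_real (\<chi>q\<^sup>2)"
      by (simp add: power2_eq_square)
    hence "character f (r - q) = character f (p - q) * of_real \<chi>q"
      unfolding \<chi>(3) by simp
    hence 1: "character f (r - q) = - of_real \<chi>q * character f (q - p)"
      using character_minus[OF f, of "q - p"] d by simp
    have o': "orient r p q > 0" using o by (simp only: orient_rotate[of r p q] orient_rotate[of q r p])
    have "character f (r - p) = character f (q - p) * of_real \<chi>p"
      using character_mult_cis[OF f _ turn_at_vertex[OF o']] d \<chi>(2) by simp
    hence 2: "character f (p - r) = - of_real \<chi>p * character f (q - p)"
      using character_minus[OF f, of "r - p"] d by simp
    show ?thesis
      by (simp add: character_weight_def 1 2 algebra_simps)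
  qed
  show ?thesis
  proof (cases "orient p q r > 0")
    case True
    thus ?thesis using pos \<chi> by blast
  next
    case False
    \<comment> \<open>A clockwise triangle is traversed the other way round, which only negates the
      weights.\<close>
    hence neg: "orient q p r > 0" using o by (simp add: orient_swap[of q p])
    have d: "p \<noteq> q" using o by auto
    have a: "angle_at q p r = angle_at r p q" "angle_at r q p = angle_at p q r"
      by (simp_all add: angle_at_def inner_commute mult.commute)
    have "boundary_sum (character_weight \<phi> f) (p, q, r) = - boundary_sum (character_weight \<phi> f) (q, p, r)"
      using character_weight_swap[OF f \<phi>, of p q] character_weight_swap[OF f \<phi>, of q r] character_weight_swap[OF f \<phi>, of r p]
      by simp
    also have "\<dots> = - (character f (p - q) * of_real (\<phi> (dist q p) - \<chi>p * \<phi> (dist p r) - \<chi>q * \<phi> (dist r q)))"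
      using pos[OF neg, of \<chi>p \<chi>q] \<chi> by (simp only: a)
    also have "character f (p - q) = - character f (q - p)"
      using character_minus[OF f, of "q - p"] d by simp
    finally show ?thesis by (simp add: dist_commute algebra_simps)
  qed
qed

section \<open>Arithmetic of the sides\<close>

definition commensurable :: "real \<Rightarrow> real \<Rightarrow> real \<Rightarrow> bool" where
  "commensurable a b c \<longleftrightarrow> a / b \<in> \<rat> \<and> b / c \<in> \<rat> \<and> a / c \<in> \<rat>"

lemma commensurable_swap:
  assumes "commensurable a b c"
  shows "commensurable b a c"
proof -
  have "b / a = inverse (a / b)" by simp
  thus ?thesis using assms unfolding commensurable_def by (metis Rats_inverse)
qed

lemma commensurable_multiples:
  assumes "m * a \<in> \<rat>" "m * b \<in> \<rat>" "m * c \<in> \<rat>" "m \<noteq> (0::real)"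
  shows "commensurable a b c"
proof -
  have "x / y = (m * x) / (m * y)" for x y using assms(4) by simp
  thus ?thesis using assms unfolding commensurable_def by (metis Rats_divide)
qed

context
  fixes a b c :: real
  assumes pos: "0 < a" "0 < b" "0 < c" and cos_law: "c\<^sup>2 = a\<^sup>2 + a * b + b\<^sup>2"
begin

text \<open>The product is \<open>c\<^sup>2 - (a - b)\<^sup>2\<close>, which the law of cosines for
  the angle 2\<pi>/3 turns into 3ab.\<close>

lemma triangle_pos: "0 < c + a - b" "0 < c - a + b" "(c + a - b) * (c - a + b) = 3 * (a * b)"
proof -
  have "(a - b)\<^sup>2 < c\<^sup>2"
    unfolding cos_law using pos mult_pos_pos[OF pos(1,2)] by (simp add: power2_eq_square algebra_simps)
  hence "\<bar>a - b\<bar> < c" using pos abs_le_square_iff[of c "a - b"] by auto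
  thus "0 < c + a - b" "0 < c - a + b" by auto
  show "(c + a - b) * (c - a + b) = 3 * (a * b)"
    using cos_law by (simp add: power2_eq_square algebra_simps)
qed

text \<open>Corners 3\<alpha>, \<beta>, 2\<beta>. By the law of cosines the left-hand sides of the
  relations contain the factors c + a - b and c - a + b, and the cofactors make kc and k(a + 2b)
  rational.\<close>

lemma commensurable_3al_be_2be:
  assumes k: "k \<noteq> 0" and "\<rho> \<in> \<rat>" "\<rho>' \<in> \<rat>" "n \<in> \<rat>"
    and 1: "k * (3 * a * (a + b)) + k * (c * (2 * a + b)) - k * c\<^sup>2 = \<rho> * (c + a - b)"
    and 2: "k * (c * (2 * a + b)) - k * (3 * a * (a + b)) + k * c\<^sup>2 = \<rho>' * (c - a + b)"
    and 3: "3 * k\<^sup>2 * (a + b) * (2 * a + b) = n"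
  shows "commensurable a b c"
proof -
  have "k * (c + a + 2 * b) = \<rho>"
  proof -
    have "k * (c + a + 2 * b) * (c + a - b) = \<rho> * (c + a - b)"
      using 1 cos_law by algebra
    thus ?thesis using triangle_pos(1) by simp
  qed
  moreover have "k * (a + 2 * b - c) = \<rho>'"
  proof -
    have "k * (a + 2 * b - c) * (c - a + b) = \<rho>' * (c - a + b)"
      using 2 cos_law by algebra
    thus ?thesis using triangle_pos(2) by simp
  qed
  ultimately have eqs: "k * c = (\<rho> - \<rho>') / 2" "k * (a + 2 * b) = (\<rho> + \<rho>') / 2"
    by (simp_all add: algebra_simps)
  have r: "k * c \<in> \<rat>" "k * (a + 2 * b) \<in> \<rat>" unfolding eqs using assms(2,3) by simp_all
  \<comment> \<open>The squares of kc and k(a + 2b) and the area are three independent linear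
    equations for the squares and the product of ka and kb.\<close>
  have ab: "k\<^sup>2 * (a * b) = n / 6 + (k * (a + 2 * b))\<^sup>2 / 6 - 7 / 6 * (k * c)\<^sup>2"
    unfolding 3[symmetric] power_mult_distrib cos_law by (simp add: power2_eq_square field_simps)
  have bb: "k\<^sup>2 * b\<^sup>2 = - n / 6 + (k * (a + 2 * b))\<^sup>2 / 6 + 5 / 6 * (k * c)\<^sup>2"
    unfolding 3[symmetric] power_mult_distrib cos_law by (simp add: power2_eq_square field_simps)
  have "k\<^sup>2 * (a * b) \<in> \<rat>" "k\<^sup>2 * b\<^sup>2 \<in> \<rat>"
    unfolding ab bb using r assms(4) by simp_all
  hence "(k\<^sup>2 * (a * b)) / (k\<^sup>2 * b\<^sup>2) \<in> \<rat>" by (rule Rats_divide)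
  hence q: "a / b \<in> \<rat>" using k pos by (simp add: power2_eq_square)
  have "k * b = k * (a + 2 * b) / (a / b + 2)" using pos by (simp add: field_simps)
  hence kb: "k * b \<in> \<rat>" using r q by simp
  have "k * a = k * b * (a / b)" using pos by simp
  hence "k * a \<in> \<rat>" using Rats_mult[OF kb q] by simp
  thus ?thesis using kb r(1) k by (rule commensurable_multiples)
qed

text \<open>Corners 3\<alpha> + \<beta>, \<beta>, \<beta>. Here the cofactors are (k/a)(a + b + c)
  and (k/a)(a + b - c), whence the scale m = k/a.\<close>

lemma commensurable_isosceles:
  assumes k: "k \<noteq> 0" and "\<rho> \<in> \<rat>" "\<rho>' \<in> \<rat>" "n \<in> \<rat>"
    and 1: "k * c + k * (2 * a + b) + k * c = \<rho> * (c + a - b)"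
    and 2: "k * c - k * (2 * a + b) + k * c = \<rho>' * (c - a + b)"
    and 3: "k\<^sup>2 * (2 * a + b) / a = n"
  shows "commensurable a b c"
proof -
  define m where "m = k / a"
  have k': "k = m * a" and m: "m \<noteq> 0" using k pos by (auto simp: m_def)
  have "m * (a + b + c) = \<rho>"
  proof -
    have "m * (a + b + c) * (c + a - b) = \<rho> * (c + a - b)"
      using 1 cos_law k' by algebra
    thus ?thesis using triangle_pos(1) by simp
  qed
  moreover have "m * (a + b - c) = \<rho>'"
  proof -
    have "m * (a + b - c) * (c - a + b) = \<rho>' * (c - a + b)"
      using 2 cos_law k' by algebra
    thus ?thesis using triangle_pos(2) by simp
  qed
  ultimately have eqs: "m * c = (\<rho> - \<rho>') / 2" "m * (a + b) = (\<rho> + \<rho>') / 2"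
    by (simp_all add: algebra_simps)
  have r: "m * c \<in> \<rat>" "m * (a + b) \<in> \<rat>" unfolding eqs using assms(2,3) by simp_all
  have n: "n = m\<^sup>2 * (a * (2 * a + b))"
    unfolding 3[symmetric] k' using pos by (simp add: power2_eq_square)
  have ab: "m\<^sup>2 * (a * b) = (m * (a + b))\<^sup>2 - (m * c)\<^sup>2"
    unfolding power_mult_distrib cos_law by (simp add: power2_eq_square field_simps)
  have aa: "m\<^sup>2 * a\<^sup>2 = (n - m\<^sup>2 * (a * b)) / 2"
    unfolding n by (simp add: power2_eq_square algebra_simps)
  have q1: "m\<^sup>2 * (a * b) \<in> \<rat>" unfolding ab using r by simp
  hence "m\<^sup>2 * a\<^sup>2 \<in> \<rat>" unfolding aa using assms(4) by simp
  hence "(m\<^sup>2 * a\<^sup>2) / (m\<^sup>2 * (a * b)) \<in> \<rat>" using q1 by (rule Rats_divide)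
  hence q: "a / b \<in> \<rat>" using m pos by (simp add: power2_eq_square)
  have "m * b = m * (a + b) / (a / b + 1)" using pos by (simp add: field_simps)
  hence kb: "m * b \<in> \<rat>" using r q by simp
  have "m * a = m * b * (a / b)" using pos by simp
  hence "m * a \<in> \<rat>" using Rats_mult[OF kb q] by simp
  thus ?thesis using kb r(1) m by (rule commensurable_multiples)
qed

text \<open>Corners 2\<alpha>, \<alpha> + 2\<beta>, \<beta>. The cofactors k(b + c) and k(c - b)
  make kb and kc rational at once, and the area then gives the product of ka and kb.\<close>

lemma commensurable_2al_al2be_be:
  assumes k: "k \<noteq> 0" and "\<rho> \<in> \<rat>" "\<rho>' \<in> \<rat>" "n \<in> \<rat>"
    and 1: "k * (a * (a + 2 * b)) + k * (c * (a + b)) - k * (b * c) = \<rho> * (c + a - b)"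
    and 2: "k * (b * c) + k * (a * (a + 2 * b)) - k * (c * (a + b)) = \<rho>' * (c - a + b)"
    and 3: "k\<^sup>2 * (a + 2 * b) * (a + b) = n"
  shows "commensurable a b c"
proof -
  have "k * (b + c) = \<rho>"
  proof -
    have "k * (b + c) * (c + a - b) = \<rho> * (c + a - b)"
      using 1 cos_law by algebra
    thus ?thesis using triangle_pos(1) by simp
  qed
  moreover have "k * (c - b) = \<rho>'"
  proof -
    have "k * (c - b) * (c - a + b) = \<rho>' * (c - a + b)"
      using 2 cos_law by algebra
    thus ?thesis using triangle_pos(2) by simp
  qed
  ultimately have eqs: "k * c = (\<rho> + \<rho>') / 2" "k * b = (\<rho> - \<rho>') / 2"
    by (simp_all add: algebra_simps)
  have r: "k * c \<in> \<rat>" "k * b \<in> \<rat>" unfolding eqs using assms(2,3) by simp_all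
  have ab: "k\<^sup>2 * (a * b) = (n - (k * c)\<^sup>2 - (k * b)\<^sup>2) / 2"
    unfolding 3[symmetric] power_mult_distrib cos_law by (simp add: power2_eq_square field_simps)
  have "k\<^sup>2 * (a * b) \<in> \<rat>" unfolding ab using r assms(4) by simp
  hence "k\<^sup>2 * (a * b) / (k * b) \<in> \<rat>" using r(2) by (rule Rats_divide)
  hence "k * a \<in> \<rat>" using k pos by (simp add: power2_eq_square)
  thus ?thesis using r k by (intro commensurable_multiples[of k])
qed

text \<open>Corners 2\<alpha> + \<beta>, \<alpha> + \<beta>, \<beta>. The area would only add that
  \<open>m\<^sup>2 * a * (a + b)\<close> is rational, and this equals
  \<open>m\<^sup>2 * (c\<^sup>2 - b\<^sup>2)\<close>; so a has to be treated geometrically.\<close>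

lemma rational_2albe_albe_be:
  assumes k: "k \<noteq> 0" and "\<rho> \<in> \<rat>" "\<rho>' \<in> \<rat>"
    and 1: "k * b + k * (a + b) + k * c = \<rho> * (c + a - b)"
    and 2: "k * b + k * (a + b) - k * c = \<rho>' * (c - a + b)"
  obtains m where "m \<noteq> 0" "k = m * a" "m * b \<in> \<rat>" "m * c \<in> \<rat>"
proof -
  define m where "m = k / a"
  have k': "k = m * a" and m: "m \<noteq> 0" using k pos by (auto simp: m_def)
  have "m * (b + c) = \<rho>"
  proof -
    have "m * (b + c) * (c + a - b) = \<rho> * (c + a - b)"
      using 1 cos_law k' by algebra
    thus ?thesis using triangle_pos(1) by simp
  qed
  moreover have "m * (c - b) = \<rho>'"
  proof -
    have "m * (c - b) * (c - a + b) = \<rho>' * (c - a + b)"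
      using 2 cos_law k' by algebra
    thus ?thesis using triangle_pos(2) by simp
  qed
  ultimately have eqs: "m * c = (\<rho> + \<rho>') / 2" "m * b = (\<rho> - \<rho>') / 2"
    by (simp_all add: algebra_simps)
  have "m * c \<in> \<rat>" "m * b \<in> \<rat>" unfolding eqs using assms(2,3) by simp_all
  thus ?thesis using that m k' by blast
qed

text \<open>The two multiples are of c plus and c minus the number a - b; equating them solves for a
  - b.\<close>

lemma rational_difference:
  assumes x: "x \<noteq> 0" and "\<rho> \<in> \<rat>" "\<rho>' \<in> \<rat>" "x = \<rho> * (c + a - b)" "x = \<rho>' * (c - a + b)"
  obtains \<kappa> where "\<kappa> \<in> \<rat>" "a - b = \<kappa> * c" "x / c \<in> \<rat>"
proof -
  \<comment> \<open>If the coefficients were opposite, the two values of x would give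
    \<open>\<rho> * (2 * c) = 0\<close> and hence x = 0.\<close>
  have nz: "\<rho> + \<rho>' \<noteq> 0"
  proof
    assume "\<rho> + \<rho>' = 0"
    hence "\<rho>' = - \<rho>" by simp
    hence "\<rho> * (2 * c) = 0" using assms(4,5) by (simp add: algebra_simps)
    hence "\<rho> = 0" using pos by simp
    thus False using assms by simp
  qed
  define \<kappa> where "\<kappa> = (\<rho>' - \<rho>) / (\<rho> + \<rho>')"
  have "(a - b) * (\<rho> + \<rho>') = (\<rho>' - \<rho>) * c" using assms(4,5) by algebra
  hence d: "a - b = \<kappa> * c" using nz by (simp add: \<kappa>_def field_simps)
  have \<kappa>: "\<kappa> \<in> \<rat>" using assms by (simp add: \<kappa>_def)
  have "x = \<rho> * (1 + \<kappa>) * c" using assms(4) d by (simp add: algebra_simps)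
  hence "x / c = \<rho> * (1 + \<kappa>)" using pos by simp
  hence "x / c \<in> \<rat>" using assms(2) \<kappa> by simp
  thus ?thesis using that \<kappa> d by blast
qed

text \<open>Modulo rational multiples of c the sides a and b coincide, so the length is (x1 + x2)b
  up to such a multiple. If x1 + x2 were positive, b and then a would be rational multiples of
  c.\<close>

lemma only_c_edges:
  assumes nc: "\<not> commensurable a b c" and \<kappa>: "\<kappa> \<in> \<rat>" "a - b = \<kappa> * c"
    and x: "(real x1 * a + real x2 * b + real x3 * c) / c \<in> \<rat>"
  shows "x1 = 0" "x2 = 0"
proof -
  have "x1 + x2 = 0"
  proof (rule ccontr)
    assume n: "x1 + x2 \<noteq> 0"
    have a: "a = b + \<kappa> * c" using \<kappa> by simp
    have "(real x1 * a + real x2 * b + real x3 * c) / c = real (x1 + x2) * (b / c) + real x1 * \<kappa> + real x3"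
      unfolding a using pos by (simp add: field_simps)
    hence "real (x1 + x2) * (b / c) = (real x1 * a + real x2 * b + real x3 * c) / c - real x1 * \<kappa> - real x3"
      by simp
    moreover have "b / c = real (x1 + x2) * (b / c) / real (x1 + x2)"
    proof -
      have "real (x1 + x2) \<noteq> 0" unfolding of_nat_eq_0_iff by (rule n)
      thus ?thesis by (rule nonzero_mult_div_cancel_left[symmetric])
    qed
    ultimately have "b / c = ((real x1 * a + real x2 * b + real x3 * c) / c - real x1 * \<kappa> - real x3) / real (x1 + x2)"
      by metis
    hence bc: "b / c \<in> \<rat>" using x \<kappa> by (metis Rats_diff Rats_divide Rats_mult Rats_of_nat)
    have "a / c = b / c + \<kappa>" unfolding a using pos by (simp add: field_simps)
    hence ac: "a / c \<in> \<rat>" using bc \<kappa> by simp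
    have "a / b = (a / c) / (b / c)" using pos by simp
    hence "a / b \<in> \<rat>" using bc ac by (metis Rats_divide)
    thus False using nc bc ac by (simp add: commensurable_def)
  qed
  thus "x1 = 0" "x2 = 0" by auto
qed

end

section \<open>Trigonometry of triangles\<close>

lemma orient_sin_pos:
  assumes o: "orient p q r > 0"
  shows "orient p q r = dist p q * dist r q * sin (angle_at p q r)"
proof -
  have rq: "r \<noteq> q" using o by auto
  define k where "k = dist p q / dist r q"
  have t: "p - q = of_real k * (r - q) * cis (angle_at p q r)"
    unfolding k_def by (rule turn_at_vertex[OF o])
  have "orient p q r = Im (cnj (r - q) * (p - q))"
    by (simp add: orient_def algebra_simps)
  also have "cnj (r - q) * (p - q) = of_real k * ((r - q) * cnj (r - q)) * cis (angle_at p q r)"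
    unfolding t by (simp only: mult_ac)
  also have "(r - q) * cnj (r - q) = of_real ((norm (r - q))\<^sup>2)"
    by (simp only: complex_norm_square)
  also have "Im (of_real k * of_real ((norm (r - q))\<^sup>2) * cis (angle_at p q r))
      = k * (norm (r - q))\<^sup>2 * sin (angle_at p q r)"
    by (simp add: Im_complex_of_real)
  also have "k * (norm (r - q))\<^sup>2 = dist p q * dist r q"
    using rq by (simp add: k_def dist_norm power2_eq_square)
  finally show ?thesis .
qed

lemma abs_orient_sin:
  assumes o: "orient p q r \<noteq> 0"
  shows "\<bar>orient p q r\<bar> = dist p q * dist r q * sin (angle_at p q r)"
proof (cases "orient p q r > 0")
  case True thus ?thesis using orient_sin_pos by simp
next
  case False
  have "orient r q p = - orient p q r" by (simp add: orient_def algebra_simps)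
  thus ?thesis using orient_sin_pos[of r q p] False o angle_at_commute[of p q r]
    by (simp add: mult.commute)
qed

lemma angle_at_bounds:
  assumes "orient p q r \<noteq> 0"
  shows "0 < angle_at p q r" "angle_at p q r < pi"
proof -
  have d: "p - q \<noteq> 0" "r - q \<noteq> 0" using assms by auto
  have "\<bar>(p - q) \<bullet> (r - q)\<bar> \<le> norm (p - q) * norm (r - q)" by (rule Cauchy_Schwarz_ineq2)
  hence b: "\<bar>(p - q) \<bullet> (r - q) / (norm (p - q) * norm (r - q))\<bar> \<le> 1"
    using d by (simp add: abs_mult)
  from b have "-1 \<le> (p - q) \<bullet> (r - q) / (norm (p - q) * norm (r - q))"
    "(p - q) \<bullet> (r - q) / (norm (p - q) * norm (r - q)) \<le> 1"
    unfolding abs_le_iff by linarith+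
  hence "0 \<le> angle_at p q r" "angle_at p q r \<le> pi"
    unfolding angle_at_def by (rule arccos_lbound, rule arccos_ubound)
  moreover have "sin (angle_at p q r) \<noteq> 0" using abs_orient_sin[OF assms] assms by auto
  ultimately show "0 < angle_at p q r" "angle_at p q r < pi"
    by (metis order_le_less sin_zero, metis order_le_less sin_pi)
qed

lemma cos_angle_at:
  assumes "x \<noteq> y" "z \<noteq> y"
  shows "2 * dist x y * dist z y * cos (angle_at x y z) = (dist x y)\<^sup>2 + (dist z y)\<^sup>2 - (dist x z)\<^sup>2"
proof -
  have "\<bar>(x - y) \<bullet> (z - y)\<bar> \<le> norm (x - y) * norm (z - y)" by (rule Cauchy_Schwarz_ineq2)
  hence b: "\<bar>(x - y) \<bullet> (z - y) / (norm (x - y) * norm (z - y))\<bar> \<le> 1"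
    using assms by (simp add: abs_mult)
  have "cos (angle_at x y z) = (x - y) \<bullet> (z - y) / (norm (x - y) * norm (z - y))"
    unfolding angle_at_def using b by (rule cos_arccos_abs)
  hence "2 * dist x y * dist z y * cos (angle_at x y z) = 2 * ((x - y) \<bullet> (z - y))"
    using assms by (simp add: dist_norm)
  thus ?thesis by (simp add: inner_dist)
qed

text \<open>Going around a counterclockwise triangle multiplies the three turns, and each edge is
  reversed once. So the angles sum to \<pi> modulo 2\<pi>, and the bounds on the single angles leave
  only \<pi>.\<close>

lemma angle_sum:
  assumes o: "orient p q r \<noteq> 0"
  shows "angle_at r p q + angle_at p q r + angle_at q r p = pi"
proof -
  have pos: "angle_at r p q + angle_at p q r + angle_at q r p = pi" if o: "orient p q r > 0" for p q r
  proof -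
    let ?s = "angle_at p q r + angle_at q r p + angle_at r p q"
    have o2: "orient q r p > 0" and o3: "orient r p q > 0"
      using o orient_rotate[of q r p] orient_rotate[of r p q] by simp_all
    have d: "p \<noteq> q" "q \<noteq> r" "r \<noteq> p" using o by auto
    define k1 k2 k3 where "k1 = dist p q / dist r q" and "k2 = dist q r / dist p r" and "k3 = dist r p / dist q p"
    have e: "p - q = of_real k1 * (r - q) * cis (angle_at p q r)"
       "q - r = of_real k2 * (p - r) * cis (angle_at q r p)"
       "r - p = of_real k3 * (q - p) * cis (angle_at r p q)"
      unfolding k1_def k2_def k3_def using turn_at_vertex[OF o] turn_at_vertex[OF o2] turn_at_vertex[OF o3] .
    have "(p - q) * (q - r) * (r - p) = (of_real k1 * (r - q) * cis (angle_at p q r)) *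
       (of_real k2 * (p - r) * cis (angle_at q r p)) * (of_real k3 * (q - p) * cis (angle_at r p q))"
      using e by metis
    also have "\<dots> = of_real (k1 * k2 * k3) * cis ?s * ((r - q) * (p - r) * (q - p))"
      by (simp add: cis_mult[symmetric] mult_ac)
    also have "k1 * k2 * k3 = 1" using d by (simp add: k1_def k2_def k3_def dist_commute)
    also have "(r - q) * (p - r) * (q - p) = - ((p - q) * (q - r) * (r - p))"
      by (simp add: algebra_simps)
    finally have W: "(p - q) * (q - r) * (r - p) = - (cis ?s * ((p - q) * (q - r) * (r - p)))"
      by simp
    have "cis ?s = -1"
    proof -
      have "cis ?s = -1" if "W = - (cis ?s * W)" "W \<noteq> 0" for W
      proof -
        have "(cis ?s + 1) * W = 0"
          using iffD1[OF eq_neg_iff_add_eq_0 that(1)] by (simp add: distrib_right add.commute)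
        thus ?thesis using that(2) by (simp add: eq_neg_iff_add_eq_0)
      qed
      from this[OF W] show ?thesis using d by simp
    qed
    hence "cis (?s - pi) = 1" by (simp add: cis_divide[symmetric])
    then have "sin (?s - pi) = 0" "cos (?s - pi) = 1" by (simp_all add: complex_eq_iff)
    moreover have "0 < ?s" "?s < 3 * pi"
      using angle_at_bounds[of p q r] angle_at_bounds[of q r p] angle_at_bounds[of r p q] o o2 o3 by auto
    moreover obtain m :: int where m: "?s - pi = of_int m * 2 * pi"
      using cos_one_2pi_int[of "?s - pi"] calculation(2) by auto
    ultimately have "0 < pi * (of_int (2 * m + 1))" "pi * of_int (2 * m + 1) < pi * 3"
      by (simp_all add: algebra_simps)
    hence "0 < (of_int (2 * m + 1) :: real)" "(of_int (2 * m + 1) :: real) < 3"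
      by (simp_all only: zero_less_mult_iff mult_less_cancel_left_pos pi_gt_zero) auto
    hence "0 < 2 * m + 1" "2 * m + 1 < 3" by (simp_all only: of_int_0_less_iff of_int_less_numeral_iff)
    hence "m = 0" by simp
    thus ?thesis using m by (simp add: algebra_simps)
  qed
  show ?thesis
  proof (cases "orient p q r > 0")
    case False
    hence "orient q p r > 0" using o by (simp add: orient_swap[of q p])
    from pos[OF this] show ?thesis
      using angle_at_commute[of r q p] angle_at_commute[of q p r] angle_at_commute[of p r q] by simp
  qed (rule pos)
qed

text \<open>The angle 2\<pi>/3 gives the law of cosines and the area. The sines of \<alpha> and
  \<beta> then follow from the area, their cosines from the law of cosines at the other two
  corners.\<close>

lemma tile_trigonometry:
  assumes o: "orient p q r \<noteq> 0"
    and d: "dist p q = c" "dist q r = a" "dist r p = b"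
    and ang: "angle_at r p q = \<alpha>" "angle_at p q r = \<beta>" "angle_at q r p = 2 * pi / 3"
  shows "0 < a" "0 < b" "0 < c" "c\<^sup>2 = a\<^sup>2 + a * b + b\<^sup>2" "0 < \<alpha>" "0 < \<beta>" "\<alpha> + \<beta> = pi / 3"
    "2 * c * sin \<alpha> = sqrt 3 * a" "2 * c * cos \<alpha> = a + 2 * b"
    "2 * c * sin \<beta> = sqrt 3 * b" "2 * c * cos \<beta> = 2 * a + b"
    "\<bar>orient p q r\<bar> = a * b * sqrt 3 / 2"
proof -
  have ne: "p \<noteq> q" "q \<noteq> r" "r \<noteq> p" using o by auto
  show pos: "0 < a" "0 < b" "0 < c" using ne d by auto
  have o2: "orient q r p = orient p q r" "orient r p q = orient p q r"
    by (simp_all only: orient_rotate[of q r p] orient_rotate[of r p q])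
  have c3: "cos (2 * pi / 3) = - 1 / 2" "sin (2 * pi / 3) = sqrt 3 / 2"
    using cos_120 sin_120 by (simp_all add: mult.commute)
  show cl: "c\<^sup>2 = a\<^sup>2 + a * b + b\<^sup>2"
    using cos_angle_at[of q r p] ne d ang c3 by (simp add: dist_commute algebra_simps)
  show "0 < \<alpha>" "0 < \<beta>" using angle_at_bounds[of r p q] angle_at_bounds[of p q r] o o2 ang by auto
  show "\<alpha> + \<beta> = pi / 3" using angle_sum[OF o] ang by simp
  show A: "\<bar>orient p q r\<bar> = a * b * sqrt 3 / 2"
    using abs_orient_sin[of q r p] o o2 d ang c3 by (simp add: dist_commute)
  have "\<bar>orient p q r\<bar> = b * c * sin \<alpha>"
    using abs_orient_sin[of r p q] o o2 d ang by (simp add: dist_commute)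
  thus "2 * c * sin \<alpha> = sqrt 3 * a" using A pos by (simp add: field_simps)
  have "\<bar>orient p q r\<bar> = c * a * sin \<beta>"
    using abs_orient_sin[of p q r] o d ang by (simp add: dist_commute)
  thus "2 * c * sin \<beta> = sqrt 3 * b" using A pos by (simp add: field_simps)
  have "2 * b * c * cos \<alpha> = b * (a + 2 * b)"
    using cos_angle_at[of r p q] ne d ang cl by (simp add: dist_commute power2_eq_square algebra_simps)
  thus "2 * c * cos \<alpha> = a + 2 * b" using pos by simp
  have "2 * c * a * cos \<beta> = a * (2 * a + b)"
    using cos_angle_at[of p q r] ne d ang cl by (simp add: dist_commute power2_eq_square algebra_simps)
  thus "2 * c * cos \<beta> = 2 * a + b" using pos by simp
qed

section \<open>Tilings by a tile with a 120 degree angle\<close>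

text \<open>The symmetry that exchanges \<alpha> with \<beta> and a with b while keeping c. It
  yields the second relation from the first and halves the list of corner shapes.\<close>

fun swap_labels :: "triangle \<Rightarrow> triangle" where
  "swap_labels (p, q, r) = (q, p, r)"

lemma swap_labels_swap_labels [simp]: "swap_labels (swap_labels t) = t"
  by (cases t) simp

lemma inj_on_swap_labels: "inj_on swap_labels T"
  by (rule inj_on_inverseI[where g = swap_labels]) simp

lemma region_swap_labels [simp]: "region (swap_labels t) = region t"
  by (cases t) (simp only: swap_labels.simps region_swap)

lemma orientation_swap_labels [simp]: "orientation (swap_labels t) = - orientation t"
proof (cases t)
  case (fields p q r)
  thus ?thesis using orient_swap[of p q r] by simp
qed

lemma strictly_inside_swap_labels [simp]: "strictly_inside (swap_labels t) z = strictly_inside t z"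
proof (cases t)
  case (fields p q r)
  have "orient q p r * orient q p z = orient p q r * orient p q z"
    "orient q p r * orient p r z = orient p q r * orient r p z"
    "orient q p r * orient r q z = orient p q r * orient q r z"
    by (simp_all only: orient_swap[of q p] orient_swap[of p r] orient_swap[of r q] minus_mult_minus)
  thus ?thesis unfolding fields swap_labels.simps strictly_inside.simps by auto
qed

lemma tiled_swap_labels:
  assumes "tiled T t0"
  shows "tiled (swap_labels ` T) t0"
proof -
  have "(\<Sum>t\<in>swap_labels ` T. of_bool (z \<in> region t)) = (\<Sum>t\<in>T. of_bool (z \<in> region t) :: real)" for z
    unfolding sum.reindex[OF inj_on_swap_labels] comp_def region_swap_labels ..
  note sum_eq = this
  show ?thesis
    unfolding tiled_def
  proof (intro conjI ballI allI impI)
    show "finite (swap_labels ` T)" "orientation t0 \<noteq> 0" using assms by (auto simp: tiled_def)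
    fix t assume "t \<in> swap_labels ` T"
    then obtain s where s: "s \<in> T" "t = swap_labels s" by blast
    hence "orientation s \<noteq> 0" "region s \<subseteq> region t0" using assms unfolding tiled_def by blast+
    thus "orientation t \<noteq> 0" "region t \<subseteq> region t0" by (simp_all add: s(2))
  next
    fix z assume "\<forall>t\<in>swap_labels ` T. z \<in> region t \<longrightarrow> strictly_inside t z"
    hence "\<forall>t\<in>T. z \<in> region t \<longrightarrow> strictly_inside t z" by simp
    thus "(\<Sum>t\<in>swap_labels ` T. of_bool (z \<in> region t)) = (of_bool (z \<in> region t0) :: real)"
      unfolding sum_eq using assms unfolding tiled_def by blast
  qed
qed

lemma cis_nat_pi: "cis (real n * pi) = (-1) ^ n"
proof -
  have "cis (real n * pi) = cis pi ^ n" by (rule Complex.DeMoivre[symmetric])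
  thus ?thesis by simp
qed

section \<open>Counting tiles at the corners and on the sides\<close>

definition at_alpha :: "triangle set \<Rightarrow> complex \<Rightarrow> nat" where
  "at_alpha T v = card {t \<in> T. fst t = v}"

definition at_beta :: "triangle set \<Rightarrow> complex \<Rightarrow> nat" where
  "at_beta T v = card {t \<in> T. fst (snd t) = v}"

definition at_gamma :: "triangle set \<Rightarrow> complex \<Rightarrow> nat" where
  "at_gamma T v = card {t \<in> T. snd (snd t) = v}"

definition edges_on ::
    "triangle set \<Rightarrow> complex \<Rightarrow> complex \<Rightarrow> (triangle \<Rightarrow> complex) \<Rightarrow> (triangle \<Rightarrow> complex) \<Rightarrow> nat" where
  "edges_on T A B f g = card {t \<in> T. aligned A B (f t) (g t)}"

text \<open>Only the measures of the tiles and the irrationality are recorded, so the locale is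
  stable under permuting A, B, C and under \<open>swap_labels\<close>, and each fact has to be
  proved in one position only.\<close>

locale tile_cover =
  fixes T :: "triangle set" and a b c \<alpha> \<beta> :: real and A B C :: complex
  assumes cov: "tiled T (A, B, C)"
    and tile: "\<And>p q r. (p, q, r) \<in> T \<Longrightarrow> dist p q = c \<and> dist q r = a \<and> dist r p = b \<and>
      angle_at r p q = \<alpha> \<and> angle_at p q r = \<beta> \<and> angle_at q r p = 2 * pi / 3"
    and irrational: "\<alpha> / pi \<notin> \<rat>"
begin

lemma finite_T: "finite T"
  and orient_ABC: "orient A B C \<noteq> 0"
  and orient_T: "(p, q, r) \<in> T \<Longrightarrow> orient p q r \<noteq> 0"
  using cov unfolding tiled_def by auto

lemma nonempty: "T \<noteq> {}"
  using tiled_area[OF cov] orient_ABC by auto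

lemma trig:
  "0 < a" "0 < b" "0 < c" "c\<^sup>2 = a\<^sup>2 + a * b + b\<^sup>2" "0 < \<alpha>" "0 < \<beta>" "\<alpha> + \<beta> = pi / 3"
  "2 * c * sin \<alpha> = sqrt 3 * a" "2 * c * cos \<alpha> = a + 2 * b"
  "2 * c * sin \<beta> = sqrt 3 * b" "2 * c * cos \<beta> = 2 * a + b"
proof -
  obtain p q r where t: "(p, q, r) \<in> T" using nonempty by auto
  have o: "orient p q r \<noteq> 0" using orient_T[OF t] .
  have d: "dist p q = c" "dist q r = a" "dist r p = b" "angle_at r p q = \<alpha>"
     "angle_at p q r = \<beta>" "angle_at q r p = 2 * pi / 3"
    using tile[OF t] by auto
  show "0 < a" "0 < b" "0 < c" "c\<^sup>2 = a\<^sup>2 + a * b + b\<^sup>2" "0 < \<alpha>" "0 < \<beta>" "\<alpha> + \<beta> = pi / 3"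
    "2 * c * sin \<alpha> = sqrt 3 * a" "2 * c * cos \<alpha> = a + 2 * b"
    "2 * c * sin \<beta> = sqrt 3 * b" "2 * c * cos \<beta> = 2 * a + b"
    by (fact tile_trigonometry[OF o d])+
qed

lemma abs_orient_T: "(p, q, r) \<in> T \<Longrightarrow> \<bar>orient p q r\<bar> = a * b * sqrt 3 / 2"
  using tile_trigonometry(12)[of p q r c a b \<alpha> \<beta>] orient_T[of p q r] tile[of p q r] by simp

lemma tile_cover_rotate: "tile_cover T a b c \<alpha> \<beta> B C A"
  by unfold_locales (rule tiled_rotate[OF cov], erule tile, rule irrational)

lemma tile_cover_swap: "tile_cover T a b c \<alpha> \<beta> B A C"
  by unfold_locales (rule tiled_swap[OF cov], erule tile, rule irrational)

lemma tile_cover_relabel: "tile_cover (swap_labels ` T) b a c \<beta> \<alpha> A B C"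
proof
  show "tiled (swap_labels ` T) (A, B, C)" by (rule tiled_swap_labels[OF cov])
  show "dist p q = c \<and> dist q r = b \<and> dist r p = a \<and>
      angle_at r p q = \<beta> \<and> angle_at p q r = \<alpha> \<and> angle_at q r p = 2 * pi / 3"
    if m: "(p, q, r) \<in> swap_labels ` T" for p q r
  proof -
    from m obtain t where "t \<in> T" "(p, q, r) = swap_labels t" by auto
    hence "(q, p, r) \<in> T" by (cases t) auto
    from tile[OF this] show ?thesis
      using angle_at_commute[of r p q] angle_at_commute[of p q r] angle_at_commute[of q r p]
      by (auto simp: dist_commute)
  qed
  have "\<beta> = 1 / 3 * pi - \<alpha>" using trig(7) by simp
  hence "\<beta> / pi = 1 / 3 - \<alpha> / pi" by (simp add: diff_divide_distrib)
  hence "\<alpha> / pi = 1 / 3 - \<beta> / pi" by simp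
  thus "\<beta> / pi \<notin> \<rat>" using irrational by auto
qed

lemma corner_angle:
  "angle_at C A B = at_alpha T A * \<alpha> + at_beta T A * \<beta> + at_gamma T A * (2 * pi / 3)"
proof -
  have cs: "corner_sum A (\<lambda>q r. angle_at q A r) t =
      (if fst t = A then \<alpha> else 0) + (if fst (snd t) = A then \<beta> else 0) + (if snd (snd t) = A then 2 * pi / 3 else 0)"
    if "t \<in> T" for t
  proof -
    obtain p q r where t: "t = (p, q, r)" by (cases t)
    from tile[of p q r] that show ?thesis
      by (auto simp: t angle_at_commute[of r p q] angle_at_commute[of p q r] angle_at_commute[of q r p])
  qed
  have "angle_at C A B = angle_at B A C" by (rule angle_at_commute)
  also have "\<dots> = (\<Sum>t\<in>T. corner_sum A (\<lambda>q r. angle_at q A r) t)"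
    by (rule tiled_corner(1)[OF cov, symmetric])
  also have "\<dots> = (\<Sum>t\<in>T. (if fst t = A then \<alpha> else 0)) + (\<Sum>t\<in>T. (if fst (snd t) = A then \<beta> else 0))
      + (\<Sum>t\<in>T. (if snd (snd t) = A then 2 * pi / 3 else 0))"
    by (simp add: cs sum.distrib cong: sum.cong)
  also have "\<dots> = at_alpha T A * \<alpha> + at_beta T A * \<beta> + at_gamma T A * (2 * pi / 3)"
    using finite_T by (simp add: sum.If_cases at_alpha_def at_beta_def at_gamma_def Int_def)
  finally show ?thesis .
qed

lemma corner_angle_B: "angle_at A B C = at_alpha T B * \<alpha> + at_beta T B * \<beta> + at_gamma T B * (2 * pi / 3)"
  by (rule tile_cover.corner_angle[OF tile_cover_rotate])

lemma corner_angle_C: "angle_at B C A = at_alpha T C * \<alpha> + at_beta T C * \<beta> + at_gamma T C * (2 * pi / 3)"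
  by (rule tile_cover.corner_angle_B[OF tile_cover_rotate])

lemma corner_positive:
  "0 < at_alpha T A + at_beta T A + at_gamma T A"
proof (rule ccontr)
  assume "\<not> ?thesis"
  hence "angle_at C A B = 0" unfolding corner_angle by simp
  moreover have "orient C A B \<noteq> 0"
    using orient_ABC by (simp only: orient_rotate[of C A B] orient_rotate[of B C A] not_False_eq_True)
  ultimately show False using angle_at_bounds(1)[of C A B] by simp
qed

text \<open>With \<beta> = \<pi>/3 - \<alpha> the angle sum makes \<alpha>, times the difference of
  the two totals, a rational multiple of \<pi>, so that difference is 0.\<close>

lemma corner_totals:
  "at_alpha T A + at_alpha T B + at_alpha T C = at_beta T A + at_beta T B + at_beta T C"
  "at_beta T A + at_beta T B + at_beta T C + 2 * (at_gamma T A + at_gamma T B + at_gamma T C) = 3"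
proof -
  define p q r where "p = at_alpha T A + at_alpha T B + at_alpha T C"
    and "q = at_beta T A + at_beta T B + at_beta T C" and "r = at_gamma T A + at_gamma T B + at_gamma T C"
  have "pi = real p * \<alpha> + real q * \<beta> + real r * (2 * pi / 3)"
    using angle_sum[OF orient_ABC] unfolding corner_angle corner_angle_B corner_angle_C p_def q_def r_def
    by (simp add: algebra_simps add_divide_distrib)
  moreover have "\<beta> = pi / 3 - \<alpha>" using trig(7) by simp
  ultimately have e: "(real p - real q) * \<alpha> = (1 - real q / 3 - 2 * real r / 3) * pi"
    by (simp add: algebra_simps)
  have pq: "p = q"
  proof (rule ccontr)
    assume "p \<noteq> q"
    hence nz: "real p - real q \<noteq> 0" by simp
    have "\<alpha> / pi = (1 - real q / 3 - 2 * real r / 3) / (real p - real q)"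
      using e nz by (simp add: frac_eq_eq mult.commute)
    also have "\<dots> \<in> \<rat>" by simp
    finally show False using irrational by simp
  qed
  hence "1 - real q / 3 - 2 * real r / 3 = 0" using e by simp
  hence "real (q + 2 * r) = 3" by simp
  hence "q + 2 * r = 3" by linarith
  thus "at_beta T A + at_beta T B + at_beta T C + 2 * (at_gamma T A + at_gamma T B + at_gamma T C) = 3"
    by (simp add: q_def r_def)
  show "at_alpha T A + at_alpha T B + at_alpha T C = at_beta T A + at_beta T B + at_beta T C"
    using pq by (simp add: p_def q_def)
qed

lemma area: "dist A B * dist A C * sin (angle_at C A B) = real (card T) * (a * b * sqrt 3 / 2)"
proof -
  have o: "\<bar>orient C A B\<bar> = \<bar>orient A B C\<bar>"
    by (simp only: orient_rotate[of C A B] orient_rotate[of A B C])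
  hence "orient C A B \<noteq> 0" using orient_ABC by auto
  hence "\<bar>orient A B C\<bar> = dist C A * dist B A * sin (angle_at C A B)"
    unfolding o[symmetric] by (rule abs_orient_sin)
  moreover have "(\<Sum>t\<in>T. \<bar>orientation t\<bar>) = (\<Sum>t\<in>T. a * b * sqrt 3 / 2)"
    using abs_orient_T by (intro sum.cong) auto
  ultimately show ?thesis using tiled_area[OF cov] by (simp add: dist_commute mult_ac)
qed

lemma side_AB:
  "dist A B = real (edges_on T A B (fst \<circ> snd) (snd \<circ> snd)) * a + real (edges_on T A B (snd \<circ> snd) fst) * b
     + real (edges_on T A B fst (fst \<circ> snd)) * c"
proof -
  have "dist A B = (\<Sum>t\<in>T. boundary_sum (\<lambda>x y. if aligned A B x y then dist x y else 0) t)"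
    by (rule tiled_side[OF cov])
  also have "\<dots> = (\<Sum>t\<in>T. (if aligned A B (fst t) (fst (snd t)) then c else 0)
      + (if aligned A B (fst (snd t)) (snd (snd t)) then a else 0) + (if aligned A B (snd (snd t)) (fst t) then b else 0))"
  proof (rule sum.cong[OF refl])
    fix t assume t: "t \<in> T"
    obtain p q r where pqr: "t = (p, q, r)" by (cases t)
    show "boundary_sum (\<lambda>x y. if aligned A B x y then dist x y else 0) t =
      (if aligned A B (fst t) (fst (snd t)) then c else 0)
      + (if aligned A B (fst (snd t)) (snd (snd t)) then a else 0) + (if aligned A B (snd (snd t)) (fst t) then b else 0)"
      using tile[of p q r] t by (auto simp: pqr)
  qed
  finally show ?thesis
    using finite_T by (simp add: sum.distrib sum.If_cases edges_on_def Int_def)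
qed

text \<open>Were w no rational multiple of v, some \<phi> would vanish on v and not on w. The
  weights built from it are zero on every tile, hence on ABC, where they are a unit factor times
  \<phi>(w).\<close>

lemma relation_beta:
  assumes g: "at_gamma T A = 0" "at_gamma T B = 0"
  obtains \<rho> where "\<rho> \<in> \<rat>"
    "dist A B - (-1) ^ at_beta T B * dist B C - (-1) ^ at_beta T A * dist C A = \<rho> * (c + a - b)"
proof -
  define v where "v = c + a - b"
  define w where "w = dist A B - (-1) ^ at_beta T B * dist B C - (-1) ^ at_beta T A * dist C A"
  have v: "v \<noteq> 0" using triangle_pos(1)[OF trig(1-4)] by (simp add: v_def)
  have "w / v \<in> \<rat>"
  proof (rule ccontr)
    assume "w / v \<notin> \<rat>"
    then obtain \<phi> where \<phi>: "rat_linear \<phi>" "\<phi> v = 0" "\<phi> w = 1"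
      using rat_linear_exists[OF v, of w 0 1] by blast
    \<comment> \<open>These values force \<open>f \<beta> = pi\<close>: an angle \<alpha> leaves the
      character unchanged and an angle \<beta> negates it, so a corner made of them has the parity
      of its angles \<beta> as its sign.\<close>
    obtain f where f: "rat_linear f" "f pi = 3 * pi" "f \<alpha> = 0"
      using rat_linear_exists[of pi \<alpha> "3 * pi" 0] irrational by auto
    have f\<beta>: "f \<beta> = pi"
    proof -
      have "\<beta> = 1 / 3 * pi - \<alpha>" using trig(7) by simp
      hence "f \<beta> = f (1 / 3 * pi) - f \<alpha>" by (simp only: rat_linear_diff[OF f(1)])
      also have "f (1 / 3 * pi) = 1 / 3 * f pi" by (rule rat_linear_scale[OF f(1)]) simp
      finally show ?thesis using f by simp
    qed
    have corner: "cis (f (real m * \<alpha> + real n * \<beta>)) = of_real ((-1) ^ n)" for m n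
    proof -
      have "f (real m * \<alpha> + real n * \<beta>) = real m * f \<alpha> + real n * f \<beta>"
        using rat_linear_add[OF f(1)] rat_linear_scale[OF f(1)] by simp
      thus ?thesis by (simp add: f f\<beta> cis_nat_pi)
    qed
    have sq: "((-1) ^ n)\<^sup>2 = (1::real)" for n :: nat by (simp add: power_mult[symmetric])
    define W where "W = character_weight \<phi> f"
    have zero: "boundary_sum W t = 0" if t: "t \<in> T" for t
    proof -
      obtain p q r where pqr: "t = (p, q, r)" by (cases t)
      have d: "dist p q = c" "dist q r = a" "dist r p = b" "angle_at p q r = \<beta>" "angle_at r p q = \<alpha>"
        using tile[of p q r] t by (auto simp: pqr)
      have "boundary_sum W (p, q, r)
          = character f (q - p) * of_real (\<phi> (dist p q) - (-1) * \<phi> (dist q r) - 1 * \<phi> (dist r p))"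
        unfolding W_def
        by (rule boundary_sum_character[OF f(1,2) \<phi>(1)])
           (use orient_T[of p q r] t corner[of 0 1] corner[of 1 0] in \<open>simp_all add: d pqr\<close>)
      also have "\<phi> (dist p q) - (-1) * \<phi> (dist q r) - 1 * \<phi> (dist r p) = \<phi> v"
        by (simp add: d v_def rat_linear_add[OF \<phi>(1)] rat_linear_diff[OF \<phi>(1)])
      finally show ?thesis by (simp add: \<phi> pqr)
    qed
    have angs: "cis (f (angle_at A B C)) = of_real ((-1) ^ at_beta T B)"
       "cis (f (angle_at C A B)) = of_real ((-1) ^ at_beta T A)"
      unfolding corner_angle corner_angle_B g by (simp_all only: of_nat_0 mult_zero_left add_0_right corner)
    have "sgn (orientation (A, B, C)) *\<^sub>R boundary_sum W (A, B, C) = (\<Sum>t\<in>T. sgn (orientation t) *\<^sub>R boundary_sum W t)"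
      unfolding W_def by (rule tiled_boundary_sum[OF cov line_additive_character_weight[OF f(1,2) \<phi>(1)], symmetric])
    also have "\<dots> = 0" by (intro sum.neutral ballI) (simp only: zero scaleR_zero_right)
    finally have "boundary_sum W (A, B, C) = 0" using orient_ABC by (auto simp: sgn_zero_iff)
    moreover have "boundary_sum W (A, B, C) = character f (B - A) *
        of_real (\<phi> (dist A B) - (-1) ^ at_beta T B * \<phi> (dist B C) - (-1) ^ at_beta T A * \<phi> (dist C A))"
      unfolding W_def by (rule boundary_sum_character[OF f(1,2) \<phi>(1) orient_ABC angs sq sq])
    moreover have "character f (B - A) \<noteq> 0" by (simp add: character_def)
    ultimately have "\<phi> (dist A B) - (-1) ^ at_beta T B * \<phi> (dist B C) - (-1) ^ at_beta T A * \<phi> (dist C A) = 0"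
      by (simp only: mult_eq_0_iff of_real_eq_0_iff) blast
    moreover have "\<phi> ((-1) ^ n * x) = (-1) ^ n * \<phi> x" for n :: nat and x
      by (rule rat_linear_scale[OF \<phi>(1)]) simp
    ultimately have "\<phi> w = 0" by (simp add: w_def rat_linear_diff[OF \<phi>(1)])
    thus False using \<phi> by simp
  qed
  moreover have "w = w / v * v" using v by simp
  ultimately show ?thesis using that unfolding w_def v_def by blast
qed

end

lemma at_alpha_swap: "at_alpha (swap_labels ` T) v = at_beta T v"
  and at_beta_swap: "at_beta (swap_labels ` T) v = at_alpha T v"
  and at_gamma_swap: "at_gamma (swap_labels ` T) v = at_gamma T v"
proof -
  have 1: "{t \<in> swap_labels ` T. fst t = v} = swap_labels ` {t \<in> T. fst (snd t) = v}"
    "{t \<in> swap_labels ` T. fst (snd t) = v} = swap_labels ` {t \<in> T. fst t = v}"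
    "{t \<in> swap_labels ` T. snd (snd t) = v} = swap_labels ` {t \<in> T. snd (snd t) = v}"
    by (auto intro!: image_eqI)
  show "at_alpha (swap_labels ` T) v = at_beta T v" "at_beta (swap_labels ` T) v = at_alpha T v"
    "at_gamma (swap_labels ` T) v = at_gamma T v"
    unfolding at_alpha_def at_beta_def at_gamma_def 1
    by (simp_all add: card_image inj_on_swap_labels)
qed

context tile_cover
begin

lemma relation_alpha:
  assumes g: "at_gamma T A = 0" "at_gamma T B = 0"
  obtains \<rho> where "\<rho> \<in> \<rat>"
    "dist A B - (-1) ^ at_alpha T B * dist B C - (-1) ^ at_alpha T A * dist C A = \<rho> * (c - a + b)"
proof (rule tile_cover.relation_beta[OF tile_cover_relabel])
  show "at_gamma (swap_labels ` T) A = 0" "at_gamma (swap_labels ` T) B = 0"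
    using g by (simp_all only: at_gamma_swap)
  fix \<rho> assume "\<rho> \<in> \<rat>" "dist A B - (-1) ^ at_beta (swap_labels ` T) B * dist B C
     - (-1) ^ at_beta (swap_labels ` T) A * dist C A = \<rho> * (c + b - a)"
  moreover have "c + b - a = c - a + b" by simp
  ultimately show thesis using that by (simp only: at_beta_swap)
qed

end

section \<open>Similarity criteria\<close>

lemma point_unique:
  assumes AB: "A \<noteq> B" and d: "dist A x = dist A y" "dist B x = dist B y" and o: "orient A B x = orient A B y"
  shows "x = y"
proof -
  have "2 * ((B - A) \<bullet> (x - A)) = 2 * ((B - A) \<bullet> (y - A))"
    unfolding inner_dist using d by (simp add: dist_commute)
  hence "cnj (B - A) * (x - A) = cnj (B - A) * (y - A)"
    using o by (simp add: complex_eq_iff inner_complex_def orient_def algebra_simps)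
  moreover have "cnj (B - A) \<noteq> 0" using AB by simp
  ultimately show ?thesis by simp
qed

lemma similar_if_vertices:
  assumes "similarity k f" "linear L" "\<And>z. f z = t + L z" "f p = A" "f q = B" "f r = C"
  shows "similar (p, q, r) (A, B, C)"
proof -
  have f: "f ` S = (+) t ` L ` S" for S using assms(3) by auto
  have "f ` region (p, q, r) = convex hull (f ` {p, q, r})"
    unfolding f region.simps by (simp only: convex_hull_linear_image[OF assms(2)] convex_hull_translation)
  also have "\<dots> = region (A, B, C)" using assms(4-6) by simp
  finally show ?thesis using assms(1) unfolding similar_def by blast
qed

text \<open>By Heron's formula the orientations correspond up to sign. The similarity is complex
  affine for one sign and involves conjugation for the other; distances from A and B together with
  the orientation pin down the image of the third vertex.\<close>

lemma similar_if_sides: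
  assumes o: "orient p q r \<noteq> 0" and k: "k > 0"
    and d: "dist A B = k * dist p q" "dist B C = k * dist q r" "dist C A = k * dist r p"
  shows "similar (p, q, r) (A, B, C)"
proof -
  have pq: "p \<noteq> q" using o by auto
  have AB: "A \<noteq> B" using d(1) k pq by auto
  define w where "w = (B - A) / (q - p)"
  have w: "norm w = k" using d(1) pq by (simp add: w_def norm_divide dist_norm norm_minus_commute)
  have sq: "(orient A B C)\<^sup>2 = (k\<^sup>2 * orient p q r)\<^sup>2"
    using orient_square_dist[of A B C] orient_square_dist[of p q r] d
    by (simp add: dist_commute power_mult_distrib algebra_simps) algebra
  hence "orient A B C = k\<^sup>2 * orient p q r \<or> orient A B C = - (k\<^sup>2 * orient p q r)"
    by (simp add: power2_eq_iff)
  thus ?thesis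
  proof
    assume e: "orient A B C = k\<^sup>2 * orient p q r"
    define f where "f z = A - w * p + w * z" for z
    have s: "similarity k f"
      unfolding similarity_def using k
      by (simp add: f_def dist_norm w norm_mult right_diff_distrib[symmetric])
    have "w * (q - p) = B - A" using pq by (simp add: w_def)
    hence fp: "f p = A" "f q = B" by (simp_all add: f_def algebra_simps)
    have o': "orient (f p) (f q) (f r) = k\<^sup>2 * orient p q r"
      unfolding f_def orient_affine w ..
    have "f r = C"
    proof (rule point_unique[OF AB])
      show "dist A (f r) = dist A C" "dist B (f r) = dist B C"
        using s d fp unfolding similarity_def by (metis dist_commute)+
      show "orient A B (f r) = orient A B C" using o' e fp by simp
    qed
    moreover have "linear (\<lambda>z. w * z)" by (rule linear_times)
    ultimately show ?thesis by (intro similar_if_vertices[OF s _ _ fp]) (auto simp: f_def)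
  next
    assume e: "orient A B C = - (k\<^sup>2 * orient p q r)"
    define v where "v = (B - A) / cnj (q - p)"
    have v: "norm v = k" using d(1) pq
      by (simp add: v_def norm_divide dist_norm norm_minus_commute del: complex_cnj_diff)
    define f where "f z = A - v * cnj p + v * cnj z" for z
    have s: "similarity k f"
    proof -
      have "f x - f y = v * cnj (x - y)" for x y by (simp add: f_def algebra_simps)
      hence "dist (f x) (f y) = k * dist x y" for x y by (simp add: dist_norm norm_mult v del: complex_cnj_diff)
      thus ?thesis using k by (simp add: similarity_def)
    qed
    have "v * (cnj q - cnj p) = B - A" using pq by (simp add: v_def)
    hence fp: "f p = A" "f q = B" by (simp_all add: f_def algebra_simps)
    have o': "orient (f p) (f q) (f r) = - (k\<^sup>2 * orient p q r)"
      unfolding f_def orient_affine v by (simp add: orient_def algebra_simps)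
    have "f r = C"
    proof (rule point_unique[OF AB])
      show "dist A (f r) = dist A C" "dist B (f r) = dist B C"
        using s d fp unfolding similarity_def by (metis dist_commute)+
      show "orient A B (f r) = orient A B C" using o' e fp by simp
    qed
    moreover have "linear (\<lambda>z. v * cnj z)"
      by (intro linearI) (simp_all add: algebra_simps scaleR_conv_of_real)
    ultimately show ?thesis by (intro similar_if_vertices[OF s _ _ fp]) (auto simp: f_def)
  qed
qed

lemma similar_if_angles:
  assumes o: "orient p q r \<noteq> 0" and O: "orient A B C \<noteq> 0"
    and ang: "angle_at r p q = angle_at C A B" "angle_at p q r = angle_at A B C"
  shows "similar (p, q, r) (A, B, C)"
proof -
  have law: "dist x y * sin (angle_at z x y) = dist y z * sin (angle_at y z x)"
    "dist x y * sin (angle_at x y z) = dist z x * sin (angle_at y z x)"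
    "sin (angle_at y z x) > 0" "sin (angle_at z x y) > 0" "dist x y > 0"
    if "orient x y z \<noteq> 0" for x y z
  proof -
    have r: "orient y z x = orient x y z" "orient z x y = orient x y z"
      by (simp_all only: orient_rotate[of z x y] orient_rotate[of y z x])
    have ne: "x \<noteq> y" "y \<noteq> z" "z \<noteq> x" using that by auto
    have a: "\<bar>orient x y z\<bar> = dist x y * dist z y * sin (angle_at x y z)"
      "\<bar>orient x y z\<bar> = dist y z * dist x z * sin (angle_at y z x)"
      "\<bar>orient x y z\<bar> = dist z x * dist y x * sin (angle_at z x y)"
      using abs_orient_sin[of x y z] abs_orient_sin[of y z x] abs_orient_sin[of z x y] that r by auto
    have "dist z x * (dist x y * sin (angle_at z x y)) = dist z x * (dist y z * sin (angle_at y z x))"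
      using a(2,3) by (simp add: dist_commute mult_ac)
    thus "dist x y * sin (angle_at z x y) = dist y z * sin (angle_at y z x)" using ne by simp
    have "dist y z * (dist x y * sin (angle_at x y z)) = \<bar>orient x y z\<bar>"
      unfolding a(1) by (simp add: dist_commute mult_ac)
    also have "\<dots> = dist y z * (dist z x * sin (angle_at y z x))"
      unfolding a(2) by (simp add: dist_commute mult_ac)
    finally have "dist y z * (dist x y * sin (angle_at x y z)) = dist y z * (dist z x * sin (angle_at y z x))" .
    thus "dist x y * sin (angle_at x y z) = dist z x * sin (angle_at y z x)" using ne by simp
    show "sin (angle_at y z x) > 0" "sin (angle_at z x y) > 0"
      using angle_at_bounds[of y z x] angle_at_bounds[of z x y] that r by (auto intro!: sin_gt_zero)
    show "dist x y > 0" using ne by simp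
  qed
  have third: "angle_at q r p = angle_at B C A"
    using angle_sum[OF o] angle_sum[OF O] ang by linarith
  define k where "k = dist A B / dist p q"
  have k: "k > 0" using law(5)[OF o] law(5)[OF O] by (simp add: k_def)
  have Z: "dist A B = k * dist p q" using law(5)[OF o] by (simp add: k_def)
  have "dist B C * sin (angle_at q r p) = k * dist q r * sin (angle_at q r p)"
    using law(1)[OF o, symmetric] law(1)[OF O, symmetric] ang third Z by (simp add: mult.assoc)
  hence X: "dist B C = k * dist q r" using law(3)[OF o] by simp
  have "dist C A * sin (angle_at q r p) = k * dist r p * sin (angle_at q r p)"
    using law(2)[OF o, symmetric] law(2)[OF O, symmetric] ang third Z by (simp add: mult.assoc)
  hence Y: "dist C A = k * dist r p" using law(3)[OF o] by simp
  show ?thesis by (rule similar_if_sides[OF o k Z X Y])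
qed

text \<open>Normalised so that the law of sines for the tile reads \<open>nsin \<alpha> = a / c\<close>.\<close>

definition nsin :: "real \<Rightarrow> real" where
  "nsin x = 2 * sin x / sqrt 3"

definition corners :: "triangle set \<Rightarrow> complex \<Rightarrow> complex \<Rightarrow> complex \<Rightarrow> nat \<Rightarrow> nat \<Rightarrow> nat \<Rightarrow> nat \<Rightarrow> nat \<Rightarrow> nat \<Rightarrow> bool" where
  "corners T A B C pA qA pB qB pC qC \<longleftrightarrow> at_alpha T A = pA \<and> at_beta T A = qA \<and> at_gamma T A = 0 \<and>
     at_alpha T B = pB \<and> at_beta T B = qB \<and> at_gamma T B = 0 \<and>
     at_alpha T C = pC \<and> at_beta T C = qC \<and> at_gamma T C = 0"

text \<open>Stated as the absence of a-edges and b-edges on the whole line, which is what vanishing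
  edge counts deliver.\<close>

definition only_c :: "triangle set \<Rightarrow> complex \<Rightarrow> complex \<Rightarrow> bool" where
  "only_c T A B \<longleftrightarrow> (\<forall>(p, q, r)\<in>T. \<not> aligned A B q r \<and> \<not> aligned A B r p)"

context tile_cover
begin

lemma nsin_values:
  "nsin \<alpha> = a / c" "nsin \<beta> = b / c" "nsin (2 * \<alpha>) = a * (a + 2 * b) / c\<^sup>2" "nsin (2 * \<beta>) = b * (2 * a + b) / c\<^sup>2"
  "nsin (3 * \<alpha>) = 3 * a * b * (a + b) / c ^ 3" "nsin (\<alpha> + \<beta>) = 1" "nsin (2 * \<alpha> + \<beta>) = (a + b) / c"
  "nsin (\<alpha> + 2 * \<beta>) = (a + b) / c" "nsin (3 * \<alpha> + \<beta>) = b * (2 * a + b) / c\<^sup>2"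
proof -
  have c0: "c \<noteq> 0" using trig(3) by simp
  have sa: "sin \<alpha> = sqrt 3 * a / (2 * c)" and ca: "cos \<alpha> = (a + 2 * b) / (2 * c)"
    and sb: "sin \<beta> = sqrt 3 * b / (2 * c)" and cb: "cos \<beta> = (2 * a + b) / (2 * c)"
    using trig(8-11) c0 by (simp_all add: field_simps)
  have v1: "nsin \<alpha> = a / c" "nsin \<beta> = b / c" by (simp_all add: nsin_def sa sb)
  have v3: "nsin (2 * \<alpha>) = a * (a + 2 * b) / c\<^sup>2" and v4: "nsin (2 * \<beta>) = b * (2 * a + b) / c\<^sup>2"
    by (simp_all add: nsin_def sin_double sa ca sb cb power2_eq_square)
  have c2: "cos (2 * \<alpha>) = (a + 2 * b)\<^sup>2 / (2 * c\<^sup>2) - 1"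
    by (simp add: cos_double_cos ca power_divide)
  have "nsin (3 * \<alpha>) = nsin (2 * \<alpha>) * cos \<alpha> + cos (2 * \<alpha>) * nsin \<alpha>"
    using sin_add[of "2 * \<alpha>" \<alpha>] by (simp add: nsin_def add_divide_distrib distrib_left mult_ac)
  also have "\<dots> = a * (a + 2 * b) / c\<^sup>2 * ((a + 2 * b) / (2 * c)) + ((a + 2 * b)\<^sup>2 / (2 * c\<^sup>2) - 1) * (a / c)"
    unfolding v1 v3 c2 ca ..
  also have "\<dots> = a * ((a + 2 * b)\<^sup>2 - c\<^sup>2) / c ^ 3"
    using c0 by (simp add: field_simps power2_eq_square power3_eq_cube)
  also have "(a + 2 * b)\<^sup>2 - c\<^sup>2 = 3 * b * (a + b)" unfolding trig(4) by (simp add: power2_eq_square algebra_simps)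
  finally have v5: "nsin (3 * \<alpha>) = 3 * a * b * (a + b) / c ^ 3" by (simp add: mult_ac)
  have p3: "sin (pi / 3) = sqrt 3 / 2" "cos (pi / 3) = 1 / 2" using sin_60 cos_60 by auto
  have v6: "nsin (\<alpha> + \<beta>) = 1" unfolding trig(7) by (simp add: nsin_def p3)
  have aux: "nsin (\<theta> + pi / 3) = nsin \<theta> / 2 + cos \<theta>" for \<theta>
    unfolding nsin_def sin_add p3 by (simp add: field_simps)
  \<comment> \<open>Since \<alpha> + \<beta> = \<pi>/3, the mixed angles are a shift by \<pi>/3 or a
    supplement of a known angle.\<close>
  have e: "2 * \<alpha> + \<beta> = \<alpha> + pi / 3" "\<alpha> + 2 * \<beta> = \<beta> + pi / 3" "3 * \<alpha> + \<beta> = pi - 2 * \<beta>" using trig(7) by simp_all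
  have v7: "nsin (2 * \<alpha> + \<beta>) = (a + b) / c" "nsin (\<alpha> + 2 * \<beta>) = (a + b) / c"
    unfolding e aux v1 ca cb using c0 by (simp_all add: field_simps)
  have v9: "nsin (3 * \<alpha> + \<beta>) = b * (2 * a + b) / c\<^sup>2"
    unfolding e v4[symmetric] by (simp add: nsin_def)
  show "nsin \<alpha> = a / c" "nsin \<beta> = b / c" "nsin (2 * \<alpha>) = a * (a + 2 * b) / c\<^sup>2" "nsin (2 * \<beta>) = b * (2 * a + b) / c\<^sup>2"
    "nsin (3 * \<alpha>) = 3 * a * b * (a + b) / c ^ 3" "nsin (\<alpha> + \<beta>) = 1" "nsin (2 * \<alpha> + \<beta>) = (a + b) / c"
    "nsin (\<alpha> + 2 * \<beta>) = (a + b) / c" "nsin (3 * \<alpha> + \<beta>) = b * (2 * a + b) / c\<^sup>2"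
    by (fact v1 v3 v4 v5 v6 v7 v9)+
qed

lemma nsin_area: "dist A B * dist C A * nsin (angle_at C A B) = real (card T) * a * b"
proof -
  have "dist A B * dist C A * nsin (angle_at C A B) = (dist A B * dist A C * sin (angle_at C A B)) * 2 / sqrt 3"
    by (simp add: nsin_def dist_commute)
  thus ?thesis unfolding area by simp
qed

lemma side_positive: "0 < dist A B" "0 < dist B C" "0 < dist C A"
  using orient_ABC by auto

lemma sines:
  "dist A B * dist C A * nsin (angle_at C A B) = real (card T) * a * b"
  "dist B C * dist A B * nsin (angle_at A B C) = real (card T) * a * b"
  "dist C A * dist B C * nsin (angle_at B C A) = real (card T) * a * b"
  "dist B C * nsin (angle_at A B C) = dist C A * nsin (angle_at C A B)"
  "dist B C * nsin (angle_at B C A) = dist A B * nsin (angle_at C A B)"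
proof -
  show s: "dist A B * dist C A * nsin (angle_at C A B) = real (card T) * a * b"
    "dist B C * dist A B * nsin (angle_at A B C) = real (card T) * a * b"
    "dist C A * dist B C * nsin (angle_at B C A) = real (card T) * a * b"
    by (rule nsin_area, rule tile_cover.nsin_area[OF tile_cover_rotate],
      rule tile_cover.nsin_area[OF tile_cover.tile_cover_rotate[OF tile_cover_rotate]])
  have "dist A B * (dist B C * nsin (angle_at A B C)) = dist A B * (dist C A * nsin (angle_at C A B))"
    using s(1,2) by (simp add: mult_ac)
  thus "dist B C * nsin (angle_at A B C) = dist C A * nsin (angle_at C A B)"
    using side_positive by simp
  have "dist C A * (dist B C * nsin (angle_at B C A)) = dist C A * (dist A B * nsin (angle_at C A B))"
    using s(1,3) by (simp add: mult_ac)
  thus "dist B C * nsin (angle_at B C A) = dist A B * nsin (angle_at C A B)"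
    using side_positive by simp
qed

end

section \<open>The possible corner types\<close>

lemma (in tile_cover) only_c_of_counts:
  assumes "edges_on T A B (fst \<circ> snd) (snd \<circ> snd) = 0" "edges_on T A B (snd \<circ> snd) fst = 0"
  shows "only_c T A B"
proof -
  have "{t \<in> T. aligned A B (fst (snd t)) (snd (snd t))} = {}" "{t \<in> T. aligned A B (snd (snd t)) (fst t)} = {}"
    using assms finite_T by (auto simp: edges_on_def)
  thus ?thesis by (auto simp: only_c_def)
qed

context tile_cover
begin

lemma corner_angles:
  assumes "corners T A B C pA qA pB qB pC qC"
  shows "angle_at C A B = real pA * \<alpha> + real qA * \<beta>" "angle_at A B C = real pB * \<alpha> + real qB * \<beta>"
    "angle_at B C A = real pC * \<alpha> + real qC * \<beta>"
  using assms unfolding corner_angle corner_angle_B corner_angle_C corners_def by simp_all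

lemma relations:
  assumes "corners T A B C pA qA pB qB pC qC"
  obtains \<rho> \<rho>' where "\<rho> \<in> \<rat>" "\<rho>' \<in> \<rat>"
    "dist A B - (-1) ^ qB * dist B C - (-1) ^ qA * dist C A = \<rho> * (c + a - b)"
    "dist A B - (-1) ^ pB * dist B C - (-1) ^ pA * dist C A = \<rho>' * (c - a + b)"
proof -
  have g: "at_gamma T A = 0" "at_gamma T B = 0" and n: "at_alpha T A = pA" "at_beta T A = qA"
      "at_alpha T B = pB" "at_beta T B = qB"
    using assms by (simp_all add: corners_def)
  show ?thesis
    by (rule relation_beta[OF g], rule relation_alpha[OF g]) (simp only: n that)
qed

lemma shape_3al_be_2be:
  assumes "corners T A B C 3 0 0 1 0 2"
  shows "commensurable a b c"
proof -
  note pos = trig(1-3) and cl = trig(4)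
  define X Y Z where "X = dist B C" and "Y = dist C A" and "Z = dist A B"
  have XYZ: "0 < X" "0 < Y" "0 < Z" using side_positive by (simp_all add: X_def Y_def Z_def)
  have ang: "angle_at C A B = 3 * \<alpha>" "angle_at A B C = \<beta>" "angle_at B C A = 2 * \<beta>"
    using corner_angles[OF assms] by simp_all
  note s = sines[unfolded ang nsin_values, folded X_def Y_def Z_def]
  obtain \<rho> \<rho>' where r: "\<rho> \<in> \<rat>" "\<rho>' \<in> \<rat>" "Z + X - Y = \<rho> * (c + a - b)" "Z - X + Y = \<rho>' * (c - a + b)"
    using relations[OF assms] unfolding X_def Y_def Z_def by (auto simp: eval_nat_numeral)
  \<comment> \<open>The law of sines reads X : Y : Z = 3a(a + b) : \<open>c\<^sup>2\<close> : c(2a +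
    b), and k is the common factor.\<close>
  define k where "k = Y / c\<^sup>2"
  have k: "k \<noteq> 0" "Y = k * c\<^sup>2" using XYZ pos by (simp_all add: k_def)
  have "b * c\<^sup>2 * X = b * c\<^sup>2 * (k * (3 * a * (a + b)))"
    using s(4) pos unfolding k(2) by (simp add: field_simps power2_eq_square power3_eq_cube)
  hence X: "X = k * (3 * a * (a + b))" using pos by simp
  have "b * Y * (2 * a + b) * X = b * c * Z * X"
    using s(2,3) pos by (simp add: field_simps power2_eq_square)
  hence "Y * (2 * a + b) = c * Z" using pos XYZ by simp
  hence "c * Z = Y * (2 * a + b)" by simp
  also have "\<dots> = c * (k * (c * (2 * a + b)))" unfolding k(2) by (simp add: power2_eq_square mult_ac)
  finally have "c * Z = c * (k * (c * (2 * a + b)))" .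
  hence Z: "Z = k * (c * (2 * a + b))" using pos by simp
  have "a * b * c\<^sup>2 * (3 * k\<^sup>2 * (a + b) * (2 * a + b)) = a * b * c\<^sup>2 * real (card T)"
    using s(3) pos unfolding X k(2) by (simp add: field_simps power2_eq_square)
  hence N: "3 * k\<^sup>2 * (a + b) * (2 * a + b) = real (card T)" using pos by simp
  show ?thesis
  proof (rule commensurable_3al_be_2be[OF pos cl k(1) r(1,2)])
    show "real (card T) \<in> \<rat>" by simp
    show "k * (3 * a * (a + b)) + k * (c * (2 * a + b)) - k * c\<^sup>2 = \<rho> * (c + a - b)"
      using r(3) X Z k(2) by simp
    show "k * (c * (2 * a + b)) - k * (3 * a * (a + b)) + k * c\<^sup>2 = \<rho>' * (c - a + b)"
      using r(4) X Z k(2) by simp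
  qed (rule N)
qed

lemma shape_isosceles:
  assumes "corners T A B C 3 1 0 1 0 1"
  shows "commensurable a b c"
proof -
  note pos = trig(1-3) and cl = trig(4)
  define X Y Z where "X = dist B C" and "Y = dist C A" and "Z = dist A B"
  have XYZ: "0 < X" "0 < Y" "0 < Z" using side_positive by (simp_all add: X_def Y_def Z_def)
  have ang: "angle_at C A B = 3 * \<alpha> + \<beta>" "angle_at A B C = \<beta>" "angle_at B C A = \<beta>"
    using corner_angles[OF assms] by simp_all
  note s = sines[unfolded ang nsin_values, folded X_def Y_def Z_def]
  obtain \<rho> \<rho>' where r: "\<rho> \<in> \<rat>" "\<rho>' \<in> \<rat>" "Z + X + Y = \<rho> * (c + a - b)" "Z - X + Y = \<rho>' * (c - a + b)"
    using relations[OF assms] unfolding X_def Y_def Z_def by (auto simp: eval_nat_numeral)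
  \<comment> \<open>Here X : Y : Z = (2a + b) : c : c.\<close>
  define k where "k = Y / c"
  have k: "k \<noteq> 0" "Y = k * c" using XYZ pos by (simp_all add: k_def)
  have "b * c * X = b * c * (k * (2 * a + b))"
    using s(4) pos unfolding k(2) by (simp add: field_simps power2_eq_square)
  hence X: "X = k * (2 * a + b)" using pos by simp
  have "Z * (X * (b / c)) = Y * (X * (b / c))"
    using s(2,3) by (simp add: mult_ac)
  hence "Z = Y" using pos XYZ by simp
  hence Z: "Z = k * c" using k(2) by simp
  have "b * c * (k\<^sup>2 * (2 * a + b)) = b * c * (real (card T) * a)"
    using s(3) pos unfolding X k(2) by (simp add: field_simps power2_eq_square)
  hence "k\<^sup>2 * (2 * a + b) = real (card T) * a" using pos by simp
  hence N: "k\<^sup>2 * (2 * a + b) / a = real (card T)" using pos by simp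
  show ?thesis
  proof (rule commensurable_isosceles[OF pos cl k(1) r(1,2)])
    show "real (card T) \<in> \<rat>" by simp
    show "k * c + k * (2 * a + b) + k * c = \<rho> * (c + a - b)"
      using r(3) X Z k(2) by simp
    show "k * c - k * (2 * a + b) + k * c = \<rho>' * (c - a + b)"
      using r(4) X Z k(2) by simp
  qed (rule N)
qed

lemma shape_2al_al2be_be:
  assumes "corners T A B C 2 0 1 2 0 1"
  shows "commensurable a b c"
proof -
  note pos = trig(1-3) and cl = trig(4)
  define X Y Z where "X = dist B C" and "Y = dist C A" and "Z = dist A B"
  have XYZ: "0 < X" "0 < Y" "0 < Z" using side_positive by (simp_all add: X_def Y_def Z_def)
  have ang: "angle_at C A B = 2 * \<alpha>" "angle_at A B C = \<alpha> + 2 * \<beta>" "angle_at B C A = \<beta>"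
    using corner_angles[OF assms] by simp_all
  note s = sines[unfolded ang nsin_values, folded X_def Y_def Z_def]
  obtain \<rho> \<rho>' where r: "\<rho> \<in> \<rat>" "\<rho>' \<in> \<rat>" "Z - X - Y = \<rho> * (c + a - b)" "Z + X - Y = \<rho>' * (c - a + b)"
    using relations[OF assms] unfolding X_def Y_def Z_def by (auto simp: eval_nat_numeral)
  \<comment> \<open>Here X : Y : Z = a(a + 2b) : c(a + b) : bc.\<close>
  define k where "k = Z / (b * c)"
  have k: "k \<noteq> 0" "Z = k * (b * c)" using XYZ pos by (simp_all add: k_def)
  have "b * c * X = b * c * (k * (a * (a + 2 * b)))"
    using s(5) pos unfolding k(2) by (simp add: field_simps power2_eq_square)
  hence X: "X = k * (a * (a + 2 * b))" using pos by simp
  have "b * Y * X = (a + b) * Z * X"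
    using s(2,3) pos by (simp add: field_simps power2_eq_square)
  hence "b * Y = b * (k * (c * (a + b)))" using pos XYZ k(2) by (simp add: mult_ac)
  hence Y: "Y = k * (c * (a + b))" using pos by simp
  have "a * b * c * (k\<^sup>2 * (a + 2 * b) * (a + b)) = a * b * c * real (card T)"
    using s(3) pos unfolding X Y by (simp add: field_simps power2_eq_square)
  hence N: "k\<^sup>2 * (a + 2 * b) * (a + b) = real (card T)" using pos by simp
  show ?thesis
  \<comment> \<open>The first relation is about Z - X - Y, the arithmetic lemma about its
    negative.\<close>
  proof (rule commensurable_2al_al2be_be[OF pos cl k(1), of "- \<rho>" \<rho>'])
    show "- \<rho> \<in> \<rat>" "\<rho>' \<in> \<rat>" "real (card T) \<in> \<rat>" using r by simp_all
    show "k * (a * (a + 2 * b)) + k * (c * (a + b)) - k * (b * c) = - \<rho> * (c + a - b)"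
      using r(3) X Y k(2) by simp
    show "k * (b * c) + k * (a * (a + 2 * b)) - k * (c * (a + b)) = \<rho>' * (c - a + b)"
      using r(4) X Y k(2) by simp
  qed (rule N)
qed

text \<open>Here b/c is rational and a/c is not, so comparing coefficients in the edge count of the
  side shows that q counts its a-edges. What remains is a sum of nonnegative lengths equal to
  0.\<close>

lemma only_a_edges:
  assumes ac: "a / c \<notin> \<rat>" and m: "m \<noteq> 0" "m * b \<in> \<rat>" "m * c \<in> \<rat>" and q: "dist A B = q * a" "q \<in> \<rat>"
  shows "(p, q', r) \<in> T \<Longrightarrow> \<not> aligned A B r p \<and> \<not> aligned A B p q'"
proof -
  let ?na = "edges_on T A B (fst \<circ> snd) (snd \<circ> snd)" and ?nb = "edges_on T A B (snd \<circ> snd) fst"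
    and ?nc = "edges_on T A B fst (fst \<circ> snd)"
  have e: "q * a = real ?na * a + real ?nb * b + real ?nc * c" using side_AB q by simp
  have bc: "b / c \<in> \<rat>"
  proof -
    have "b / c = (m * b) / (m * c)" using m by simp
    thus ?thesis using m Rats_divide by metis
  qed
  have "q = real ?na"
  proof (rule ccontr)
    assume "q \<noteq> real ?na"
    hence nz: "q - real ?na \<noteq> 0" by simp
    have "(q - real ?na) * (a / c) = real ?nb * (b / c) + real ?nc"
      using e trig(3) by (simp add: field_simps)
    hence "a / c = (real ?nb * (b / c) + real ?nc) / (q - real ?na)"
      using nz by (metis nonzero_mult_div_cancel_left)
    also have "\<dots> \<in> \<rat>" by (intro Rats_divide Rats_add Rats_mult Rats_diff bc q(2)) simp_all
    finally show False using ac by simp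
  qed
  hence s: "real ?nb * b + real ?nc * c = 0" using e by simp
  have "0 \<le> real ?nb * b" "0 \<le> real ?nc * c" using trig(1-3) by simp_all
  hence "real ?nb * b = 0" "real ?nc * c = 0" using s by linarith+
  hence "?nb = 0" "?nc = 0" using trig(1-3) by simp_all
  hence E: "{t \<in> T. aligned A B (snd (snd t)) (fst t)} = {}" "{t \<in> T. aligned A B (fst t) (fst (snd t))} = {}"
    using finite_T by (auto simp: edges_on_def)
  show "(p, q', r) \<in> T \<Longrightarrow> \<not> aligned A B r p \<and> \<not> aligned A B p q'"
    using E by fastforce
qed

text \<open>Two sides that carry only \<open>a\<close>-edges need two tiles with angle \<open>\<beta>\<close> or \<open>\<gamma>\<close> at their common vertex.\<close>

lemma only_a_edges_corner:
  assumes A: "at_gamma T A = 0" "at_beta T A = 1"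
    and e: "\<And>p q r. (p, q, r) \<in> T \<Longrightarrow> \<not> aligned A B r p \<and> \<not> aligned A B p q"
      "\<And>p q r. (p, q, r) \<in> T \<Longrightarrow> \<not> aligned A C r p \<and> \<not> aligned A C p q"
  shows False
proof -
  have gam: "r \<noteq> A" if "(p, q, r) \<in> T" for p q r
    using A(1) that finite_T by (auto simp: at_gamma_def)
  have beta: "\<exists>p q r. (p, q, r) \<in> T \<and> q = A \<and> orient A V r = 0"
    if "\<exists>t\<in>T. corner_ex A (\<lambda>q r. orient A V q = 0 \<or> orient A V r = 0) t"
      and "\<And>p q r. (p, q, r) \<in> T \<Longrightarrow> \<not> aligned A V r p \<and> \<not> aligned A V p q" for V
  proof -
    from that(1) obtain p q r where t: "(p, q, r) \<in> T"
      "corner_ex A (\<lambda>q r. orient A V q = 0 \<or> orient A V r = 0) (p, q, r)" by auto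
    from that(2)[OF t(1)] gam[OF t(1)] t(2) have "q = A \<and> orient A V r = 0"
      by (auto simp: aligned_def)
    thus ?thesis using t(1) by blast
  qed
  obtain p q r where t: "(p, q, r) \<in> T" "q = A" "orient A B r = 0"
    using beta[OF tiled_corner(2)[OF cov] e(1)] by blast
  obtain p' q' r' where t': "(p', q', r') \<in> T" "q' = A" "orient A C r' = 0"
    using beta[OF tiled_corner(3)[OF cov] e(2)] by blast
  \<comment> \<open>Only one tile has its angle \<beta> at A, so the tiles found along A B and A C
    coincide, and r would lie on both lines.\<close>
  have "card {t \<in> T. fst (snd t) = A} = 1" using A(2) by (simp add: at_beta_def)
  then obtain t0 where "{t \<in> T. fst (snd t) = A} = {t0}" by (auto simp: card_1_singleton_iff)
  moreover have "(p, q, r) \<in> {t \<in> T. fst (snd t) = A}" "(p', q', r') \<in> {t \<in> T. fst (snd t) = A}"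
    using t t' by simp_all
  ultimately have "(p, q, r) = t0" "(p', q', r') = t0" by (simp_all only: singleton_iff)
  hence "(p, q, r) = (p', q', r')" by simp
  hence "orient A C r = 0" using t' by simp
  have AB: "A \<noteq> B" using orient_ABC by auto
  define s where "s = Re ((r - A) / (B - A))"
  have rs: "r = A + of_real s * (B - A)" unfolding s_def using AB t(3) by (rule orient_zero_point)
  have "orient A C (A + of_real s * (B - A)) = - s * orient A B C"
    by (simp add: orient_def algebra_simps)
  hence "s = 0" using \<open>orient A C r = 0\<close> rs orient_ABC by simp
  hence "r = A" using rs by simp
  thus False using gam[OF t(1)] by simp
qed

lemma shape_2albe_albe_be:
  assumes "corners T A B C 2 1 1 1 0 1"
  shows "commensurable a b c"
proof -
  note pos = trig(1-3) and cl = trig(4)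
  define X Y Z where "X = dist B C" and "Y = dist C A" and "Z = dist A B"
  have XYZ: "0 < X" "0 < Y" "0 < Z" using side_positive by (simp_all add: X_def Y_def Z_def)
  have ang: "angle_at C A B = 2 * \<alpha> + \<beta>" "angle_at A B C = \<alpha> + \<beta>" "angle_at B C A = \<beta>"
    using corner_angles[OF assms] by simp_all
  note s = sines[unfolded ang nsin_values, folded X_def Y_def Z_def]
  obtain \<rho> \<rho>' where r: "\<rho> \<in> \<rat>" "\<rho>' \<in> \<rat>" "Z + X + Y = \<rho> * (c + a - b)" "Z + X - Y = \<rho>' * (c - a + b)"
    using relations[OF assms] unfolding X_def Y_def Z_def by (auto simp: eval_nat_numeral)
  \<comment> \<open>Here X : Y : Z = (a + b) : c : b.\<close>
  define k where "k = Y / c"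
  have k: "k \<noteq> 0" "Y = k * c" using XYZ pos by (simp_all add: k_def)
  have "c * X = c * (k * (a + b))" using s(4) pos unfolding k(2) by (simp add: field_simps)
  hence X: "X = k * (a + b)" using pos by simp
  have "Z * X = (Y * (b / c)) * X"
    using s(2,3) by (simp add: mult_ac)
  hence "Z = Y * (b / c)" using XYZ mult_right_cancel[of X Z] by blast
  hence Z: "Z = k * b" using pos unfolding k(2) by simp
  obtain m where m: "m \<noteq> 0" "k = m * a" "m * b \<in> \<rat>" "m * c \<in> \<rat>"
  proof (rule rational_2albe_albe_be[OF pos cl k(1) r(1,2)])
    show "k * b + k * (a + b) + k * c = \<rho> * (c + a - b)" using r(3) X Z k(2) by simp
    show "k * b + k * (a + b) - k * c = \<rho>' * (c - a + b)" using r(4) X Z k(2) by simp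
  qed blast
  have "a / c \<in> \<rat>"
  proof (rule ccontr)
    \<comment> \<open>Both sides at A are now rational multiples of a and so carry a-edges only,
      although a single \<beta> lies at A.\<close>
    assume ac: "a / c \<notin> \<rat>"
    have Z': "dist A B = (m * b) * a" using Z m(2) by (simp add: Z_def mult_ac)
    have Y': "dist A C = (m * c) * a" using k(2) m(2) by (simp add: Y_def dist_commute mult_ac)
    interpret AC: tile_cover T a b c \<alpha> \<beta> A C B
      by (rule tile_cover.tile_cover_swap[OF tile_cover.tile_cover_rotate[OF tile_cover_rotate]])
    show False
    proof (rule only_a_edges_corner)
      show "at_gamma T A = 0" "at_beta T A = 1" using assms by (simp_all add: corners_def)
      show "(p, q, r) \<in> T \<Longrightarrow> \<not> aligned A B r p \<and> \<not> aligned A B p q" for p q r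
        by (rule only_a_edges[OF ac m(1,3,4) Z' m(3)])
      show "(p, q, r) \<in> T \<Longrightarrow> \<not> aligned A C r p \<and> \<not> aligned A C p q" for p q r
        by (rule AC.only_a_edges[OF ac m(1,3,4) Y' m(4)])
    qed
  qed
  moreover have "b / c \<in> \<rat>"
  proof -
    have "b / c = (m * b) / (m * c)" using m by simp
    thus ?thesis using m Rats_divide by metis
  qed
  moreover have "a / b = (a / c) / (b / c)" using pos by simp
  ultimately show ?thesis unfolding commensurable_def by (metis Rats_divide)
qed

lemma side_rational_only_c:
  assumes "\<not> commensurable a b c" "\<kappa> \<in> \<rat>" "a - b = \<kappa> * c" "dist A B / c \<in> \<rat>"
  shows "only_c T A B"
proof (rule only_c_of_counts)
  note oc = only_c_edges[OF trig(1-4) assms(1-3) assms(4)[unfolded side_AB]]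
  show "edges_on T A B (fst \<circ> snd) (snd \<circ> snd) = 0" "edges_on T A B (snd \<circ> snd) fst = 0"
    using oc by blast+
qed

text \<open>Every corner has one \<alpha> and one \<beta>, so both relations have three times the
  side on the left, and \<open>rational_difference\<close> applies.\<close>

lemma shape_equilateral:
  assumes "corners T A B C 1 1 1 1 1 1"
  shows "commensurable a b c \<or>
    only_c T A B \<and> only_c T B C \<and> only_c T C A \<and> equilateral (A, B, C)"
proof -
  note pos = trig(1-3) and cl = trig(4)
  have ang: "angle_at C A B = \<alpha> + \<beta>" "angle_at A B C = \<alpha> + \<beta>" "angle_at B C A = \<alpha> + \<beta>"
    using corner_angles[OF assms] by simp_all
  note s = sines[unfolded ang nsin_values]
  have eq: "dist B C = dist A B" "dist C A = dist A B" using s(4,5) by simp_all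
  obtain \<rho> \<rho>' where rr: "\<rho> \<in> \<rat>" "\<rho>' \<in> \<rat>"
    "dist A B - (-1) ^ 1 * dist B C - (-1) ^ 1 * dist C A = \<rho> * (c + a - b)"
    "dist A B - (-1) ^ 1 * dist B C - (-1) ^ 1 * dist C A = \<rho>' * (c - a + b)"
    by (rule relations[OF assms])
  have r: "\<rho> \<in> \<rat>" "\<rho>' \<in> \<rat>" "3 * dist A B = \<rho> * (c + a - b)" "3 * dist A B = \<rho>' * (c - a + b)"
    using rr eq by simp_all
  have "3 * dist A B \<noteq> 0" using side_positive by simp
  then obtain \<kappa> where \<kappa>: "\<kappa> \<in> \<rat>" "a - b = \<kappa> * c" "3 * dist A B / c \<in> \<rat>"
    using rational_difference[OF pos cl _ r] by blast
  have AB: "dist A B / c \<in> \<rat>" using Rats_divide[OF \<kappa>(3), of 3] by simp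
  show ?thesis
  proof (cases "commensurable a b c")
    case False
    interpret BC: tile_cover T a b c \<alpha> \<beta> B C A by (rule tile_cover_rotate)
    interpret CA: tile_cover T a b c \<alpha> \<beta> C A B by (rule BC.tile_cover_rotate)
    show ?thesis
      using side_rational_only_c[OF False \<kappa>(1,2) AB] BC.side_rational_only_c[OF False \<kappa>(1,2)]
        CA.side_rational_only_c[OF False \<kappa>(1,2)] AB eq by simp
  qed simp
qed

text \<open>The numbers of \<alpha> and of \<beta> at A and B are even, so both relations concern Z
  - X - Y and \<open>rational_difference\<close> applies again.\<close>

lemma shape_2al_2be_albe:
  assumes "corners T A B C 2 0 0 2 1 1"
  shows "commensurable a b c \<or>
    only_c T A B \<and> only_c T B C \<and> only_c T C A \<and> angles (A, B, C) = {# pi / 3, 2 * \<alpha>, 2 * \<beta> #}"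
proof -
  note pos = trig(1-3) and cl = trig(4)
  have ang: "angle_at C A B = 2 * \<alpha>" "angle_at A B C = 2 * \<beta>" "angle_at B C A = \<alpha> + \<beta>"
    using corner_angles[OF assms] by simp_all
  define X Y Z where "X = dist B C" and "Y = dist C A" and "Z = dist A B"
  have XYZ: "0 < X" "0 < Y" "0 < Z" using side_positive by (simp_all add: X_def Y_def Z_def)
  note s = sines[unfolded ang nsin_values, folded X_def Y_def Z_def]
  obtain \<rho> \<rho>' where rr: "\<rho> \<in> \<rat>" "\<rho>' \<in> \<rat>"
    "Z - (-1) ^ 2 * X - (-1) ^ 0 * Y = \<rho> * (c + a - b)" "Z - (-1) ^ 0 * X - (-1) ^ 2 * Y = \<rho>' * (c - a + b)"
    unfolding X_def Y_def Z_def by (rule relations[OF assms])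
  have r: "\<rho> \<in> \<rat>" "\<rho>' \<in> \<rat>" "Z - X - Y = \<rho> * (c + a - b)" "Z - X - Y = \<rho>' * (c - a + b)"
    using rr by simp_all
  \<comment> \<open>Here X : Y : Z = a(a + 2b) : b(2a + b) : \<open>c\<^sup>2\<close>.\<close>
  define k where "k = Z / c\<^sup>2"
  have k: "k \<noteq> 0" "Z = k * c\<^sup>2" using XYZ pos by (simp_all add: k_def)
  have X: "X = k * (a * (a + 2 * b))" using s(5) pos unfolding k(2) by simp
  have "Y * X = (Z * (b * (2 * a + b) / c\<^sup>2)) * X"
    using s(2,3) by (simp add: mult_ac)
  hence "Y = Z * (b * (2 * a + b) / c\<^sup>2)" using XYZ mult_right_cancel[of X Y] by blast
  hence Y: "Y = k * (b * (2 * a + b))" using pos unfolding k(2) by simp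
  have x: "Z - X - Y = - (3 * k * (a * b))"
    unfolding X Y k(2) cl by (simp add: power2_eq_square algebra_simps)
  hence "Z - X - Y \<noteq> 0" using pos k by simp
  then obtain \<kappa> where \<kappa>: "\<kappa> \<in> \<rat>" "a - b = \<kappa> * c" "(Z - X - Y) / c \<in> \<rat>"
    using rational_difference[OF pos cl _ r] by blast
  \<comment> \<open>This turns Z - X - Y = -3kab into a rational multiple of Z, whence Z/c is
    rational.\<close>
  have ab: "3 * (a * b) = (1 - \<kappa>\<^sup>2) * c\<^sup>2"
  proof -
    have "3 * (a * b) = c\<^sup>2 - (a - b)\<^sup>2" unfolding cl by (simp add: power2_eq_square algebra_simps)
    thus ?thesis unfolding \<kappa>(2) by (simp add: power2_eq_square algebra_simps)
  qed
  have \<kappa>1: "1 - \<kappa>\<^sup>2 \<noteq> 0" using ab pos by auto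
  have "Z - X - Y = - (k * (3 * (a * b)))" unfolding x by simp
  also have "\<dots> = - ((1 - \<kappa>\<^sup>2) * Z)" unfolding ab k(2) by simp
  finally have "Z / c = - ((Z - X - Y) / c) / (1 - \<kappa>\<^sup>2)" using \<kappa>1 pos by simp
  also have "\<dots> \<in> \<rat>" using \<kappa>(1,3) by (intro Rats_divide) auto
  finally have Zc: "Z / c \<in> \<rat>" .
  have "(X + Y) / c = Z / c - (Z - X - Y) / c" by (simp add: diff_divide_distrib add_divide_distrib)
  also have "\<dots> \<in> \<rat>" using Zc \<kappa>(3) by (rule Rats_diff)
  finally have XYc: "(X + Y) / c \<in> \<rat>" .
  interpret BC: tile_cover T a b c \<alpha> \<beta> B C A by (rule tile_cover_rotate)
  interpret CA: tile_cover T a b c \<alpha> \<beta> C A B by (rule BC.tile_cover_rotate)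
  have an: "angles (A, B, C) = {# pi / 3, 2 * \<alpha>, 2 * \<beta> #}"
    using ang trig(7) by (simp add: add_mset_commute)
  show ?thesis
  proof (cases "commensurable a b c")
    case False
    \<comment> \<open>Only the sum X + Y is known to be a rational multiple of c, so the edges of
      the two sides are counted together.\<close>
    let ?n = "\<lambda>x y. edges_on T x y (fst \<circ> snd) (snd \<circ> snd)" and ?m = "\<lambda>x y. edges_on T x y (snd \<circ> snd) fst"
      and ?l = "\<lambda>x y. edges_on T x y fst (fst \<circ> snd)"
    have "X + Y = real (?n B C + ?n C A) * a + real (?m B C + ?m C A) * b + real (?l B C + ?l C A) * c"
      unfolding X_def Y_def BC.side_AB CA.side_AB by (simp add: algebra_simps)
    hence "?n B C + ?n C A = 0" "?m B C + ?m C A = 0"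
      using only_c_edges[OF pos cl False \<kappa>(1,2)] XYc by metis+
    hence "only_c T B C" "only_c T C A"
      using BC.only_c_of_counts CA.only_c_of_counts by simp_all
    thus ?thesis using side_rational_only_c[OF False \<kappa>(1,2)] Zc an by (simp add: Z_def)
  qed simp
qed

end

section \<open>Conclusion\<close>

definition outcome :: "triangle set \<Rightarrow> real \<Rightarrow> real \<Rightarrow> real \<Rightarrow> real \<Rightarrow> real \<Rightarrow> complex \<Rightarrow> complex \<Rightarrow> complex \<Rightarrow> bool" where
  "outcome T a b c \<alpha> \<beta> A B C \<longleftrightarrow> commensurable a b c \<or>
     only_c T A B \<and> only_c T B C \<and> only_c T C A \<and>
     (equilateral (A, B, C) \<or> angles (A, B, C) = {# pi / 3, 2 * \<alpha>, 2 * \<beta> #})"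

lemma aligned_swap: "aligned B A x y = aligned A B x y"
  unfolding aligned_def orient_swap[of B A x] orient_swap[of B A y] by simp

lemma aligned_commute: "aligned A B y x = aligned A B x y"
  by (auto simp: aligned_def)

lemma only_c_commute: "only_c T B A = only_c T A B"
  by (simp add: only_c_def aligned_swap[of B A])

lemma outcome_rotate:
  assumes "outcome T a b c \<alpha> \<beta> B C A"
  shows "outcome T a b c \<alpha> \<beta> A B C"
proof -
  have "angles (A, B, C) = angles (B, C, A)" by (simp add: add_mset_commute)
  moreover have "equilateral (A, B, C) = equilateral (B, C, A)" by auto
  ultimately show ?thesis using assms unfolding outcome_def by metis
qed

lemma outcome_swap:
  assumes "outcome T a b c \<alpha> \<beta> B A C"
  shows "outcome T a b c \<alpha> \<beta> A B C"
proof -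
  have "angles (A, B, C) = angles (B, A, C)"
    using angle_at_commute[of C A B] angle_at_commute[of A B C] angle_at_commute[of B C A]
    by (simp add: add_mset_commute)
  moreover have "equilateral (A, B, C) = equilateral (B, A, C)" by (auto simp: dist_commute)
  ultimately show ?thesis
    using assms only_c_commute[of T A B] only_c_commute[of T A C] only_c_commute[of T B C]
    unfolding outcome_def by metis
qed

lemma only_c_swap_labels: "only_c (swap_labels ` T) A B = only_c T A B"
proof -
  have "(\<forall>t\<in>swap_labels ` T. case t of (p, q, r) \<Rightarrow> \<not> aligned A B q r \<and> \<not> aligned A B r p) \<longleftrightarrow>
    (\<forall>t\<in>T. case t of (p, q, r) \<Rightarrow> \<not> aligned A B q r \<and> \<not> aligned A B r p)"
    unfolding ball_simps(9) image_iff
    by (intro ball_cong refl) (auto simp: aligned_commute)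
  thus ?thesis by (simp only: only_c_def)
qed

lemma outcome_relabel:
  assumes "outcome (swap_labels ` T) b a c \<beta> \<alpha> A B C"
  shows "outcome T a b c \<alpha> \<beta> A B C"
proof -
  have "{# pi / 3, 2 * \<beta>, 2 * \<alpha> #} = {# pi / 3, 2 * \<alpha>, 2 * \<beta> #}" by (simp add: add_mset_commute)
  thus ?thesis using assms commensurable_swap[of b a c] unfolding outcome_def only_c_swap_labels by auto
qed

text \<open>The pairs count the angles \<open>\<alpha>\<close> and \<open>\<beta>\<close> at the three corners.\<close>

definition shape :: "nat \<times> nat \<Rightarrow> nat \<times> nat \<Rightarrow> nat \<times> nat \<Rightarrow> bool" where
  "shape x y z \<longleftrightarrow> (x, y, z) \<in> {((3,0),(0,1),(0,2)), ((3,1),(0,1),(0,1)), ((2,0),(1,2),(0,1)),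
     ((2,1),(1,1),(0,1)), ((1,1),(1,1),(1,1)), ((2,0),(0,2),(1,1))}"

definition permuted_shape :: "nat \<times> nat \<Rightarrow> nat \<times> nat \<Rightarrow> nat \<times> nat \<Rightarrow> bool" where
  "permuted_shape x y z \<longleftrightarrow> shape x y z \<or> shape y z x \<or> shape z x y \<or> shape y x z \<or> shape x z y \<or> shape z y x"

text \<open>A single \<alpha> at one corner and a single \<beta> at another make ABC similar to the
  tile.\<close>

definition tile_corners :: "nat \<times> nat \<Rightarrow> nat \<times> nat \<Rightarrow> nat \<times> nat \<Rightarrow> bool" where
  "tile_corners x y z \<longleftrightarrow> (1, 0) \<in> {x, y, z} \<and> (0, 1) \<in> {x, y, z}"

text \<open>A finite check: two corners determine the third, and the bounds on the sums keep the
  natural subtraction from being truncated. The last disjunct exchanges \<alpha> and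
  \<beta>.\<close>

lemma shape_enumeration:
  "\<forall>p1\<in>set [0..<4]. \<forall>p2\<in>set [0..<4]. \<forall>q1\<in>set [0..<4]. \<forall>q2\<in>set [0..<4].
     let x = (p1, q1); y = (p2, q2); z = (3 - p1 - p2, 3 - q1 - q2) in
     p1 + p2 \<le> 3 \<longrightarrow> q1 + q2 \<le> 3 \<longrightarrow> x \<noteq> (0, 0) \<longrightarrow> y \<noteq> (0, 0) \<longrightarrow> z \<noteq> (0, 0) \<longrightarrow>
     tile_corners x y z \<or> permuted_shape x y z \<or>
     permuted_shape (prod.swap x) (prod.swap y) (prod.swap z)"
  unfolding tile_corners_def permuted_shape_def shape_def prod.swap_def
  by code_simp

lemma shape_cases:
  assumes "p1 + p2 + p3 = 3" "q1 + q2 + q3 = (3::nat)" "0 < p1 + q1" "0 < p2 + q2" "0 < p3 + q3"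
    and "\<not> tile_corners (p1, q1) (p2, q2) (p3, q3)"
  shows "permuted_shape (p1, q1) (p2, q2) (p3, q3) \<or> permuted_shape (q1, p1) (q2, p2) (q3, p3)"
proof -
  have e: "p3 = 3 - p1 - p2" "q3 = 3 - q1 - q2" using assms by simp_all
  have m: "p1 \<in> set [0..<4]" "p2 \<in> set [0..<4]" "q1 \<in> set [0..<4]" "q2 \<in> set [0..<4]"
    using assms by auto
  have n: "(p1, q1) \<noteq> (0, 0)" "(p2, q2) \<noteq> (0, 0)" "(p3, q3) \<noteq> (0, 0)" "p1 + p2 \<le> 3" "q1 + q2 \<le> 3"
    using assms by auto
  from shape_enumeration[rule_format, OF m, unfolded Let_def, folded e] n assms(6) show ?thesis
    unfolding prod.swap_def fst_conv snd_conv by blast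
qed

context tile_cover
begin

lemma outcome_if_shape:
  assumes g: "at_gamma T A = 0" "at_gamma T B = 0" "at_gamma T C = 0"
    and s: "shape (at_alpha T A, at_beta T A) (at_alpha T B, at_beta T B) (at_alpha T C, at_beta T C)"
  shows "outcome T a b c \<alpha> \<beta> A B C"
proof -
  have "corners T A B C (at_alpha T A) (at_beta T A) (at_alpha T B) (at_beta T B) (at_alpha T C) (at_beta T C)"
    using g by (simp add: corners_def)
  with s have "corners T A B C 3 0 0 1 0 2 \<or> corners T A B C 3 1 0 1 0 1 \<or> corners T A B C 2 0 1 2 0 1 \<or>
    corners T A B C 2 1 1 1 0 1 \<or> corners T A B C 1 1 1 1 1 1 \<or> corners T A B C 2 0 0 2 1 1"
    unfolding shape_def by auto
  thus ?thesis
  proof (elim disjE)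
    assume "corners T A B C 3 0 0 1 0 2"
    from shape_3al_be_2be[OF this] show ?thesis unfolding outcome_def by (rule disjI1)
  next
    assume "corners T A B C 3 1 0 1 0 1"
    from shape_isosceles[OF this] show ?thesis unfolding outcome_def by (rule disjI1)
  next
    assume "corners T A B C 2 0 1 2 0 1"
    from shape_2al_al2be_be[OF this] show ?thesis unfolding outcome_def by (rule disjI1)
  next
    assume "corners T A B C 2 1 1 1 0 1"
    from shape_2albe_albe_be[OF this] show ?thesis unfolding outcome_def by (rule disjI1)
  next
    assume "corners T A B C 1 1 1 1 1 1"
    from shape_equilateral[OF this] show ?thesis unfolding outcome_def by (elim disjE conjE) simp_all
  next
    assume "corners T A B C 2 0 0 2 1 1"
    from shape_2al_2be_albe[OF this] show ?thesis unfolding outcome_def by (elim disjE conjE) simp_all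
  qed
qed

lemma outcome_if_permuted_shape:
  assumes g: "at_gamma T A = 0" "at_gamma T B = 0" "at_gamma T C = 0"
    and s: "permuted_shape (at_alpha T A, at_beta T A) (at_alpha T B, at_beta T B) (at_alpha T C, at_beta T C)"
  shows "outcome T a b c \<alpha> \<beta> A B C"
proof -
  interpret BCA: tile_cover T a b c \<alpha> \<beta> B C A by (rule tile_cover_rotate)
  interpret CAB: tile_cover T a b c \<alpha> \<beta> C A B by (rule BCA.tile_cover_rotate)
  interpret BAC: tile_cover T a b c \<alpha> \<beta> B A C by (rule tile_cover_swap)
  interpret ACB: tile_cover T a b c \<alpha> \<beta> A C B by (rule BAC.tile_cover_rotate)
  interpret CBA: tile_cover T a b c \<alpha> \<beta> C B A by (rule ACB.tile_cover_rotate)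
  note o = outcome_if_shape[OF g] BCA.outcome_if_shape[OF g(2,3,1)] CAB.outcome_if_shape[OF g(3,1,2)]
    BAC.outcome_if_shape[OF g(2,1,3)] ACB.outcome_if_shape[OF g(1,3,2)] CBA.outcome_if_shape[OF g(3,2,1)]
  from s show ?thesis
    unfolding permuted_shape_def
  proof (elim disjE)
    assume "shape (at_alpha T A, at_beta T A) (at_alpha T B, at_beta T B) (at_alpha T C, at_beta T C)"
    thus ?thesis by (rule o(1))
  next
    assume "shape (at_alpha T B, at_beta T B) (at_alpha T C, at_beta T C) (at_alpha T A, at_beta T A)"
    from o(2)[OF this] show ?thesis by (rule outcome_rotate)
  next
    assume "shape (at_alpha T C, at_beta T C) (at_alpha T A, at_beta T A) (at_alpha T B, at_beta T B)"
    from o(3)[OF this] show ?thesis by (rule outcome_rotate[OF outcome_rotate])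
  next
    assume "shape (at_alpha T B, at_beta T B) (at_alpha T A, at_beta T A) (at_alpha T C, at_beta T C)"
    from o(4)[OF this] show ?thesis by (rule outcome_swap)
  next
    assume "shape (at_alpha T A, at_beta T A) (at_alpha T C, at_beta T C) (at_alpha T B, at_beta T B)"
    from o(5)[OF this] show ?thesis by (rule outcome_swap[OF outcome_rotate])
  next
    assume "shape (at_alpha T C, at_beta T C) (at_alpha T B, at_beta T B) (at_alpha T A, at_beta T A)"
    from o(6)[OF this] show ?thesis by (rule outcome_swap[OF outcome_rotate[OF outcome_rotate]])
  qed
qed

lemma similar_if_tile_corners:
  assumes t: "orient P Q R \<noteq> 0" "angle_at R P Q = \<alpha>" "angle_at P Q R = \<beta>"
    and c: "(at_alpha T A, at_beta T A) = (1, 0)" "(at_alpha T B, at_beta T B) = (0, 1)"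
    and g: "at_gamma T A = 0" "at_gamma T B = 0"
  shows "similar (P, Q, R) (A, B, C)"
proof (rule similar_if_angles[OF t(1) orient_ABC])
  show "angle_at R P Q = angle_at C A B" using c g unfolding t corner_angle by simp
  show "angle_at P Q R = angle_at A B C" using c g unfolding t corner_angle_B by simp
qed

end

text \<open>\<open>similar\<close> sees only the regions, so the vertices of ABC may be named in any
  order.\<close>

lemma similar_region_cong: "region t = region t' \<Longrightarrow> similar s t \<Longrightarrow> similar s t'"
  by (simp add: similar_def)

context tile_cover
begin

lemma dissimilar_corners:
  assumes t: "orient P Q R \<noteq> 0" "angle_at R P Q = \<alpha>" "angle_at P Q R = \<beta>"
    and n: "\<not> similar (P, Q, R) (A, B, C)"
    and xy: "x \<in> {A, B, C}" "y \<in> {A, B, C}"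
    and c: "(at_alpha T x, at_beta T x, at_gamma T x) = (1, 0, 0)" "(at_alpha T y, at_beta T y, at_gamma T y) = (0, 1, 0)"
  shows False
proof -
  have c': "(at_alpha T x, at_beta T x) = (1, 0)" "(at_alpha T y, at_beta T y) = (0, 1)"
    "at_gamma T x = 0" "at_gamma T y = 0" using c by simp_all
  have ne: "x \<noteq> y" using c by auto
  have "False" if "tile_cover T a b c \<alpha> \<beta> x y z" "region (x, y, z) = region (A, B, C)" for z
    using similar_region_cong[OF that(2) tile_cover.similar_if_tile_corners[OF that(1) t c']] n by simp
  note * = this
  interpret BCA: tile_cover T a b c \<alpha> \<beta> B C A by (rule tile_cover_rotate)
  interpret CAB: tile_cover T a b c \<alpha> \<beta> C A B by (rule BCA.tile_cover_rotate)
  consider "x = A" "y = B" | "x = B" "y = C" | "x = C" "y = A" | "x = B" "y = A" | "x = C" "y = B" | "x = A" "y = C"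
    using xy ne by auto
  thus False
  proof cases
    case 1 thus False using *[of C] tile_cover_axioms by (simp add: insert_commute)
  next
    case 2 thus False using *[of A] BCA.tile_cover_axioms by (simp add: insert_commute)
  next
    case 3 thus False using *[of B] CAB.tile_cover_axioms by (simp add: insert_commute)
  next
    case 4 thus False using *[of C] tile_cover_swap by (simp add: insert_commute)
  next
    case 5 thus False using *[of A] BCA.tile_cover_swap by (simp add: insert_commute)
  next
    case 6 thus False using *[of B] CAB.tile_cover_swap by (simp add: insert_commute)
  qed
qed

lemma outcome_if_dissimilar:
  assumes t: "orient P Q R \<noteq> 0" "angle_at R P Q = \<alpha>" "angle_at P Q R = \<beta>"
    and n: "\<not> similar (P, Q, R) (A, B, C)"
  shows "outcome T a b c \<alpha> \<beta> A B C"
proof -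
  note dis = dissimilar_corners[OF t n]
  interpret BCA: tile_cover T a b c \<alpha> \<beta> B C A by (rule tile_cover_rotate)
  interpret CAB: tile_cover T a b c \<alpha> \<beta> C A B by (rule BCA.tile_cover_rotate)
  define p1 p2 p3 where "p1 = at_alpha T A" and "p2 = at_alpha T B" and "p3 = at_alpha T C"
  define q1 q2 q3 where "q1 = at_beta T A" and "q2 = at_beta T B" and "q3 = at_beta T C"
  define g1 g2 g3 where "g1 = at_gamma T A" and "g2 = at_gamma T B" and "g3 = at_gamma T C"
  note defs = p1_def p2_def p3_def q1_def q2_def q3_def g1_def g2_def g3_def
  have tot: "p1 + p2 + p3 = q1 + q2 + q3" "q1 + q2 + q3 + 2 * (g1 + g2 + g3) = 3"
    using corner_totals unfolding defs by simp_all
  have pos: "0 < p1 + q1 + g1" "0 < p2 + q2 + g2" "0 < p3 + q3 + g3"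
    using corner_positive BCA.corner_positive CAB.corner_positive unfolding defs by simp_all
  have nt: "\<not> ((1, 0, 0) \<in> {(p1, q1, g1), (p2, q2, g2), (p3, q3, g3)} \<and>
      (0, 1, 0) \<in> {(p1, q1, g1), (p2, q2, g2), (p3, q3, g3)})"
  proof
    assume a: "(1, 0, 0) \<in> {(p1, q1, g1), (p2, q2, g2), (p3, q3, g3)} \<and>
      (0, 1, 0) \<in> {(p1, q1, g1), (p2, q2, g2), (p3, q3, g3)}"
    moreover have "{(p1, q1, g1), (p2, q2, g2), (p3, q3, g3)}
        = (\<lambda>v. (at_alpha T v, at_beta T v, at_gamma T v)) ` {A, B, C}"
      unfolding defs by simp
    ultimately obtain x y where x: "x \<in> {A, B, C}" "(1, 0, 0) = (at_alpha T x, at_beta T x, at_gamma T x)"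
      and y: "y \<in> {A, B, C}" "(0, 1, 0) = (at_alpha T y, at_beta T y, at_gamma T y)"
      by (metis (no_types, lifting) imageE)
    show False by (rule dis[OF x(1) y(1) x(2)[symmetric] y(2)[symmetric]])
  qed
  have g0: "g1 = 0" "g2 = 0" "g3 = 0"
  proof -
    \<comment> \<open>An angle 2\<pi>/3 leaves one \<alpha> and one \<beta>, hence a single angle at
      each corner, and ABC would be similar to the tile.\<close>
    have "g1 + g2 + g3 = 0"
    proof (rule ccontr)
      assume "g1 + g2 + g3 \<noteq> 0"
      moreover have "G = 1 \<and> q = 1" if "q + 2 * G = 3" "G \<noteq> 0" for q G :: nat
        using that by presburger
      ultimately have s: "g1 + g2 + g3 = 1" "q1 + q2 + q3 = 1" "p1 + p2 + p3 = 1"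
        using tot by metis+
      have one: "p1 + q1 + g1 = 1" "p2 + q2 + g2 = 1" "p3 + q3 + g3 = 1" using s pos by linarith+
      have k: "(p, q, g) = (1, 0, 0) \<or> (p, q, g) = (0, 1, 0) \<or> (p, q, g) = (0, 0, 1)"
        if "p + q + g = (1::nat)" for p q g
        using that by auto
      show False using k[OF one(1)] k[OF one(2)] k[OF one(3)] s nt by auto
    qed
    thus "g1 = 0" "g2 = 0" "g3 = 0" by simp_all
  qed
  hence three: "p1 + p2 + p3 = 3" "q1 + q2 + q3 = 3" using tot by simp_all
  have nt': "\<not> tile_corners (p1, q1) (p2, q2) (p3, q3)"
    using nt unfolding tile_corners_def g0 by auto
  have "permuted_shape (p1, q1) (p2, q2) (p3, q3) \<or> permuted_shape (q1, p1) (q2, p2) (q3, p3)"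
    by (rule shape_cases[OF three _ _ _ nt']) (use pos g0 in simp_all)
  thus ?thesis
  proof
    assume "permuted_shape (p1, q1) (p2, q2) (p3, q3)"
    thus ?thesis using outcome_if_permuted_shape g0 unfolding defs by blast
  next
    assume s: "permuted_shape (q1, p1) (q2, p2) (q3, p3)"
    interpret S: tile_cover "swap_labels ` T" b a c \<beta> \<alpha> A B C by (rule tile_cover_relabel)
    have "outcome (swap_labels ` T) b a c \<beta> \<alpha> A B C"
      by (rule S.outcome_if_permuted_shape)
        (use s g0 in \<open>simp_all only: at_alpha_swap at_beta_swap at_gamma_swap defs\<close>)
    thus ?thesis by (rule outcome_relabel)
  qed
qed

end

section \<open>Tiles on the boundary, and the theorem\<close>

lemma only_c_supported:
  assumes o: "only_c T A B" and t: "t \<in> T" and s: "supported_by t (closed_segment A B)"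
  shows "c_edge t \<subseteq> closed_segment A B"
proof -
  obtain p q r where pqr: "t = (p, q, r)" by (cases t)
  have z: "orient A B z = 0" if "z \<in> closed_segment A B" for z
  proof -
    from that obtain u where "z = (1 - u) *\<^sub>R A + u *\<^sub>R B" by (auto simp: in_segment)
    thus ?thesis using orient_convex[of "1 - u" u 0 A B A] by simp
  qed
  have no: "\<not> aligned A B q r" "\<not> aligned A B r p" using o t by (auto simp: only_c_def pqr)
  have "closed_segment p q \<subseteq> closed_segment A B \<or> closed_segment q r \<subseteq> closed_segment A B \<or>
    closed_segment r p \<subseteq> closed_segment A B"
    using s by (auto simp: supported_by_def edges_def pqr)
  thus ?thesis
    using z no ends_in_segment[of q r] ends_in_segment[of r p] by (auto simp: aligned_def pqr)
qed

theorem theorem3p7: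
  fixes P Q R A B C :: complex
    and T :: "triangle set"
    and a b c \<alpha> \<beta> :: real
  assumes tile: "nondegenerate (P, Q, R)"
    and sides: "a = dist Q R" "b = dist R P" "c = dist P Q"
    and tile_angles: "angle_at R P Q = \<alpha>" "angle_at P Q R = \<beta>" "angle_at Q R P = 2 * pi / 3"
    and noncommensurable_angles:
      "\<not> (\<alpha> / pi \<in> \<rat> \<and> \<beta> / pi \<in> \<rat> \<and> (2 * pi / 3) / pi \<in> \<rat>)"
    and ABC: "nondegenerate (A, B, C)"
    and tiling: "tiling (P, Q, R) T (A, B, C)"
    and not_similar: "\<not> similar (P, Q, R) (A, B, C)"
  shows "(a / b \<in> \<rat> \<and> b / c \<in> \<rat> \<and> a / c \<in> \<rat>) \<or>
    ((\<forall>t\<in>T. (\<exists>S\<in>edges (A, B, C). supported_by t S) \<longrightarrow>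
        c_edge t \<subseteq> frontier (region (A, B, C))) \<and>
     (equilateral (A, B, C) \<or> angles (A, B, C) = {# pi / 3, 2 * \<alpha>, 2 * \<beta> #}))"
proof -
  have o: "orient P Q R \<noteq> 0" using tile unfolding nondegenerate_iff by simp
  have "\<alpha> + \<beta> + 2 * pi / 3 = pi" using angle_sum[OF o] tile_angles by simp
  hence "\<beta> = 1 / 3 * pi - \<alpha>" by simp
  hence "\<beta> / pi = 1 / 3 - \<alpha> / pi" by (simp add: diff_divide_distrib)
  hence "\<beta> / pi \<in> \<rat>" if "\<alpha> / pi \<in> \<rat>" using that by simp
  \<comment> \<open>Since \<beta> = \<pi>/3 - \<alpha>, all angles would be commensurable as soon as
    \<alpha>/\<pi> is rational.\<close>
  hence irr: "\<alpha> / pi \<notin> \<rat>" using noncommensurable_angles by auto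
  interpret tile_cover T a b c \<alpha> \<beta> A B C
  proof
    show "tiled T (A, B, C)" by (rule tiling_imp_tiled[OF tiling tile ABC])
    show "\<alpha> / pi \<notin> \<rat>" by (rule irr)
    fix p q r assume "(p, q, r) \<in> T"
    hence "copy_of (P, Q, R) (p, q, r)" using tiling by (auto simp: tiling_def)
    from copy_of_dist[OF this] sides tile_angles
    show "dist p q = c \<and> dist q r = a \<and> dist r p = b \<and>
      angle_at r p q = \<alpha> \<and> angle_at p q r = \<beta> \<and> angle_at q r p = 2 * pi / 3"
      unfolding angle_at_dist by (simp add: dist_commute)
  qed
  have "outcome T a b c \<alpha> \<beta> A B C"
    by (rule outcome_if_dissimilar[OF o tile_angles(1,2) not_similar])
  thus ?thesis
    unfolding outcome_def commensurable_def
  proof (elim disjE[of "_ \<and> _ \<and> _"] conjE)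
    assume only: "only_c T A B" "only_c T B C" "only_c T C A"
      and s: "equilateral (A, B, C) \<or> angles (A, B, C) = {# pi / 3, 2 * \<alpha>, 2 * \<beta> #}"
    have fr: "frontier (region (A, B, C)) = closed_segment A B \<union> closed_segment B C \<union> closed_segment C A"
      unfolding region.simps by (rule frontier_of_triangle) simp
    have "c_edge t \<subseteq> frontier (region (A, B, C))"
      if t: "t \<in> T" and S: "\<exists>S\<in>edges (A, B, C). supported_by t S" for t
      using only_c_supported[OF only(1) t] only_c_supported[OF only(2) t] only_c_supported[OF only(3) t] S
      unfolding fr edges_def by auto
    thus ?thesis using s by blast
  qed blast
qed

end
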